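(* Let $Y=(Y_n)_{n\in\mathbb{N}_0}$, $Y_n=\sum_{k=0}^n\sum_{i=1}^{J_k}X_{i,k}(n-k)$, be the Galton–Watson process with immigration described in the context. Suppose that $$\mathbb{P}\{\log J>x\}\sim x^{-\alpha}\ell(x),\qquad x\to\infty,$$ for some $\alpha\in(0,1]$ and some function $\ell$ slowly varying at $\infty$, and if $\alpha=1$ suppose additionally that $\lim_{x\to\infty}\ell(x)=\infty$. Let $(b_n)_{n\in\mathbb{N}}$ be positive numbers with $\lim_{n\to\infty}n\,\mathbb{P}\{\log J>b_n\}=1$. Then, as $n\to\infty$, $$\frac{\log^+\big(Y_{[n\cdot]}\big)}{b_n}\ \Rightarrow\ \sup_{t_k^{(1,\alpha)}\le\cdot} j_k^{(1,\alpha)},$$ weakly on the Skorokhod space $D[0,\infty)$ with the $J_1$-topology.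
   Context: $\mathbb{N}_0=\mathbb{N}\cup\{0\}$. The families $(X_{i,k})_{i\in\mathbb{N},k\in\mathbb{N}_0}$ and $(J_k)_{k\in\mathbb{N}_0}$ are mutually independent, each consisting of i.i.d. random objects; each $X_{i,k}=(X_{i,k}(n))_{n\in\mathbb{N}_0}$ is a Galton–Watson process with $X_{i,k}(0)=1$ and offspring mean $\mathbb{E}X_{i,k}(1)=\mu\in(0,\infty)$; each $J_k$ is a nonnegative integer-valued random variable with $\mathbb{P}\{J_k=0\}<1$, and $J$ denotes a random variable with the law of $J_k$. $\log^+x=\max(\log x,0)$, $[\cdot]$ is the integer part. For $a,b>0$, $N^{(a,b)}=\sum_{k}\varepsilon_{(t_k^{(a,b)},\,j_k^{(a,b)})}$ is a Poisson random measure on $[0,\infty)\times(0,\infty]$ with mean measure $\mathrm{Leb}\times\mu_{a,b}$, where $\mu_{a,b}((x,\infty])=ax^{-b}$ for $x>0$. The supremum over the empty set is $0$. *)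

theory Defs
  imports "HOL-Probability.Probability" "HOL-Library.Landau_Symbols"
begin

text \<open>Offspring variables xi i k n m: number of children of the m-th individual
  of generation n of the Galton--Watson process X_{i,k}.  X_{i,k}(0) = 1.\<close>
fun gw :: "(nat \<Rightarrow> nat \<Rightarrow> nat \<Rightarrow> nat \<Rightarrow> 'a \<Rightarrow> nat) \<Rightarrow> nat \<Rightarrow> nat \<Rightarrow> nat \<Rightarrow> 'a \<Rightarrow> nat" where
  "gw xi i k 0 \<omega> = 1"
| "gw xi i k (Suc n) \<omega> = (\<Sum>m<gw xi i k n \<omega>. xi i k n m \<omega>)"

definition gwi :: "(nat \<Rightarrow> nat \<Rightarrow> nat \<Rightarrow> nat \<Rightarrow> 'a \<Rightarrow> nat) \<Rightarrow> (nat \<Rightarrow> 'a \<Rightarrow> nat) \<Rightarrow> nat \<Rightarrow> 'a \<Rightarrow> nat" where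
  "gwi xi J n \<omega> = (\<Sum>k\<le>n. \<Sum>i\<in>{1..J k \<omega>}. gw xi i k (n - k) \<omega>)"

definition log_plus :: "real \<Rightarrow> real" where
  "log_plus x = (if x \<le> 1 then 0 else ln x)"

definition slowly_varying :: "(real \<Rightarrow> real) \<Rightarrow> bool" where
  "slowly_varying L \<longleftrightarrow> L \<in> borel_measurable borel \<and> (\<forall>x>0. L x > 0) \<and>
     (\<forall>c>0. ((\<lambda>x. L (c * x) / L x) \<longlongrightarrow> 1) at_top)"

text \<open>mu_{a,b} on (0,infinity]: mu((x,infinity]) = a x^(-b).\<close>
definition mu_ab :: "real \<Rightarrow> real \<Rightarrow> ennreal measure" where
  "mu_ab a b = distr (density lborel (\<lambda>x. ennreal (if x > 0 then a * b * x powr (- b - 1) else 0)))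
                     borel ennreal"

definition mean_meas :: "real \<Rightarrow> real \<Rightarrow> (real \<times> ennreal) measure" where
  "mean_meas a b = density lborel (indicator {0..}) \<Otimes>\<^sub>M mu_ab a b"

definition pcount :: "(nat \<Rightarrow> 'b \<Rightarrow> 'c) \<Rightarrow> 'b \<Rightarrow> 'c set \<Rightarrow> ennreal" where
  "pcount P \<omega> B = (\<Sum>k. indicator B (P k \<omega>))"

definition is_PRM :: "'b measure \<Rightarrow> 'c measure \<Rightarrow> (nat \<Rightarrow> 'b \<Rightarrow> 'c) \<Rightarrow> bool" where
  "is_PRM N m P \<longleftrightarrow> prob_space N \<and> (\<forall>k. P k \<in> measurable N m) \<and>
     (\<forall>B\<in>sets m. emeasure m B < \<infinity> \<longrightarrow> (\<forall>n::nat.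
        measure N {\<omega>\<in>space N. pcount P \<omega> B = of_nat n}
          = exp (- enn2real (emeasure m B)) * enn2real (emeasure m B) ^ n / fact n)) \<and>
     (\<forall>B\<in>sets m. emeasure m B = \<infinity> \<longrightarrow> (AE \<omega> in N. pcount P \<omega> B = \<infinity>)) \<and>
     (\<forall>(I::nat set) B. finite I \<longrightarrow> B ` I \<subseteq> sets m \<longrightarrow> disjoint_family_on B I \<longrightarrow>
        prob_space.indep_vars N (\<lambda>_. borel) (\<lambda>i \<omega>. pcount P \<omega> (B i)) I)"

definition cadlag :: "(real \<Rightarrow> real) \<Rightarrow> bool" where
  "cadlag x \<longleftrightarrow> (\<forall>t\<ge>0. continuous (at_right t) x) \<and> (\<forall>t>0. \<exists>l. (x \<longlongrightarrow> l) (at_left t))"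

definition time_change :: "(real \<Rightarrow> real) \<Rightarrow> bool" where
  "time_change lam \<longleftrightarrow> strict_mono_on {0..} lam \<and> continuous_on {0..} lam \<and> lam ` {0..} = {0..}"

text \<open>Convergence in the J1 topology of D[0,infinity) (Ethier--Kurtz, Prop. 3.5.3).\<close>
definition J1_conv :: "(nat \<Rightarrow> real \<Rightarrow> real) \<Rightarrow> (real \<Rightarrow> real) \<Rightarrow> bool" where
  "J1_conv xs x \<longleftrightarrow> (\<exists>lam. (\<forall>n. time_change (lam n)) \<and>
     (\<forall>T>0. \<forall>\<epsilon>>0. eventually (\<lambda>n. \<forall>t\<in>{0..T}.
         \<bar>lam n t - t\<bar> \<le> \<epsilon> \<and> \<bar>xs n (lam n t) - x t\<bar> \<le> \<epsilon>) sequentially))"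

text \<open>Bounded J1-continuous functionals on D[0,infinity) (extended measurably
  to all functions real => real w.r.t. the product sigma-algebra).\<close>
definition J1_test :: "((real \<Rightarrow> real) \<Rightarrow> real) \<Rightarrow> bool" where
  "J1_test f \<longleftrightarrow> f \<in> borel_measurable (PiM UNIV (\<lambda>_. borel)) \<and> (\<exists>B. \<forall>x. \<bar>f x\<bar> \<le> B) \<and>
     (\<forall>xs x. (\<forall>n. cadlag (xs n)) \<longrightarrow> cadlag x \<longrightarrow> J1_conv xs x \<longrightarrow> (\<lambda>n. f (xs n)) \<longlonglongrightarrow> f x)"

definition weak_conv_D :: "'a measure \<Rightarrow> (nat \<Rightarrow> 'a \<Rightarrow> real \<Rightarrow> real) \<Rightarrow> 'b measure \<Rightarrow> ('b \<Rightarrow> real \<Rightarrow> real) \<Rightarrow> bool" where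
  "weak_conv_D M Zs N Z \<longleftrightarrow> (\<forall>f. J1_test f \<longrightarrow>
     (\<lambda>n. \<integral>\<omega>. f (Zs n \<omega>) \<partial>M) \<longlonglongrightarrow> (\<integral>\<omega>. f (Z \<omega>) \<partial>N))"

end

theory Submission
  imports Defs
begin

text \<open>
  Since \<open>b\<^sub>n / n \<rightarrow> \<infinity>\<close>, the growth or decay of a Galton--Watson process over \<open>O(n)\<close> generations is
  invisible after taking logarithms and dividing by \<open>b\<^sub>n\<close>: uniformly in \<open>m \<le> nT\<close>,
  \<open>log\<^sup>+ Y\<^sub>m = max\<^sub>k\<^sub>\<le>\<^sub>m log\<^sup>+ J\<^sub>k + o(b\<^sub>n)\<close> with high probability. The upper bound is Markov's inequality
  for the conditional mean \<open>J\<^sub>k \<mu>\<^sup>m\<close>; the lower bound counts surviving lines of first children with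
  Hoeffding's inequality.

  For the running maxima, cut time and height into a fine grid and record which boxes
  \<open>block \<times> (height, \<infinity>]\<close> contain a point. The law of this finite record is determined by void probabilities,
  which converge to those of the Poisson random measure. With probability close to one
  each block carries at most one large point, and then all paths with the same record
  are J1-close to each other. Hence a bounded J1-continuous functional is almost a function of the record.
\<close>

section \<open>Time changes between step functions\<close>

text \<open>On the branching side the obstacle is that every estimate over O(n) generations costs a
  factor exp(O(n)): growth of the mean \<open>mu ^ l\<close>, or decay of the probability
  \<open>p ^ R\<close> that a line of first children survives, to be summed over all immigration
  times and ages. The threshold \<open>exp \<theta>\<close> with \<theta> of order b_n pays for all
  of this because b_n / n is unbounded; here \<alpha> < 1, or L tending to infinity if \<alpha> = 1,
  is used. Waves of immigrants below \<open>exp \<theta>\<close> are invisible at scale b_n, and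
  larger ones keep about a fraction \<open>p ^ R\<close> of their lines with high probability. On
  the path side, jump times of the rescaled process are multiples of 1/n and do not match the
  Poisson times, so paths can only be compared after a change of time. One jump time per block makes
  the matching automatic. Void probabilities suffice because exceeding a level implies exceeding
  every lower one: avoiding a set of pairs means that one finite union of disjoint boxes is empty.
  Its probability is a product over the independent J_k before the limit and one exponential in the
  limit.\<close>

lemma time_change_zero:
  assumes "time_change lam"
  shows "lam 0 = 0"
proof -
  have "0 \<in> lam ` {0..}" using assms by (auto simp: time_change_def)
  then obtain u where u: "u \<ge> 0" "lam u = 0" by auto
  have "lam 0 \<in> lam ` {0..}" by auto
  then have "lam 0 \<ge> 0" using assms by (auto simp: time_change_def)
  moreover have "lam 0 \<le> lam u"
    using assms u strict_mono_on_leD[of "{0..}" lam 0 u] by (auto simp: time_change_def)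
  ultimately show ?thesis using u by simp
qed

text \<open>Induction on the number of nodes: the time change for the first m nodes is kept up to
  \<open>s m\<close> and continued by a ray whose slope makes it hit the next node. The ray is
  unbounded, so the map stays onto the half-line.\<close>

lemma time_change_interpolate:
  fixes s t :: "nat \<Rightarrow> real"
  assumes "s 0 = 0" "t 0 = 0"
    and "\<And>i. i < m \<Longrightarrow> s i < s (Suc i)" "\<And>i. i < m \<Longrightarrow> t i < t (Suc i)"
  shows "\<exists>lam. time_change lam \<and> (\<forall>i\<le>m. lam (s i) = t i)"
  using assms(3,4)
proof (induction m)
  case 0
  have "time_change (\<lambda>x. x)" by (auto simp: time_change_def strict_mono_on_def)
  then show ?case using assms(1,2) by auto
next
  case (Suc m)
  then obtain lam where tc: "time_change lam" and lam: "\<And>i. i \<le> m \<Longrightarrow> lam (s i) = t i"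
    by (metis less_Suc_eq)
  define a where "a = s m"
  define c where "c = (t (Suc m) - t m) / (s (Suc m) - s m)"
  define lam' where "lam' = (\<lambda>u. if u \<le> a then lam u else t m + (u - a) * c)"
  have sm: "s m < s (Suc m)" and tm: "t m < t (Suc m)" using Suc.prems by auto
  have c: "c > 0" using sm tm by (simp add: c_def)
  have s_le: "s i \<le> a" if "i \<le> m" for i
    using that unfolding a_def
  proof (induction rule: inc_induct)
    case (step n)
    then show ?case using Suc.prems(1)[of n] by simp
  qed simp
  have a0: "0 \<le> a" using s_le[of 0] assms(1) by simp
  have lama: "lam a = t m" using lam[of m] by (simp add: a_def)
  have mono: "lam u < lam v" if "0 \<le> u" "u < v" for u v
    using tc that by (auto simp: time_change_def strict_mono_on_def)
  have nonneg: "0 \<le> lam u" if "0 \<le> u" for u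
    using mono[of 0 u] time_change_zero[OF tc] that by (cases "u = 0") auto
  have tm0: "0 \<le> t m" using nonneg[OF a0] lama by simp
  have "strict_mono_on {0..} lam'"
  proof (rule strict_mono_onI)
    fix u v :: real assume uv: "u \<in> {0..}" "v \<in> {0..}" "u < v"
    consider "v \<le> a" | "u \<le> a" "a < v" | "a < u" using uv by linarith
    then show "lam' u < lam' v"
    proof cases
      case 1 then show ?thesis using uv mono by (auto simp: lam'_def)
    next
      case 2
      have "lam u \<le> t m" using mono[of u a] uv 2 lama by (cases "u = a") auto
      moreover have "0 < (v - a) * c" using 2 c by simp
      ultimately show ?thesis using 2 by (simp add: lam'_def)
    next
      case 3 then show ?thesis using uv c by (simp add: lam'_def)
    qed
  qed
  moreover have "continuous_on {0..} lam'"
    unfolding lam'_def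
  proof (rule continuous_on_cases_le)
    show "continuous_on {x \<in> {0..}. x \<le> a} lam"
      using tc by (auto simp: time_change_def intro: continuous_on_subset)
  qed (auto intro!: continuous_intros simp: lama)
  moreover have "lam' ` {0..} = {0..}"
  proof (intro equalityI subsetI)
    fix v assume "v \<in> lam' ` {0..}"
    then obtain u where u: "u \<ge> 0" "v = lam' u" by auto
    show "v \<in> {0..}"
    proof (cases "u \<le> a")
      case True
      then show ?thesis using nonneg[of u] u by (simp add: lam'_def)
    next
      case False
      then have "0 \<le> (u - a) * c" using c by (intro mult_nonneg_nonneg) auto
      then show ?thesis using tm0 False u by (simp add: lam'_def)
    qed
  next
    fix v :: real assume v: "v \<in> {0..}"
    show "v \<in> lam' ` {0..}"
    proof (cases "v \<le> t m")
      case True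
      have "v \<in> lam ` {0..}" using v tc by (auto simp: time_change_def)
      then obtain u where u: "u \<ge> 0" "v = lam u" by auto
      have "u \<le> a" using mono[OF a0, of u] True u lama by fastforce
      then have "v = lam' u" using u by (simp add: lam'_def)
      then show ?thesis using u by auto
    next
      case False
      define u where "u = a + (v - t m) / c"
      have "u > a" using False c by (simp add: u_def)
      then have "lam' u = v" using c by (simp add: lam'_def u_def)
      then show ?thesis using \<open>u > a\<close> a0 by (metis atLeast_iff image_eqI less_eq_real_def order_trans)
    qed
  qed
  ultimately have "time_change lam'" by (simp add: time_change_def)
  moreover have "lam' (s i) = t i" if "i \<le> Suc m" for i
  proof (cases "i \<le> m")
    case True then show ?thesis using s_le lam by (simp add: lam'_def)
  next
    case False
    then have "i = Suc m" using that by simp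
    then show ?thesis using sm by (simp add: lam'_def a_def c_def)
  qed
  ultimately show ?case by blast
qed

text \<open>
  Level \<open>K\<close> resolves time in \<open>[0, K]\<close> into \<open>K\<^sup>5\<close> blocks of length \<open>K\<^sup>-\<^sup>4\<close> and heights into
  multiples of \<open>1/K\<close>. Blocks are this short because a Poisson configuration has about \<open>K\<^sup>\<alpha> \<le> K\<close>
  points above height \<open>1/K\<close> per unit of time, so that two of them share a block with probability
  at most \<open>1/K\<close>. A cell is a set of pairs \<open>(i, l)\<close>, read as: block \<open>i\<close> has a point above \<open>l/K\<close>.
\<close>

definition block :: "nat \<Rightarrow> nat \<Rightarrow> real set" where
  "block K i = {real i / real (K ^ 4) <.. real (Suc i) / real (K ^ 4)}"

text \<open>The inserted 0 is the height of a block without recorded point. In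
  \<open>top_height\<close> it also realises the convention that an empty supremum is 0.\<close>

definition cell_height :: "(nat \<times> nat) set \<Rightarrow> nat \<Rightarrow> nat" where
  "cell_height c i = Max (insert 0 {l. (i, l) \<in> c})"

definition top_height :: "nat \<Rightarrow> (nat \<times> nat) set \<Rightarrow> nat set \<Rightarrow> real" where
  "top_height K c I = Max (insert 0 ((\<lambda>i. real (cell_height c i) / real K) ` I))"

text \<open>Every block gets a jump time, even an empty one, whose height 0 leaves the running
  maximum unchanged. Thus any two paths with the same cell have equally many jump times to
  match.\<close>

definition step_close :: "nat \<Rightarrow> (nat \<times> nat) set \<Rightarrow> (nat \<Rightarrow> real) \<Rightarrow> real \<Rightarrow> (real \<Rightarrow> real) \<Rightarrow> bool" where
  "step_close K c \<tau> \<epsilon> y \<longleftrightarrow> (\<forall>i<K ^ 5. \<tau> i \<in> block K i) \<and>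
     (\<forall>t\<in>{0..real K}. \<bar>y t - top_height K c {i. i < K ^ 5 \<and> \<tau> i \<le> t}\<bar> \<le> \<epsilon>)"

lemma block_less:
  assumes "u \<in> block K i" "v \<in> block K j" "i < j" "K > 0"
  shows "u < v"
proof -
  have "u \<le> real (Suc i) / real (K ^ 4)" using assms by (simp add: block_def)
  also have "\<dots> \<le> real j / real (K ^ 4)"
    using assms by (intro divide_right_mono) auto
  also have "\<dots> < v" using assms by (simp add: block_def)
  finally show ?thesis .
qed

lemma block_pos: "t \<in> block K i \<Longrightarrow> 0 < t"
  by (auto simp: block_def intro: le_less_trans[of 0 "real i / real K ^ 4"])

lemma block_bounds:
  assumes "K > 0" "t \<in> block K i"
  shows "real i < real (K ^ 4) * t" "real (K ^ 4) * t \<le> real i + 1"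
  using assms by (simp_all add: block_def field_simps)

text \<open>
  Both step functions have one jump time per block and the same heights, so the time change that
  matches the jump times block by block carries one exactly onto the other.
\<close>

lemma step_close_time_change:
  assumes K: "K > 0" and y: "step_close K c \<tau> \<epsilon> y" and z: "step_close K c \<sigma> \<epsilon> z"
  shows "\<exists>lam. time_change lam \<and> (\<forall>t. 0 \<le> t \<longrightarrow> t \<le> real K - 1 \<longrightarrow>
           \<bar>lam t - t\<bar> \<le> 2 / real K \<and> \<bar>y (lam t) - z t\<bar> \<le> 2 * \<epsilon>)"
proof -
  define m where "m = K ^ 5"
  define D where "D = real (K ^ 4)"
  have D: "D > 0" using K by (simp add: D_def)
  have m: "m > 0" using K by (simp add: m_def)
  have mD: "real m / D = real K" using K by (simp add: m_def D_def divide_simps flip: power_Suc)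
  have \<tau>: "\<tau> i \<in> block K i" and \<sigma>: "\<sigma> i \<in> block K i" if "i < m" for i
    using y z that by (auto simp: step_close_def m_def)
  \<comment> \<open>The origin becomes node 0, so the jump time of block i is node
    \<open>Suc i\<close>.\<close>
  define s where "s i = (if i = 0 then 0 else \<sigma> (i - 1))" for i
  define u where "u i = (if i = 0 then 0 else \<tau> (i - 1))" for i
  have s_less: "s i < s (Suc i)" if "i < m" for i
    using \<sigma>[of "i - 1"] \<sigma>[of i] that block_less[of "\<sigma> (i - 1)" K "i - 1" "\<sigma> i" i] K
      block_pos[of "\<sigma> i"] by (cases i) (auto simp: s_def)
  have u_less: "u i < u (Suc i)" if "i < m" for i
    using \<tau>[of "i - 1"] \<tau>[of i] that block_less[of "\<tau> (i - 1)" K "i - 1" "\<tau> i" i] K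
      block_pos[of "\<tau> i"] by (cases i) (auto simp: u_def)
  obtain lam where tc: "time_change lam" and lam: "\<And>i. i \<le> m \<Longrightarrow> lam (s i) = u i"
    using time_change_interpolate[of s u m] s_less u_less by (auto simp: s_def u_def)
  have mono: "lam v \<le> lam w \<longleftrightarrow> v \<le> w" if "0 \<le> v" "0 \<le> w" for v w
    using tc that strict_mono_on_less_eq[of "{0..}" lam v w] by (auto simp: time_change_def)
  \<comment> \<open>In units of the block length, nodes i and \<open>Suc i\<close> of either
    sequence lie in the window from i - 1 to i + 1. A time and its image between these nodes
    therefore differ by at most two block lengths.\<close>
  have bnd: "real i - 1 \<le> D * s i" "D * s (Suc i) \<le> real i + 1"
    "real i - 1 \<le> D * u i" "D * u (Suc i) \<le> real i + 1" if "i < m" for i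
    using that block_bounds[OF K \<sigma>[of "i - 1"]] block_bounds[OF K \<sigma>[of i]]
      block_bounds[OF K \<tau>[of "i - 1"]] block_bounds[OF K \<tau>[of i]]
    by (cases i; simp add: s_def u_def D_def)+
  have s0: "0 \<le> s i" if "i \<le> m" for i
    using block_pos[OF \<sigma>[of "i - 1"]] that by (cases i) (auto simp: s_def less_imp_le)
  show ?thesis
  proof (intro exI[of _ lam] conjI allI impI tc)
    fix t :: real assume t: "0 \<le> t" "t \<le> real K - 1"
    \<comment> \<open>The last block starts at or after K - 1; hence the horizon K - 1 keeps t
      within the interpolated nodes.\<close>
    have "t < s m"
    proof -
      have "(real m - 1) / D < s m"
        using \<sigma>[of "m - 1"] m by (auto simp: s_def block_def D_def of_nat_diff)
      moreover have "real K - 1 \<le> (real m - 1) / D"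
        using mD D by (simp add: diff_divide_distrib D_def)
      ultimately show ?thesis using t by linarith
    qed
    define i where "i = (LEAST i. t \<le> s (Suc i))"
    have ex: "t \<le> s (Suc (m - 1))" using \<open>t < s m\<close> m by simp
    have i: "t \<le> s (Suc i)" unfolding i_def by (rule LeastI[of _ "m - 1"]) (rule ex)
    have im: "i < m" using Least_le[of "\<lambda>i. t \<le> s (Suc i)", OF ex] m by (simp add: i_def)
    have si: "s i \<le> t"
    proof (cases i)
      case 0 then show ?thesis using t by (simp add: s_def)
    next
      case (Suc j)
      then show ?thesis using not_less_Least[of j "\<lambda>i. t \<le> s (Suc i)"] by (simp add: i_def)
    qed
    have "lam (s i) \<le> lam t" "lam t \<le> lam (s (Suc i))"
      using mono si i s0[of i] s0[of "Suc i"] im t by auto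
    then have lt: "u i \<le> lam t" "lam t \<le> u (Suc i)" using lam im by auto
    have lt': "D * u i \<le> D * lam t" "D * lam t \<le> D * u (Suc i)"
       "D * s i \<le> D * t" "D * t \<le> D * s (Suc i)"
      using lt si i D by auto
    have "\<bar>D * lam t - D * t\<bar> \<le> 2"
      using lt' bnd[OF im] by linarith
    then have "D * \<bar>lam t - t\<bar> \<le> 2" using D by (simp add: abs_mult flip: right_diff_distrib)
    then have "\<bar>lam t - t\<bar> \<le> 2 / D" using D by (simp add: field_simps)
    also have "\<dots> \<le> 2 / real K" unfolding D_def using K
      by (intro divide_left_mono) (auto simp: self_le_power simp flip: of_nat_power)
    finally show "\<bar>lam t - t\<bar> \<le> 2 / real K" .
    have lt0: "0 \<le> lam t" using mono[of 0 t] t time_change_zero[OF tc] by simp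
    have "D * lam t \<le> real i + 1" using bnd[OF im] lt' by linarith
    then have "lam t \<le> real (Suc i) / D" using D by (simp add: field_simps)
    also have "\<dots> \<le> real m / D" using im D by (intro divide_right_mono) auto
    finally have ltK: "lam t \<le> real K" using mD by simp
    \<comment> \<open>The time change is increasing and maps \<sigma> to \<tau> exactly, so the same
      blocks have jumped at t and at \<open>lam t\<close>, and the two step functions coincide
      there.\<close>
    have eq: "{i. i < m \<and> \<tau> i \<le> lam t} = {i. i < m \<and> \<sigma> i \<le> t}"
    proof -
      have "\<tau> i \<le> lam t \<longleftrightarrow> \<sigma> i \<le> t" if "i < m" for i
        using lam[of "Suc i"] that mono[of "s (Suc i)" t] s0[of "Suc i"] t by (simp add: s_def u_def)
      then show ?thesis by auto
    qed
    have "\<bar>y (lam t) - top_height K c {i. i < m \<and> \<tau> i \<le> lam t}\<bar> \<le> \<epsilon>"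
      using y lt0 ltK by (auto simp: step_close_def m_def)
    moreover have "\<bar>z t - top_height K c {i. i < m \<and> \<sigma> i \<le> t}\<bar> \<le> \<epsilon>"
      using z t by (auto simp: step_close_def m_def)
    ultimately show "\<bar>y (lam t) - z t\<bar> \<le> 2 * \<epsilon>" unfolding eq by linarith
  qed
qed

text \<open>One sequence of time changes must serve all horizons and tolerances. Level K covers
  times up to K - 1 with errors 2/K in time and 4/K in space, so the sequence indexed by K is itself
  the witness. The alternative \<open>ys K = z\<close> leaves room for levels at which no common
  cell is available; there the identity is used.\<close>

lemma J1_conv_step_close:
  assumes "\<And>K. K > 0 \<Longrightarrow> ys K = z \<or>
     (\<exists>c \<tau> \<sigma>. step_close K c \<tau> (2 / real K) (ys K) \<and> step_close K c \<sigma> (2 / real K) z)"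
  shows "J1_conv ys z"
proof -
  have "\<exists>lam. time_change lam \<and> (K > 0 \<longrightarrow> (\<forall>t. 0 \<le> t \<longrightarrow> t \<le> real K - 1 \<longrightarrow>
           \<bar>lam t - t\<bar> \<le> 2 / real K \<and> \<bar>ys K (lam t) - z t\<bar> \<le> 4 / real K))" for K
  proof (cases "K > 0 \<and> ys K \<noteq> z")
    case True
    then obtain c \<tau> \<sigma> where "step_close K c \<tau> (2 / real K) (ys K)" "step_close K c \<sigma> (2 / real K) z"
      using assms[of K] by auto
    from step_close_time_change[OF _ this] True show ?thesis by auto
  next
    case False
    have "time_change (\<lambda>x. x)" by (auto simp: time_change_def strict_mono_on_def)
    then show ?thesis using False by (intro exI[of _ "\<lambda>x. x"]) auto
  qed
  then obtain lam where tc: "\<And>K. time_change (lam K)"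
    and lam: "\<And>K t. K > 0 \<Longrightarrow> 0 \<le> t \<Longrightarrow> t \<le> real K - 1 \<Longrightarrow>
           \<bar>lam K t - t\<bar> \<le> 2 / real K \<and> \<bar>ys K (lam K t) - z t\<bar> \<le> 4 / real K"
    by metis
  show ?thesis unfolding J1_conv_def
  proof (intro exI[of _ lam] conjI allI impI tc)
    fix T \<epsilon> :: real assume T: "T > 0" and \<epsilon>: "\<epsilon> > 0"
    have "eventually (\<lambda>K. K \<ge> nat \<lceil>max (T + 1) (4 / \<epsilon>)\<rceil>) sequentially"
      by (rule eventually_ge_at_top)
    then show "\<forall>\<^sub>F n in sequentially. \<forall>t\<in>{0..T}. \<bar>lam n t - t\<bar> \<le> \<epsilon> \<and> \<bar>ys n (lam n t) - z t\<bar> \<le> \<epsilon>"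
    proof eventually_elim
      case (elim K)
      then have K: "real K \<ge> max (T + 1) (4 / \<epsilon>)" by (simp add: nat_le_iff ceiling_le_iff)
      then have K0: "K > 0" using T by (cases K) auto
      have "4 \<le> \<epsilon> * real K" using K \<epsilon> by (simp add: field_simps)
      then have "4 / real K \<le> \<epsilon>" using K0 by (simp add: field_simps)
      moreover have "2 / real K \<le> 4 / real K" using K0 by (simp add: field_simps)
      ultimately show ?case using lam[OF K0] K by fastforce
    qed
  qed
qed

section \<open>Cells of point configurations\<close>

definition exceeds :: "nat \<Rightarrow> (nat \<Rightarrow> real \<times> ennreal) \<Rightarrow> nat \<Rightarrow> nat \<Rightarrow> bool" where
  "exceeds K p i l \<longleftrightarrow> (\<exists>k. fst (p k) \<in> block K i \<and> snd (p k) > ennreal (real l / real K))"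

text \<open>The cap r on the levels makes cells range over the subsets of one finite grid. Level 0
  is left out since infinitely many points may lie above it.\<close>

definition cell :: "nat \<Rightarrow> nat \<Rightarrow> (nat \<Rightarrow> real \<times> ennreal) \<Rightarrow> (nat \<times> nat) set" where
  "cell K r p = {(i, l). i < K ^ 5 \<and> 1 \<le> l \<and> l \<le> r \<and> exceeds K p i l}"

text \<open>The three ways in which a cell fails to describe the path: a visible point at time 0 or
  earlier, which no left-open block contains; two visible points in one block, whose order the cell
  does not see; a point beyond the cap. The cap is tested at \<open>Suc r\<close> because heights up
  to (r + 1)/K are still within 1/K of the recorded r/K.\<close>

definition bad :: "nat \<Rightarrow> nat \<Rightarrow> (nat \<Rightarrow> real \<times> ennreal) \<Rightarrow> bool" where
  "bad K r p \<longleftrightarrow> (\<exists>k. fst (p k) \<le> 0 \<and> snd (p k) > ennreal (1 / real K))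
     \<or> (\<exists>i<K ^ 5. \<exists>k k'. k \<noteq> k' \<and> fst (p k) \<in> block K i \<and> snd (p k) > ennreal (1 / real K)
           \<and> fst (p k') \<in> block K i \<and> snd (p k') > ennreal (1 / real K))
     \<or> (\<exists>k. fst (p k) \<le> real K \<and> snd (p k) > ennreal (real (Suc r) / real K))"

text \<open>The supremum is formed in \<open>ennreal\<close>, where the empty one is 0. An infinite
  supremum would be sent to 0 by \<open>enn2real\<close>; \<open>cadlag_sup_path\<close> excludes
  this under its finiteness assumptions.\<close>

definition sup_path :: "(nat \<Rightarrow> real \<times> ennreal) \<Rightarrow> real \<Rightarrow> real" where
  "sup_path p t = enn2real (SUP k\<in>{k. fst (p k) \<le> t}. snd (p k))"

lemma in_some_block:
  assumes "K > 0" "0 < t" "t \<le> real K"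
  shows "\<exists>i<K ^ 5. t \<in> block K i"
proof -
  define D where "D = real (K ^ 4)"
  have D: "D > 0" using assms by (simp add: D_def)
  \<comment> \<open>Ceiling minus one rather than floor, because blocks are closed on the
    right.\<close>
  define j where "j = nat (\<lceil>t * D\<rceil> - 1)"
  have pos: "0 < t * D" using assms D by simp
  have j: "real j = of_int \<lceil>t * D\<rceil> - 1" using pos by (simp add: j_def)
  have "real j < t * D" "t * D \<le> real j + 1" unfolding j by linarith+
  then have "t \<in> block K j" using D by (simp add: block_def D_def field_simps)
  moreover have "j < K ^ 5"
  proof -
    have "t * D \<le> real K * D" using assms D by (intro mult_right_mono) auto
    also have "\<dots> = real (K ^ 5)" by (simp add: D_def flip: power_Suc)
    finally have "real j < real (K ^ 5)" using \<open>real j < t * D\<close> by linarith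
    then show ?thesis by simp
  qed
  ultimately show ?thesis by blast
qed

text \<open>In a good configuration a block has at most one visible point; it supplies the jump
  time, and its height exceeds the recorded multiple of 1/K by at most 1/K. Points below 1/K raise
  the supremum by at most 1/K as well, so the step function lies below the path by at most
  1/K.\<close>

lemma step_close_sup_path:
  assumes K: "K > 0" and good: "\<not> bad K r p"
  shows "\<exists>\<tau>. step_close K (cell K r p) \<tau> (1 / real K) (sup_path p)"
proof -
  define c where "c = cell K r p"
  let ?big = "\<lambda>i k. fst (p k) \<in> block K i \<and> snd (p k) > ennreal (1 / real K)"
  \<comment> \<open>An empty block gets its right endpoint, which belongs to it and carries height
    0.\<close>
  define \<tau> where "\<tau> i = (if \<exists>k. ?big i k then fst (p (SOME k. ?big i k)) else real (Suc i) / real (K ^ 4))" for i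
  have uniq: "k = k'" if "?big i k" "?big i k'" "i < K ^ 5" for i k k'
    using good that unfolding bad_def by blast
  have \<tau>_big: "\<tau> i = fst (p k)" if "?big i k" "i < K ^ 5" for i k
  proof -
    have "?big i (SOME k. ?big i k)" by (rule someI[of "\<lambda>k. ?big i k" k, OF that(1)])
    from uniq[OF this that] have "(SOME k. ?big i k) = k" .
    then show ?thesis using that by (auto simp: \<tau>_def)
  qed
  have \<tau>: "\<tau> i \<in> block K i" if "i < K ^ 5" for i
  proof (cases "\<exists>k. ?big i k")
    case True then show ?thesis using \<tau>_big that by metis
  next
    case False
    then have "\<tau> i = real (Suc i) / real (K ^ 4)" unfolding \<tau>_def by (simp only: if_False)
    then show ?thesis using K by (simp add: block_def divide_strict_right_mono)
  qed
  have fin: "finite {l. (i, l) \<in> c}" for i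
    by (rule finite_subset[of _ "{..r}"]) (auto simp: c_def cell_def)
  have h_le: "real l / real K \<le> top_height K c I" if "(i, l) \<in> c" "i \<in> I" "finite I" for i l I
  proof -
    have "l \<le> cell_height c i" using that fin[of i] by (auto simp: cell_height_def intro!: Max_ge)
    then have "real l / real K \<le> real (cell_height c i) / real K" by (intro divide_right_mono) auto
    also have "\<dots> \<le> top_height K c I" using that by (auto simp: top_height_def intro!: Max_ge)
    finally show ?thesis .
  qed
  have "\<bar>sup_path p t - top_height K c {i. i < K ^ 5 \<and> \<tau> i \<le> t}\<bar> \<le> 1 / real K" if t: "t \<in> {0..real K}" for t
  proof -
    define I where "I = {i. i < K ^ 5 \<and> \<tau> i \<le> t}"
    have finI: "finite I" by (simp add: I_def)
    have top0: "0 \<le> top_height K c I" using finI by (auto simp: top_height_def intro!: Max_ge)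
    define S where "S = (SUP k\<in>{k. fst (p k) \<le> t}. snd (p k))"
    have le: "snd (p k) \<le> ennreal (top_height K c I + 1 / real K)" if k: "fst (p k) \<le> t" for k
    proof (cases "snd (p k) > ennreal (1 / real K)")
      case False
      then have "snd (p k) \<le> ennreal (1 / real K)" by simp
      also have "\<dots> \<le> ennreal (top_height K c I + 1 / real K)" using top0 by (intro ennreal_leI) auto
      finally show ?thesis .
    next
      case True
      then have "fst (p k) > 0" using good unfolding bad_def by (meson not_le)
      moreover have kK: "fst (p k) \<le> real K" using k t by simp
      ultimately obtain i where i: "i < K ^ 5" "fst (p k) \<in> block K i" using in_some_block[OF K] by blast
      have iI: "i \<in> I" using \<tau>_big[OF conjI[OF i(2) True] i(1)] i k by (simp add: I_def)
      define l where "l = cell_height c i"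
      have lr: "l \<le> r" unfolding l_def cell_height_def using fin[of i]
        by (subst Max_le_iff) (auto simp: c_def cell_def)
      have "snd (p k) \<le> ennreal (real (Suc l) / real K)"
      \<comment> \<open>At the cap the third clause of \<open>bad\<close> bounds the point; below
        it, a higher point would have been recorded as \<open>Suc l\<close>.\<close>
      proof (cases "l = r")
        case True
        show ?thesis unfolding True using good kK unfolding bad_def by (meson not_le)
      next
        case False
        show ?thesis
        proof (rule ccontr)
          assume "\<not> ?thesis"
          then have "exceeds K p i (Suc l)" using i unfolding exceeds_def by (auto simp: not_le)
          then have "(i, Suc l) \<in> c" using False lr i by (auto simp: c_def cell_def)
          then have "Suc l \<le> cell_height c i" using fin[of i] by (auto simp: cell_height_def intro!: Max_ge)
          then show False by (simp add: l_def)
        qed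
      qed
      also have "\<dots> \<le> ennreal (top_height K c I + 1 / real K)"
      proof (rule ennreal_leI)
        have "real l / real K \<le> top_height K c I"
          using iI finI by (auto simp: top_height_def l_def intro!: Max_ge)
        then show "real (Suc l) / real K \<le> top_height K c I + 1 / real K"
          by (simp add: add_divide_distrib)
      qed
      finally show ?thesis .
    qed
    have S_le: "S \<le> ennreal (top_height K c I + 1 / real K)"
      unfolding S_def by (rule SUP_least) (use le in auto)
    then have up: "sup_path p t \<le> top_height K c I + 1 / real K"
      using top0 by (auto simp: sup_path_def S_def intro!: enn2real_leI)
    have Sfin: "S < \<top>" using S_le by (rule le_less_trans) simp
    have low1: "real (cell_height c i) / real K \<le> sup_path p t" if i: "i \<in> I" for i
    proof (cases "cell_height c i = 0")
      case True then show ?thesis by (simp add: sup_path_def)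
    next
      case False
      have "cell_height c i \<in> insert 0 {l. (i, l) \<in> c}" unfolding cell_height_def using fin[of i] by (intro Max_in) auto
      then have hc: "(i, cell_height c i) \<in> c" using False by auto
      then obtain k where k: "fst (p k) \<in> block K i" "snd (p k) > ennreal (real (cell_height c i) / real K)"
        by (auto simp: c_def cell_def exceeds_def)
      have "ennreal (1 / real K) \<le> ennreal (real (cell_height c i) / real K)"
        using False by (intro ennreal_leI divide_right_mono) auto
      then have "?big i k" using k le_less_trans by blast
      then have "\<tau> i = fst (p k)" using \<tau>_big i by (auto simp: I_def)
      then have "snd (p k) \<le> S" unfolding S_def using i by (intro SUP_upper) (auto simp: I_def)
      then have "ennreal (real (cell_height c i) / real K) \<le> S" using k by (meson less_imp_le order_trans)
      then have "enn2real (ennreal (real (cell_height c i) / real K)) \<le> enn2real S"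
        using Sfin by (rule enn2real_mono)
      then show ?thesis by (simp add: sup_path_def S_def)
    qed
    have "top_height K c I \<le> sup_path p t"
      unfolding top_height_def using finI low1 by (subst Max_le_iff) (auto simp: sup_path_def)
    then show ?thesis using up by (simp add: I_def)
  qed
  then show ?thesis using \<tau> unfolding step_close_def c_def by blast
qed

section \<open>From void probabilities to weak convergence on D\<close>

text \<open>Inclusion-exclusion: avoiding S while containing \<open>insert a A\<close> is avoiding S
  while containing A, minus avoiding \<open>insert a S\<close> while containing A. By induction on A
  all probabilities on the finite grid are signed sums of void probabilities. The induction keeps S
  arbitrary because it grows in each step.\<close>

lemma void_probabilities_determine_limit:
  fixes c :: "nat \<Rightarrow> 'a \<Rightarrow> 'c set" and C :: "'b \<Rightarrow> 'c set"
  assumes M: "prob_space M" and N: "prob_space N" and G: "finite G"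
    and c: "\<And>n \<omega>. c n \<omega> \<subseteq> G" and C: "\<And>\<omega>. C \<omega> \<subseteq> G"
    and cm: "\<And>n x. {\<omega>\<in>space M. x \<in> c n \<omega>} \<in> sets M"
    and Cm: "\<And>x. {\<omega>\<in>space N. x \<in> C \<omega>} \<in> sets N"
    and void: "\<And>S. S \<subseteq> G \<Longrightarrow> (\<lambda>n. measure M {\<omega>\<in>space M. c n \<omega> \<inter> S = {}})
                  \<longlonglongrightarrow> measure N {\<omega>\<in>space N. C \<omega> \<inter> S = {}}"
    and A: "A \<subseteq> G"
  shows "(\<lambda>n. measure M {\<omega>\<in>space M. c n \<omega> = A}) \<longlonglongrightarrow> measure N {\<omega>\<in>space N. C \<omega> = A}"
proof -
  interpret M: prob_space M by (rule M)
  interpret N: prob_space N by (rule N)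
  have mM: "{\<omega>\<in>space M. c n \<omega> \<inter> S = {} \<and> A \<subseteq> c n \<omega>} \<in> sets M" if "A \<subseteq> G" "S \<subseteq> G" for n S A
  proof -
    have "{\<omega>\<in>space M. c n \<omega> \<inter> S = {} \<and> A \<subseteq> c n \<omega>} =
       {\<omega>\<in>space M. (\<forall>x\<in>S. \<not> x \<in> c n \<omega>) \<and> (\<forall>x\<in>A. x \<in> c n \<omega>)}" by auto
    also have "\<dots> \<in> sets M" using that finite_subset[OF _ G]
      by (intro sets.sets_Collect sets.sets_Collect_finite_All' sets.sets_Collect_finite_All cm) auto
    finally show ?thesis .
  qed
  have mN: "{\<omega>\<in>space N. C \<omega> \<inter> S = {} \<and> A \<subseteq> C \<omega>} \<in> sets N" if "A \<subseteq> G" "S \<subseteq> G" for S A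
  proof -
    have "{\<omega>\<in>space N. C \<omega> \<inter> S = {} \<and> A \<subseteq> C \<omega>} =
       {\<omega>\<in>space N. (\<forall>x\<in>S. \<not> x \<in> C \<omega>) \<and> (\<forall>x\<in>A. x \<in> C \<omega>)}" by auto
    also have "\<dots> \<in> sets N" using that finite_subset[OF _ G]
      by (intro sets.sets_Collect sets.sets_Collect_finite_All' sets.sets_Collect_finite_All Cm) auto
    finally show ?thesis .
  qed
  have gen: "(\<lambda>n. measure M {\<omega>\<in>space M. c n \<omega> \<inter> S = {} \<and> A \<subseteq> c n \<omega>})
          \<longlonglongrightarrow> measure N {\<omega>\<in>space N. C \<omega> \<inter> S = {} \<and> A \<subseteq> C \<omega>}"
    if "finite A" "A \<subseteq> G" "S \<subseteq> G" for A S
    using that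
  proof (induction A arbitrary: S rule: finite_induct)
    case empty
    then show ?case using void[of S] by simp
  next
    case (insert a A)
    have eqM: "measure M {\<omega>\<in>space M. c n \<omega> \<inter> S = {} \<and> insert a A \<subseteq> c n \<omega>} =
       measure M {\<omega>\<in>space M. c n \<omega> \<inter> S = {} \<and> A \<subseteq> c n \<omega>} -
       measure M {\<omega>\<in>space M. c n \<omega> \<inter> insert a S = {} \<and> A \<subseteq> c n \<omega>}" for n
    proof -
      have "{\<omega>\<in>space M. c n \<omega> \<inter> S = {} \<and> insert a A \<subseteq> c n \<omega>} =
         {\<omega>\<in>space M. c n \<omega> \<inter> S = {} \<and> A \<subseteq> c n \<omega>} - {\<omega>\<in>space M. c n \<omega> \<inter> insert a S = {} \<and> A \<subseteq> c n \<omega>}"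
        by auto
      then show ?thesis using insert.prems by (simp only:) (intro M.finite_measure_Diff mM, auto)
    qed
    have eqN: "measure N {\<omega>\<in>space N. C \<omega> \<inter> S = {} \<and> insert a A \<subseteq> C \<omega>} =
       measure N {\<omega>\<in>space N. C \<omega> \<inter> S = {} \<and> A \<subseteq> C \<omega>} -
       measure N {\<omega>\<in>space N. C \<omega> \<inter> insert a S = {} \<and> A \<subseteq> C \<omega>}"
    proof -
      have "{\<omega>\<in>space N. C \<omega> \<inter> S = {} \<and> insert a A \<subseteq> C \<omega>} =
         {\<omega>\<in>space N. C \<omega> \<inter> S = {} \<and> A \<subseteq> C \<omega>} - {\<omega>\<in>space N. C \<omega> \<inter> insert a S = {} \<and> A \<subseteq> C \<omega>}"
        by auto
      then show ?thesis using insert.prems by (simp only:) (intro N.finite_measure_Diff mN, auto)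
    qed
    show ?case unfolding eqM eqN using insert.prems
      by (intro tendsto_diff insert.IH) auto
  qed
  have "{\<omega>\<in>space M. c n \<omega> = A} = {\<omega>\<in>space M. c n \<omega> \<inter> (G - A) = {} \<and> A \<subseteq> c n \<omega>}" for n
    using c[of n] by blast
  moreover have "{\<omega>\<in>space N. C \<omega> = A} = {\<omega>\<in>space N. C \<omega> \<inter> (G - A) = {} \<and> A \<subseteq> C \<omega>}"
    using C by blast
  ultimately show ?thesis using gen[of A "G - A"] A finite_subset[OF A G] by simp
qed

text \<open>Only the level sets of X need to be measurable, so g may be any function of the cell, in
  particular a supremum over uncountably many paths.\<close>

lemma integral_finite_range:
  fixes g :: "'c \<Rightarrow> real"
  assumes M: "prob_space M" and F: "finite F" and X: "\<And>\<omega>. X \<omega> \<in> F"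
    and m: "\<And>A. A \<in> F \<Longrightarrow> {\<omega>\<in>space M. X \<omega> = A} \<in> sets M"
  shows "integrable M (\<lambda>\<omega>. g (X \<omega>))"
    and "(\<integral>\<omega>. g (X \<omega>) \<partial>M) = (\<Sum>A\<in>F. g A * measure M {\<omega>\<in>space M. X \<omega> = A})"
proof -
  interpret prob_space M by (rule M)
  have eq: "g (X \<omega>) = (\<Sum>A\<in>F. g A * indicator {\<omega>\<in>space M. X \<omega> = A} \<omega>)" if "\<omega> \<in> space M" for \<omega>
  proof -
    have "(\<Sum>A\<in>F. g A * indicator {\<omega>\<in>space M. X \<omega> = A} \<omega>) = (\<Sum>A\<in>F. if X \<omega> = A then g A else 0)"
      using that by (intro sum.cong) (auto simp: indicator_def)
    then show ?thesis using F X by simp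
  qed
  have int: "integrable M (\<lambda>\<omega>. g A * indicator {\<omega>\<in>space M. X \<omega> = A} \<omega>)" if "A \<in> F" for A
    using m[OF that] by (intro integrable_mult_right integrable_real_indicator) (auto simp: emeasure_eq_measure)
  show "integrable M (\<lambda>\<omega>. g (X \<omega>))"
    by (subst Bochner_Integration.integrable_cong[OF refl eq]) (auto intro!: Bochner_Integration.integrable_sum int)
  show "(\<integral>\<omega>. g (X \<omega>) \<partial>M) = (\<Sum>A\<in>F. g A * measure M {\<omega>\<in>space M. X \<omega> = A})"
  proof -
    have "(\<integral>\<omega>. g (X \<omega>) \<partial>M) = (\<integral>\<omega>. (\<Sum>A\<in>F. g A * indicator {\<omega>\<in>space M. X \<omega> = A} \<omega>) \<partial>M)"
      by (rule Bochner_Integration.integral_cong[OF refl eq])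
    also have "\<dots> = (\<Sum>A\<in>F. \<integral>\<omega>. g A * indicator {\<omega>\<in>space M. X \<omega> = A} \<omega> \<partial>M)"
      by (rule Bochner_Integration.integral_sum) (rule int)
    also have "\<dots> = (\<Sum>A\<in>F. g A * measure M {\<omega>\<in>space M. X \<omega> = A})"
      using m by (intro sum.cong) (auto simp: Int_absorb2 sets.sets_into_space)
    finally show ?thesis .
  qed
qed

text \<open>The tolerance 2/K has two sources: 1/K from the height resolution and 1/K from replacing
  the process by the running maximum of its points.\<close>

definition near :: "nat \<Rightarrow> (nat \<times> nat) set \<Rightarrow> (real \<Rightarrow> real) set" where
  "near K c = {y. cadlag y \<and> (\<exists>\<tau>. step_close K c \<tau> (2 / real K) y)}"

lemma cell_subset: "cell K r p \<subseteq> {..<K ^ 5} \<times> {1..r}"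
  by (auto simp: cell_def)

lemma sets_mem_cell:
  assumes "\<And>k. (\<lambda>\<omega>. fst (p \<omega> k)) \<in> borel_measurable M" "\<And>k. (\<lambda>\<omega>. snd (p \<omega> k)) \<in> borel_measurable M"
  shows "{\<omega>\<in>space M. x \<in> cell K r (p \<omega>)} \<in> sets M"
proof -
  note [measurable] = assms
  have "{\<omega>\<in>space M. x \<in> cell K r (p \<omega>)} = {\<omega>\<in>space M. (fst x < K ^ 5 \<and> 1 \<le> snd x \<and> snd x \<le> r) \<and>
     (\<exists>k. fst (p \<omega> k) \<in> block K (fst x) \<and> ennreal (real (snd x) / real K) < snd (p \<omega> k))}"
    by (auto simp: cell_def exceeds_def)
  also have "\<dots> \<in> sets M" unfolding block_def by measurable
  finally show ?thesis .
qed

lemma sets_bad: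
  assumes "\<And>k. (\<lambda>\<omega>. fst (p \<omega> k)) \<in> borel_measurable M" "\<And>k. (\<lambda>\<omega>. snd (p \<omega> k)) \<in> borel_measurable M"
  shows "{\<omega>\<in>space M. bad K r (p \<omega>)} \<in> sets M"
proof -
  note [measurable] = assms
  show ?thesis unfolding bad_def block_def by measurable
qed

text \<open>The index set of the supremum depends on \<omega>; giving excluded points the harmless
  value 0 turns it into a countable supremum over all k.\<close>

lemma sup_path_measurable:
  assumes "\<And>k. (\<lambda>\<omega>. fst (p \<omega> k)) \<in> borel_measurable M" "\<And>k. (\<lambda>\<omega>. snd (p \<omega> k)) \<in> borel_measurable M"
  shows "(\<lambda>\<omega>. sup_path (p \<omega>)) \<in> measurable M (PiM UNIV (\<lambda>_. borel))"
proof (rule measurable_PiM_single')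
  note [measurable] = assms
  fix t :: real
  have "(SUP k\<in>{k. fst (p \<omega> k) \<le> t}. snd (p \<omega> k)) = (SUP k. if fst (p \<omega> k) \<le> t then snd (p \<omega> k) else 0)" for \<omega>
  proof (rule antisym)
    show "(SUP k\<in>{k. fst (p \<omega> k) \<le> t}. snd (p \<omega> k)) \<le> (SUP k. if fst (p \<omega> k) \<le> t then snd (p \<omega> k) else 0)"
      by (rule SUP_least, rule SUP_upper2) auto
    show "(SUP k. if fst (p \<omega> k) \<le> t then snd (p \<omega> k) else 0) \<le> (SUP k\<in>{k. fst (p \<omega> k) \<le> t}. snd (p \<omega> k))"
      by (rule SUP_least) (auto intro: SUP_upper)
  qed
  then have "(\<lambda>\<omega>. sup_path (p \<omega>) t) = (\<lambda>\<omega>. enn2real (SUP k. if fst (p \<omega> k) \<le> t then snd (p \<omega> k) else 0))"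
    by (simp only: sup_path_def)
  also have "\<dots> \<in> borel_measurable M" by measurable
  finally show "(\<lambda>\<omega>. sup_path (p \<omega>) t) \<in> borel_measurable M" .
qed auto

text \<open>
  The cell of a configuration takes finitely many values, so the oscillation of a test function over
  all paths near a cell is a random variable without further measurability concerns. J1-continuity
  makes it vanish along the cells of the limiting configuration as \<open>K\<close> grows.
\<close>

lemma weak_conv_D_point_configurations:
  fixes p :: "nat \<Rightarrow> 'a \<Rightarrow> nat \<Rightarrow> real \<times> ennreal" and P :: "'b \<Rightarrow> nat \<Rightarrow> real \<times> ennreal"
    and r :: "nat \<Rightarrow> nat"
  assumes M: "prob_space M" and N: "prob_space N"
    and pm: "\<And>n k. (\<lambda>\<omega>. fst (p n \<omega> k)) \<in> borel_measurable M" "\<And>n k. (\<lambda>\<omega>. snd (p n \<omega> k)) \<in> borel_measurable M"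
    and Pm: "\<And>k. (\<lambda>\<omega>. fst (P \<omega> k)) \<in> borel_measurable N" "\<And>k. (\<lambda>\<omega>. snd (P \<omega> k)) \<in> borel_measurable N"
    and Zm: "\<And>n. Zs n \<in> measurable M (PiM UNIV (\<lambda>_. borel))"
    and Zc: "\<And>n \<omega>. cadlag (Zs n \<omega>)"
    and Pc: "AE \<omega> in N. cadlag (sup_path (P \<omega>))"
    and void: "\<And>K S. K > 0 \<Longrightarrow> S \<subseteq> {..<K ^ 5} \<times> {1..r K} \<Longrightarrow>
        (\<lambda>n. measure M {\<omega>\<in>space M. cell K (r K) (p n \<omega>) \<inter> S = {}})
          \<longlonglongrightarrow> measure N {\<omega>\<in>space N. cell K (r K) (P \<omega>) \<inter> S = {}}"
    and badM: "\<And>K. K > 0 \<Longrightarrow> \<forall>\<^sub>F n in sequentially. \<exists>E\<in>sets M. measure M E \<le> 4 / real K \<and>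
        (\<forall>\<omega>\<in>space M - E. \<not> bad K (r K) (p n \<omega>) \<and>
           (\<forall>t\<in>{0..real K}. \<bar>Zs n \<omega> t - sup_path (p n \<omega>) t\<bar> \<le> 1 / real K))"
    and badN: "\<And>K. K > 0 \<Longrightarrow> measure N {\<omega>\<in>space N. bad K (r K) (P \<omega>)} \<le> 4 / real K"
  shows "weak_conv_D M Zs N (\<lambda>\<omega>. sup_path (P \<omega>))"
  unfolding weak_conv_D_def
proof (intro allI impI)
  fix f assume f: "J1_test f"
  interpret M: prob_space M by (rule M)
  interpret N: prob_space N by (rule N)
  from f obtain B where B: "\<And>x. \<bar>f x\<bar> \<le> B" and fm[measurable]: "f \<in> borel_measurable (PiM UNIV (\<lambda>_. borel))"
    and fc: "\<And>xs x. (\<And>n. cadlag (xs n)) \<Longrightarrow> cadlag x \<Longrightarrow> J1_conv xs x \<Longrightarrow> (\<lambda>n. f (xs n)) \<longlonglongrightarrow> f x"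
    unfolding J1_test_def by blast
  have B0: "0 \<le> B" using B[of undefined] by linarith
  \<comment> \<open>On each cell f is replaced by its value at one arbitrary path near that cell,
    which makes it a function of finitely many values.\<close>
  define rep where "rep K c = (SOME y. y \<in> near K c)" for K c
  define F where "F K c = f (rep K c)" for K c
  \<comment> \<open>A cell without nearby path gets oscillation 0 explicitly, since a real supremum
    over the empty set carries no information.\<close>
  define Osc where "Osc K c = (if near K c = {} then 0 else (SUP y\<in>near K c. \<bar>f y - F K c\<bar>))" for K c
  have diff_le: "\<bar>f y - F K c\<bar> \<le> 2 * B" for y K c
    using B[of y] B[of "rep K c"] by (simp add: F_def)
  have bdd: "bdd_above ((\<lambda>y. \<bar>f y - F K c\<bar>) ` near K c)" for K c
    by (rule bdd_aboveI2[of _ _ "2 * B"]) (rule diff_le)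
  have Osc_upper: "\<bar>f y - F K c\<bar> \<le> Osc K c" if "y \<in> near K c" for y K c
    using that bdd by (auto simp: Osc_def intro!: cSUP_upper)
  have Osc0: "0 \<le> Osc K c" for K c
  proof (cases "near K c = {}")
    case False
    then obtain y where "y \<in> near K c" by auto
    from Osc_upper[OF this] show ?thesis by linarith
  qed (simp add: Osc_def)
  have OscB: "Osc K c \<le> 2 * B" for K c
    using B0 diff_le by (auto simp: Osc_def intro!: cSUP_least)
  define cM where "cM K n \<omega> = cell K (r K) (p n \<omega>)" for K n \<omega>
  define cN where "cN K \<omega> = cell K (r K) (P \<omega>)" for K \<omega>
  define G where "G K = {..<K ^ 5} \<times> {1..r K}" for K
  have finG: "finite (G K)" for K by (simp add: G_def)
  have cMG: "cM K n \<omega> \<subseteq> G K" for K n \<omega>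
    unfolding cM_def G_def by (rule cell_subset)
  have cNG: "cN K \<omega> \<subseteq> G K" for K \<omega>
    unfolding cN_def G_def by (rule cell_subset)
  have memM: "{\<omega>\<in>space M. x \<in> cM K n \<omega>} \<in> sets M" for K n x
    unfolding cM_def by (rule sets_mem_cell) (rule pm)+
  have memN: "{\<omega>\<in>space N. x \<in> cN K \<omega>} \<in> sets N" for K x
    unfolding cN_def by (rule sets_mem_cell) (rule Pm)+
  have eqM: "{\<omega>\<in>space M. cM K n \<omega> = A} \<in> sets M" if "A \<subseteq> G K" for K n A
  proof -
    have "{\<omega>\<in>space M. cM K n \<omega> = A} = {\<omega>\<in>space M. (\<forall>x\<in>G K. (x \<in> cM K n \<omega>) = (x \<in> A))}"
      using cMG[of K n] that by (intro Collect_cong conj_cong refl) blast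
    also have "\<dots> \<in> sets M"
    proof (rule sets.sets_Collect_finite_All)
      show "{\<omega>\<in>space M. (x \<in> cM K n \<omega>) = (x \<in> A)} \<in> sets M" for x
        using memM[of x K n] sets.sets_Collect_neg[OF memM[of x K n]] by (cases "x \<in> A") simp_all
    qed (rule finG)
    finally show ?thesis .
  qed
  have eqN: "{\<omega>\<in>space N. cN K \<omega> = A} \<in> sets N" if "A \<subseteq> G K" for K A
  proof -
    have "{\<omega>\<in>space N. cN K \<omega> = A} = {\<omega>\<in>space N. (\<forall>x\<in>G K. (x \<in> cN K \<omega>) = (x \<in> A))}"
      using cNG[of K] that by (intro Collect_cong conj_cong refl) blast
    also have "\<dots> \<in> sets N"
    proof (rule sets.sets_Collect_finite_All)
      show "{\<omega>\<in>space N. (x \<in> cN K \<omega>) = (x \<in> A)} \<in> sets N" for x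
        using memN[of x K] sets.sets_Collect_neg[OF memN[of x K]] by (cases "x \<in> A") simp_all
    qed (rule finG)
    finally show ?thesis .
  qed
  have intM: "integrable M (\<lambda>\<omega>. g (cM K n \<omega>))"
      "(\<integral>\<omega>. g (cM K n \<omega>) \<partial>M) = (\<Sum>A\<in>Pow (G K). g A * measure M {\<omega>\<in>space M. cM K n \<omega> = A})"
    for g :: "_ \<Rightarrow> real" and K n
    by (rule integral_finite_range[OF M, where F="Pow (G K)"]; simp add: finG cMG eqM)+
  have intN: "integrable N (\<lambda>\<omega>. g (cN K \<omega>))"
      "(\<integral>\<omega>. g (cN K \<omega>) \<partial>N) = (\<Sum>A\<in>Pow (G K). g A * measure N {\<omega>\<in>space N. cN K \<omega> = A})"
    for g :: "_ \<Rightarrow> real" and K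
    by (rule integral_finite_range[OF N, where F="Pow (G K)"]; simp add: finG cNG eqN)+
  have conv: "(\<lambda>n. \<integral>\<omega>. g (cM K n \<omega>) \<partial>M) \<longlonglongrightarrow> (\<integral>\<omega>. g (cN K \<omega>) \<partial>N)" if K: "K > 0" for g :: "_ \<Rightarrow> real" and K
    unfolding intM(2)[of g K] intN(2)[of g K]
  proof (intro tendsto_sum tendsto_mult tendsto_const)
    fix A assume A: "A \<in> Pow (G K)"
    show "(\<lambda>n. measure M {\<omega>\<in>space M. cM K n \<omega> = A}) \<longlonglongrightarrow> measure N {\<omega>\<in>space N. cN K \<omega> = A}"
    proof (rule void_probabilities_determine_limit[where G="G K" and c="cM K" and C="cN K",
          OF M N finG cMG cNG memM memN])
      show "(\<lambda>n. measure M {\<omega>\<in>space M. cM K n \<omega> \<inter> S = {}}) \<longlonglongrightarrow> measure N {\<omega>\<in>space N. cN K \<omega> \<inter> S = {}}"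
        if "S \<subseteq> G K" for S
        using void[OF K, of S] that unfolding cM_def cN_def G_def by blast
    qed (use A in simp)
  qed
  have fZ: "integrable M (\<lambda>\<omega>. f (Zs n \<omega>))" for n
    using B by (intro M.integrable_const_bound[of _ B] measurable_compose[OF Zm fm]) auto
  have fP: "integrable N (\<lambda>\<omega>. f (sup_path (P \<omega>)))"
    using B by (intro N.integrable_const_bound[of _ B] measurable_compose[OF sup_path_measurable[OF Pm] fm]) auto
  have nearI: "y \<in> near K (cell K (r K) q)"
    if K: "K > 0" and nb: "\<not> bad K (r K) q" and cy: "cadlag y" and cl: "\<And>t. t \<in> {0..real K} \<Longrightarrow> \<bar>y t - sup_path q t\<bar> \<le> 1 / real K" for y q K
  proof -
    obtain \<tau> where \<tau>: "step_close K (cell K (r K) q) \<tau> (1 / real K) (sup_path q)"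
      using step_close_sup_path[OF K nb] by blast
    have "step_close K (cell K (r K) q) \<tau> (2 / real K) y"
      unfolding step_close_def
    proof (intro conjI ballI)
      fix t assume t: "t \<in> {0..real K}"
      then have "\<bar>sup_path q t - top_height K (cell K (r K) q) {i. i < K ^ 5 \<and> \<tau> i \<le> t}\<bar> \<le> 1 / real K"
        using \<tau> by (simp add: step_close_def)
      then show "\<bar>y t - top_height K (cell K (r K) q) {i. i < K ^ 5 \<and> \<tau> i \<le> t}\<bar> \<le> 2 / real K"
        using cl[OF t] by linarith
    qed (use \<tau> in \<open>auto simp: step_close_def\<close>)
    then show ?thesis using cy by (auto simp: near_def)
  qed
  define badE where "badE K = {\<omega>\<in>space N. bad K (r K) (P \<omega>)}" for K
  have badE: "badE K \<in> sets N" for K unfolding badE_def by (rule sets_bad) (rule Pm)+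
  \<comment> \<open>Off E the path is near its own cell, so the error is the oscillation. On E it is
    at most 2B, and E has probability at most 4/K, whence 8B/K.\<close>
  have boundM: "\<forall>\<^sub>F n in sequentially. \<bar>(\<integral>\<omega>. f (Zs n \<omega>) \<partial>M) - (\<integral>\<omega>. F K (cM K n \<omega>) \<partial>M)\<bar>
      \<le> (\<integral>\<omega>. Osc K (cM K n \<omega>) \<partial>M) + 8 * B / real K" if K: "K > 0" for K
    using badM[OF K]
  proof eventually_elim
    case (elim n)
    then obtain E where E: "E \<in> sets M" "measure M E \<le> 4 / real K"
      and good: "\<And>\<omega>. \<omega> \<in> space M - E \<Longrightarrow> \<not> bad K (r K) (p n \<omega>)"
        "\<And>\<omega> t. \<omega> \<in> space M - E \<Longrightarrow> t\<in>{0..real K} \<Longrightarrow> \<bar>Zs n \<omega> t - sup_path (p n \<omega>) t\<bar> \<le> 1 / real K"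
      by blast
    have iE: "integrable M (\<lambda>\<omega>. 2 * B * indicator E \<omega>)"
      using E by (intro integrable_mult_right integrable_real_indicator) (auto simp: M.emeasure_eq_measure)
    have "\<bar>(\<integral>\<omega>. f (Zs n \<omega>) \<partial>M) - (\<integral>\<omega>. F K (cM K n \<omega>) \<partial>M)\<bar> = \<bar>\<integral>\<omega>. f (Zs n \<omega>) - F K (cM K n \<omega>) \<partial>M\<bar>"
      by (simp add: fZ intM(1))
    also have "\<dots> \<le> (\<integral>\<omega>. \<bar>f (Zs n \<omega>) - F K (cM K n \<omega>)\<bar> \<partial>M)"
      by (rule integral_abs_bound)
    also have "\<dots> \<le> (\<integral>\<omega>. Osc K (cM K n \<omega>) + 2 * B * indicator E \<omega> \<partial>M)"
    proof (rule integral_mono)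
      fix \<omega> assume w: "\<omega> \<in> space M"
      show "\<bar>f (Zs n \<omega>) - F K (cM K n \<omega>)\<bar> \<le> Osc K (cM K n \<omega>) + 2 * B * indicator E \<omega>"
      proof (cases "\<omega> \<in> E")
        case True
        then show ?thesis using diff_le[of "Zs n \<omega>" K "cM K n \<omega>"] Osc0[of K "cM K n \<omega>"] by simp
      next
        case False
        then show ?thesis using w good Zc by (auto simp: cM_def intro!: Osc_upper nearI[OF K])
      qed
    qed (auto intro!: fZ intM(1) iE Bochner_Integration.integrable_diff Bochner_Integration.integrable_add integrable_abs)
    also have "\<dots> = (\<integral>\<omega>. Osc K (cM K n \<omega>) \<partial>M) + 2 * B * measure M E"
      using E iE by (simp add: Bochner_Integration.integral_add intM(1) sets.sets_into_space Int_absorb2)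
    also have "\<dots> \<le> (\<integral>\<omega>. Osc K (cM K n \<omega>) \<partial>M) + 2 * B * (4 / real K)"
      using E B0 by (intro add_left_mono mult_left_mono) auto
    finally show ?case by simp
  qed
  have iE: "integrable N (\<lambda>\<omega>. 2 * B * indicator (badE K) \<omega>)" for K
    using badE by (intro integrable_mult_right integrable_real_indicator) (auto simp: N.emeasure_eq_measure)
  have eE: "(\<integral>\<omega>. 2 * B * indicator (badE K) \<omega> \<partial>N) \<le> 8 * B / real K" if "K > 0" for K
  proof -
    have "(\<integral>\<omega>. 2 * B * indicator (badE K) \<omega> \<partial>N) = 2 * B * measure N (badE K)"
      using badE[of K] by (simp add: sets.sets_into_space Int_absorb2)
    also have "\<dots> \<le> 2 * B * (4 / real K)"
      using badN[OF that] B0 by (intro mult_left_mono) (auto simp: badE_def)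
    finally show ?thesis by simp
  qed
  have boundN: "\<bar>(\<integral>\<omega>. f (sup_path (P \<omega>)) \<partial>N) - (\<integral>\<omega>. F K (cN K \<omega>) \<partial>N)\<bar>
      \<le> (\<integral>\<omega>. Osc K (cN K \<omega>) \<partial>N) + 8 * B / real K" if K: "K > 0" for K
  proof -
    have "\<bar>(\<integral>\<omega>. f (sup_path (P \<omega>)) \<partial>N) - (\<integral>\<omega>. F K (cN K \<omega>) \<partial>N)\<bar> = \<bar>\<integral>\<omega>. f (sup_path (P \<omega>)) - F K (cN K \<omega>) \<partial>N\<bar>"
      by (simp add: fP intN(1))
    also have "\<dots> \<le> (\<integral>\<omega>. \<bar>f (sup_path (P \<omega>)) - F K (cN K \<omega>)\<bar> \<partial>N)"
      by (rule integral_abs_bound)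
    also have "\<dots> \<le> (\<integral>\<omega>. Osc K (cN K \<omega>) + 2 * B * indicator (badE K) \<omega> \<partial>N)"
    proof (rule integral_mono_AE)
      show "AE \<omega> in N. \<bar>f (sup_path (P \<omega>)) - F K (cN K \<omega>)\<bar> \<le> Osc K (cN K \<omega>) + 2 * B * indicator (badE K) \<omega>"
        using Pc AE_space
      proof eventually_elim
        case (elim \<omega>)
        show ?case
        proof (cases "\<omega> \<in> badE K")
          case True
          then show ?thesis using diff_le[of "sup_path (P \<omega>)" K "cN K \<omega>"] Osc0[of K "cN K \<omega>"] by simp
        next
          case False
          then show ?thesis using elim by (auto simp: cN_def badE_def intro!: Osc_upper nearI[OF K])
        qed
      qed
    qed (auto intro!: fP intN(1) iE Bochner_Integration.integrable_diff Bochner_Integration.integrable_add integrable_abs)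
    also have "\<dots> = (\<integral>\<omega>. Osc K (cN K \<omega>) \<partial>N) + (\<integral>\<omega>. 2 * B * indicator (badE K) \<omega> \<partial>N)"
      by (intro Bochner_Integration.integral_add intN(1) iE)
    also have "\<dots> \<le> (\<integral>\<omega>. Osc K (cN K \<omega>) \<partial>N) + 8 * B / real K"
      using eE[OF K] by simp
    finally show ?thesis .
  qed
  \<comment> \<open>The restriction to good configurations is essential for pointwise convergence:
    only there is the limiting path near its own cell.\<close>
  have osc_lim: "(\<lambda>K. \<integral>\<omega>. Osc K (cN K \<omega>) * indicator (space N - badE K) \<omega> \<partial>N) \<longlonglongrightarrow> (\<integral>\<omega>. 0 \<partial>N)"
  proof (rule integral_dominated_convergence[where w="\<lambda>_. 2 * B"])
    show "(\<lambda>\<omega>. Osc K (cN K \<omega>) * indicator (space N - badE K) \<omega>) \<in> borel_measurable N" for K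
      using badE[of K] borel_measurable_integrable[OF intN(1), of "Osc K" K] by measurable
    show "AE \<omega> in N. norm (Osc K (cN K \<omega>) * indicator (space N - badE K) \<omega>) \<le> 2 * B" for K
      using Osc0 OscB B0 by (auto simp: indicator_def)
    show "AE \<omega> in N. (\<lambda>K. Osc K (cN K \<omega>) * indicator (space N - badE K) \<omega>) \<longlonglongrightarrow> 0"
      using Pc AE_space
    proof eventually_elim
      case (elim \<omega>)
      define z where "z = sup_path (P \<omega>)"
      have z: "cadlag z" and wN: "\<omega> \<in> space N" using elim by (simp_all add: z_def)
      \<comment> \<open>Good levels may have gaps. At the remaining levels the approximating
        sequences are filled with the limit path z itself, which \<open>J1_conv_step_close\<close>
        permits.\<close>
      define ok where "ok K \<longleftrightarrow> K > 0 \<and> \<omega> \<notin> badE K" for K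
      have zn: "z \<in> near K (cN K \<omega>)" if "ok K" for K
        using that elim z unfolding cN_def z_def ok_def by (intro nearI) (auto simp: badE_def)
      \<comment> \<open>The supremum need not be attained, so a path within 1/K of it is chosen.
        That path and the representative both converge to z in J1, so f takes asymptotically equal
        values on them and the oscillation vanishes.\<close>
      have "\<exists>w. w \<in> near K (cN K \<omega>) \<and> Osc K (cN K \<omega>) - 1 / real K < \<bar>f w - F K (cN K \<omega>)\<bar>" if "ok K" for K
      proof -
        have "Osc K (cN K \<omega>) - 1 / real K < (SUP y\<in>near K (cN K \<omega>). \<bar>f y - F K (cN K \<omega>)\<bar>)"
          using zn[OF that] that by (auto simp: Osc_def ok_def)
        then show ?thesis 
          using less_cSUP_iff[OF _ bdd, of K "cN K \<omega>" "Osc K (cN K \<omega>) - 1 / real K"] zn[OF that] by auto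
      qed
      then obtain w where w: "\<And>K. ok K \<Longrightarrow> w K \<in> near K (cN K \<omega>)"
          "\<And>K. ok K \<Longrightarrow> Osc K (cN K \<omega>) - 1 / real K < \<bar>f (w K) - F K (cN K \<omega>)\<bar>"
        by metis
      have rep: "rep K (cN K \<omega>) \<in> near K (cN K \<omega>)" if "ok K" for K
        unfolding rep_def by (rule someI[of "\<lambda>y. y \<in> near K (cN K \<omega>)", OF zn[OF that]])
      have lim: "(\<lambda>K. f (if ok K then y K else z)) \<longlonglongrightarrow> f z" if y: "\<And>K. ok K \<Longrightarrow> y K \<in> near K (cN K \<omega>)" for y
      proof (rule fc)
        show "cadlag (if ok K then y K else z)" for K using y[of K] z by (auto simp: near_def)
        show "J1_conv (\<lambda>K. if ok K then y K else z) z"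
        proof (rule J1_conv_step_close)
          fix K :: nat
          show "(if ok K then y K else z) = z \<or> (\<exists>c \<tau> \<sigma>. step_close K c \<tau> (2 / real K) (if ok K then y K else z)
             \<and> step_close K c \<sigma> (2 / real K) z)"
            using y[of K] zn[of K] by (auto simp: near_def)
        qed
      qed (rule z)
      have "(\<lambda>K. \<bar>f (if ok K then w K else z) - f (if ok K then rep K (cN K \<omega>) else z)\<bar> + 1 / real K) \<longlonglongrightarrow> \<bar>f z - f z\<bar> + 0"
        by (intro tendsto_intros lim w(1) rep lim_1_over_n)
      then have lim0: "(\<lambda>K. \<bar>f (if ok K then w K else z) - f (if ok K then rep K (cN K \<omega>) else z)\<bar> + 1 / real K) \<longlonglongrightarrow> 0"
        by simp
      show ?case
      proof (rule tendsto_sandwich[OF _ _ tendsto_const lim0])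
        show "\<forall>\<^sub>F K in sequentially. 0 \<le> Osc K (cN K \<omega>) * indicator (space N - badE K) \<omega>"
          using Osc0 by auto
        show "\<forall>\<^sub>F K in sequentially. Osc K (cN K \<omega>) * indicator (space N - badE K) \<omega>
           \<le> \<bar>f (if ok K then w K else z) - f (if ok K then rep K (cN K \<omega>) else z)\<bar> + 1 / real K"
          using eventually_gt_at_top[of 0]
        proof eventually_elim
          case (elim K)
          then show ?case using w(2)[of K] wN by (cases "ok K") (auto simp: F_def ok_def)
        qed
      qed
    qed
  qed auto
  have oscN: "(\<integral>\<omega>. Osc K (cN K \<omega>) \<partial>N) \<le> (\<integral>\<omega>. Osc K (cN K \<omega>) * indicator (space N - badE K) \<omega> \<partial>N) + 8 * B / real K"
    if K: "K > 0" for K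
  proof -
    have i1: "integrable N (\<lambda>\<omega>. Osc K (cN K \<omega>) * indicator (space N - badE K) \<omega>)"
      using badE[of K] by (intro integrable_real_mult_indicator intN(1)) auto
    have "(\<integral>\<omega>. Osc K (cN K \<omega>) \<partial>N) \<le> (\<integral>\<omega>. Osc K (cN K \<omega>) * indicator (space N - badE K) \<omega> + 2 * B * indicator (badE K) \<omega> \<partial>N)"
      using OscB by (intro integral_mono intN(1) Bochner_Integration.integrable_add i1 iE) (auto simp: indicator_def)
    also have "\<dots> = (\<integral>\<omega>. Osc K (cN K \<omega>) * indicator (space N - badE K) \<omega> \<partial>N) + (\<integral>\<omega>. 2 * B * indicator (badE K) \<omega> \<partial>N)"
      by (intro Bochner_Integration.integral_add i1 iE)
    finally show ?thesis using eE[OF K] by linarith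
  qed
  show "(\<lambda>n. \<integral>\<omega>. f (Zs n \<omega>) \<partial>M) \<longlonglongrightarrow> (\<integral>\<omega>. f (sup_path (P \<omega>)) \<partial>N)"
  proof (rule LIMSEQ_I)
    fix e :: real assume e: "e > 0"
    have "(\<lambda>K. 8 * B / real K) \<longlonglongrightarrow> 0" by (rule lim_const_over_n)
    \<comment> \<open>With every piece below e/16, the limiting oscillation is below 2e/16 and the
      one before the limit below 3e/16. Adding both bad-event terms and the difference of the cell
      integrals gives less than e/2.\<close>
    then have "\<forall>\<^sub>F K in sequentially. 8 * B / real K < e / 16" using e by (intro order_tendstoD(2)) auto
    moreover have "\<forall>\<^sub>F K in sequentially. (\<integral>\<omega>. Osc K (cN K \<omega>) * indicator (space N - badE K) \<omega> \<partial>N) < e / 16"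
      using osc_lim e by (intro order_tendstoD(2)) auto
    ultimately have "\<forall>\<^sub>F K in sequentially. K > 0 \<and> 8 * B / real K < e / 16 \<and>
        (\<integral>\<omega>. Osc K (cN K \<omega>) * indicator (space N - badE K) \<omega> \<partial>N) < e / 16"
      using eventually_gt_at_top[of 0] by eventually_elim auto
    then obtain K where K: "K > 0" "8 * B / real K < e / 16"
        "(\<integral>\<omega>. Osc K (cN K \<omega>) * indicator (space N - badE K) \<omega> \<partial>N) < e / 16"
      unfolding eventually_sequentially by blast
    have "\<forall>\<^sub>F n in sequentially. dist (\<integral>\<omega>. F K (cM K n \<omega>) \<partial>M) (\<integral>\<omega>. F K (cN K \<omega>) \<partial>N) < e / 16"
      using conv[OF K(1), of "F K"] e by (intro tendstoD) auto
    moreover have "\<forall>\<^sub>F n in sequentially. dist (\<integral>\<omega>. Osc K (cM K n \<omega>) \<partial>M) (\<integral>\<omega>. Osc K (cN K \<omega>) \<partial>N) < e / 16"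
      using conv[OF K(1), of "Osc K"] e by (intro tendstoD) auto
    ultimately have "\<forall>\<^sub>F n in sequentially. norm ((\<integral>\<omega>. f (Zs n \<omega>) \<partial>M) - (\<integral>\<omega>. f (sup_path (P \<omega>)) \<partial>N)) < e"
      using boundM[OF K(1)]
    proof eventually_elim
      case (elim n)
      then show ?case using K boundN[OF K(1)] oscN[OF K(1)] e unfolding dist_real_def real_norm_def by linarith
    qed
    then show "\<exists>no. \<forall>n\<ge>no. norm ((\<integral>\<omega>. f (Zs n \<omega>) \<partial>M) - (\<integral>\<omega>. f (sup_path (P \<omega>)) \<partial>N)) < e"
      unfolding eventually_sequentially .
  qed
qed

text \<open>Right continuity up to 1/(j + 1): of the finitely many points above that height, none
  enters immediately after t, and lower ones raise the supremum by at most 1/(j + 1). Left limits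
  come from monotonicity alone.\<close>

lemma cadlag_sup_path:
  assumes fin: "\<And>T j :: nat. finite {k. fst (p k) \<le> real T \<and> snd (p k) > ennreal (1 / real (Suc j))}"
    and top: "\<And>k. snd (p k) < \<top>"
  shows "cadlag (sup_path p)"
proof -
  define S where "S t = (SUP k\<in>{k. fst (p k) \<le> t}. snd (p k))" for t
  have path: "sup_path p t = enn2real (S t)" for t by (simp add: sup_path_def S_def)
  have S_fin: "S t < \<top>" for t
  proof -
    obtain T :: nat where T: "t \<le> real T" using real_arch_simple by blast
    let ?F = "{k. fst (p k) \<le> real T \<and> snd (p k) > ennreal (1 / real (Suc 0))}"
    have "S t \<le> Max (insert 1 ((\<lambda>k. snd (p k)) ` ?F))"
      unfolding S_def
    proof (rule SUP_least)
      fix k assume k: "k \<in> {k. fst (p k) \<le> t}"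
      show "snd (p k) \<le> Max (insert 1 ((\<lambda>k. snd (p k)) ` ?F))"
      proof (cases "snd (p k) > 1")
        case True
        then have "k \<in> ?F" using k T by auto
        then show ?thesis using fin[of T 0] by (intro Max_ge) auto
      next
        case False
        then show ?thesis using fin[of T 0] by (intro order_trans[OF _ Max_ge[of _ 1]]) auto
      qed
    qed
    also have "\<dots> < \<top>" using fin[of T 0] top by (subst Max_less_iff) auto
    finally show ?thesis .
  qed
  have S_mono: "S s \<le> S t" if "s \<le> t" for s t
    unfolding S_def using that by (intro SUP_subset_mono) auto
  have mono: "sup_path p s \<le> sup_path p t" if "s \<le> t" for s t
    unfolding path using S_mono[OF that] S_fin by (intro enn2real_mono) auto
  have right: "((sup_path p) \<longlongrightarrow> sup_path p t) (at_right t)" for t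
  proof (rule tendstoI)
    fix e :: real assume e: "e > 0"
    obtain j :: nat where j: "1 / real (Suc j) < e" using nat_approx_posE[OF e] by blast
    obtain T :: nat where T: "t + 1 \<le> real T" using real_arch_simple by blast
    let ?F = "{k. fst (p k) \<le> real T \<and> snd (p k) > ennreal (1 / real (Suc j))}"
    \<comment> \<open>Finiteness lets the individual waiting times until the next high point be
      combined into one common neighbourhood.\<close>
    have "\<forall>\<^sub>F s in at_right t. \<forall>k\<in>?F. t < fst (p k) \<longrightarrow> s < fst (p k)"
    proof (rule eventually_ball_finite[OF fin], rule ballI)
      fix k
      show "\<forall>\<^sub>F s in at_right t. t < fst (p k) \<longrightarrow> s < fst (p k)"
        by (cases "t < fst (p k)") (auto simp: eventually_at_right)
    qed
    moreover have "\<forall>\<^sub>F s in at_right t. t < s \<and> s < t + 1"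
      by (rule eventually_at_rightI[of t "t + 1"]) auto
    ultimately show "\<forall>\<^sub>F s in at_right t. dist (sup_path p s) (sup_path p t) < e"
    proof eventually_elim
      case (elim s)
      have "S s \<le> ennreal (sup_path p t + 1 / real (Suc j))"
        unfolding S_def
      proof (rule SUP_least)
        fix k assume k: "k \<in> {k. fst (p k) \<le> s}"
        have St: "ennreal (sup_path p t) = S t" unfolding path using S_fin[of t] by (simp add: ennreal_enn2real_if less_top)
        show "snd (p k) \<le> ennreal (sup_path p t + 1 / real (Suc j))"
        proof (cases "fst (p k) \<le> t")
          case True
          then have "snd (p k) \<le> S t" unfolding S_def by (intro SUP_upper) auto
          also have "\<dots> \<le> ennreal (sup_path p t + 1 / real (Suc j))" unfolding St[symmetric] by (intro ennreal_leI) auto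
          finally show ?thesis .
        next
          case False
          then have "k \<notin> ?F" using elim k by force
          then have "snd (p k) \<le> ennreal (1 / real (Suc j))" using k elim T by auto
          also have "\<dots> \<le> ennreal (sup_path p t + 1 / real (Suc j))" by (intro ennreal_leI) (auto simp: path)
          finally show ?thesis .
        qed
      qed
      then have "sup_path p s \<le> sup_path p t + 1 / real (Suc j)"
        unfolding path[of s] by (intro enn2real_leI) (auto simp: path)
      then show ?case using mono[of t s] elim j by (simp add: dist_real_def)
    qed
  qed
  have left: "\<exists>l. (sup_path p \<longlongrightarrow> l) (at_left t)" for t
  proof
    define l where "l = (SUP s\<in>{..<t}. sup_path p s)"
    have bdd: "bdd_above (sup_path p ` {..<t})" using mono by (intro bdd_aboveI2[of _ _ "sup_path p t"]) auto
    have lt: "\<forall>\<^sub>F s in at_left t. s < t" by (auto simp: eventually_at_filter)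
    show "(sup_path p \<longlongrightarrow> l) (at_left t)"
    proof (rule increasing_tendsto)
      show "\<forall>\<^sub>F s in at_left t. sup_path p s \<le> l"
        using lt by eventually_elim (auto simp: l_def intro!: cSUP_upper bdd)
      fix x assume "x < l"
      then obtain u where u: "u < t" "x < sup_path p u"
        using less_cSUP_iff[OF _ bdd, of x] unfolding l_def by (auto simp: lessThan_empty_iff lt_ex)
      have "\<forall>\<^sub>F s in at_left t. u < s" using u eventually_at_left[OF u(1)] by auto
      then show "\<forall>\<^sub>F s in at_left t. x < sup_path p s"
        by eventually_elim (use u mono in \<open>meson less_imp_le less_le_trans\<close>)
    qed
  qed
  show ?thesis using right left by (auto simp: cadlag_def continuous_within)
qed

section \<open>The Poisson random measure\<close>

lemma emeasure_mu_ab: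
  assumes "\<alpha> > 0" "x > 0"
  shows "emeasure (mu_ab 1 \<alpha>) {ennreal x<..} = ennreal (x powr (- \<alpha>))"
proof -
  let ?g = "\<lambda>x::real. ennreal (if x > 0 then 1 * \<alpha> * x powr (- \<alpha> - 1) else 0)"
  have vim: "ennreal -` {ennreal x<..} = {x<..}" using assms by (auto simp: ennreal_less_iff)
  have "emeasure (mu_ab 1 \<alpha>) {ennreal x<..} = emeasure (density lborel ?g) {x<..}"
    unfolding mu_ab_def by (subst emeasure_distr) (auto simp: vim)
  also have "\<dots> = (\<integral>\<^sup>+y. ?g y * indicator {x<..} y \<partial>lborel)"
    by (intro emeasure_density) auto
  \<comment> \<open>The endpoint is a null set; adding it brings the integral into the form needed
    for the antiderivative of the density on a closed half-line.\<close>
  also have "\<dots> = (\<integral>\<^sup>+y. ennreal (\<alpha> * y powr (- \<alpha> - 1)) * indicator {x..} y \<partial>lborel)"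
  proof (rule nn_integral_cong_AE)
    show "AE y in lborel. ?g y * indicator {x<..} y = ennreal (\<alpha> * y powr (- \<alpha> - 1)) * indicator {x..} y"
      using AE_lborel_singleton[of x] by eventually_elim (use assms in \<open>auto simp: indicator_def\<close>)
  qed
  also have "\<dots> = ennreal (0 - (- (x powr (- \<alpha>))))"
  proof (rule nn_integral_FTC_atLeast)
    show "DERIV (\<lambda>y. - (y powr (- \<alpha>))) y :> \<alpha> * y powr (- \<alpha> - 1)" if "x \<le> y" for y
      using that assms by (auto intro!: derivative_eq_intros)
    have "((\<lambda>y. - (y powr (- \<alpha>))) \<longlongrightarrow> - 0) at_top"
      using assms by (intro tendsto_minus tendsto_neg_powr filterlim_ident) auto
    then show "((\<lambda>y. - (y powr (- \<alpha>))) \<longlongrightarrow> 0) at_top" by simp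
  qed (use assms in auto)
  finally show ?thesis by simp
qed

lemma sets_mu_ab [measurable_cong, simp]: "sets (mu_ab a \<alpha>) = sets borel"
  by (simp add: mu_ab_def)

lemma space_mu_ab [simp]: "space (mu_ab a \<alpha>) = UNIV"
  by (simp add: mu_ab_def)

lemma emeasure_mu_ab_top: "emeasure (mu_ab a \<alpha>) {\<top>} = 0"
proof -
  have "ennreal -` {\<top>} = {}" by auto
  then show ?thesis unfolding mu_ab_def by (subst emeasure_distr) auto
qed

text \<open>The cover consists of the sets (1/(n + 1), \<infinity>] and {0}. The latter is null
  although its preimage under \<open>ennreal\<close> is the whole negative half-line with 0, because
  the density vanishes there.\<close>

lemma sigma_finite_mu_ab:
  assumes "\<alpha> > 0"
  shows "sigma_finite_measure (mu_ab 1 \<alpha>)"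
proof
  let ?A = "insert {0} (range (\<lambda>n::nat. {ennreal (1 / real (Suc n))<..}))"
  let ?g = "\<lambda>x::real. ennreal (if x > 0 then 1 * \<alpha> * x powr (- \<alpha> - 1) else 0)"
  have "emeasure (mu_ab 1 \<alpha>) {0} = emeasure (density lborel ?g) {..0}"
  proof -
    have "ennreal -` {0} = {..0}" by (auto simp: ennreal_eq_0_iff)
    then show ?thesis unfolding mu_ab_def by (subst emeasure_distr) auto
  qed
  also have "\<dots> = (\<integral>\<^sup>+y. ?g y * indicator {..0} y \<partial>lborel)"
    by (intro emeasure_density) auto
  also have "\<dots> = (\<integral>\<^sup>+y. 0 \<partial>(lborel :: real measure))"
    by (intro nn_integral_cong) (auto simp: indicator_def)
  finally have 0: "emeasure (mu_ab 1 \<alpha>) {0} = 0" by simp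
  have "\<Union> ?A = UNIV"
  proof -
    have "x \<in> \<Union> ?A" for x :: ennreal
    proof (cases "x = 0")
      case False
      have "\<exists>n::nat. ennreal (1 / real (Suc n)) < x"
      proof (cases x)
        case (real y)
        then have "y > 0" using False by auto
        then obtain n where "1 / real (Suc n) < y" using nat_approx_posE by blast
        then show ?thesis using real \<open>y > 0\<close> by (auto simp: ennreal_less_iff)
      qed auto
      then show ?thesis by auto
    qed auto
    then show ?thesis by blast
  qed
  then show "\<exists>A. countable A \<and> A \<subseteq> sets (mu_ab 1 \<alpha>) \<and> \<Union> A = space (mu_ab 1 \<alpha>) \<and> (\<forall>a\<in>A. emeasure (mu_ab 1 \<alpha>) a \<noteq> \<infinity>)"
    using 0 assms by (intro exI[of _ ?A]) (auto simp: emeasure_mu_ab)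
qed

lemma sets_mean_meas [measurable_cong, simp]: "sets (mean_meas a \<alpha>) = sets (borel \<Otimes>\<^sub>M borel)"
  unfolding mean_meas_def by (intro sets_pair_measure_cong) auto

lemma emeasure_mean_meas_Times:
  assumes "\<alpha> > 0" "T \<in> sets borel" "A \<in> sets borel"
  shows "emeasure (mean_meas 1 \<alpha>) (T \<times> A) = emeasure lborel ({0..} \<inter> T) * emeasure (mu_ab 1 \<alpha>) A"
proof -
  interpret sigma_finite_measure "mu_ab 1 \<alpha>" by (rule sigma_finite_mu_ab) fact
  show ?thesis unfolding mean_meas_def using assms
    by (subst emeasure_pair_measure_Times) (auto simp: emeasure_restricted)
qed

lemma emeasure_mean_meas_box:
  assumes "\<alpha> > 0" "T \<in> sets borel" "x > 0" "emeasure lborel ({0..} \<inter> T) = ennreal d" "d \<ge> 0"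
  shows "emeasure (mean_meas 1 \<alpha>) (T \<times> {ennreal x<..}) = ennreal (d * x powr (- \<alpha>))"
  using assms by (simp add: emeasure_mean_meas_Times emeasure_mu_ab ennreal_mult)

section \<open>Blocks and void events of cells\<close>

lemma emeasure_lborel_block:
  "K > 0 \<Longrightarrow> emeasure lborel ({0..} \<inter> block K i) = ennreal (1 / real (K ^ 4))"
proof -
  assume K: "K > 0"
  have "{0..} \<inter> block K i = block K i" using block_pos by (force intro: less_imp_le)
  moreover have "emeasure lborel (block K i) = ennreal (real (Suc i) / real (K ^ 4) - real i / real (K ^ 4))"
    unfolding block_def by (intro emeasure_lborel_Ioc divide_right_mono) auto
  moreover have "real (Suc i) / real (K ^ 4) - real i / real (K ^ 4) = 1 / real (K ^ 4)"
    by (simp add: add_divide_distrib)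
  ultimately show ?thesis by (simp only:)
qed

lemma sets_block [measurable, simp]: "block K i \<in> sets borel"
  by (simp add: block_def)

lemma block_disjoint:
  assumes "K > 0" "i \<noteq> j"
  shows "block K i \<inter> block K j = {}"
  using block_less[of _ K i _ j] block_less[of _ K j _ i] assms by (metis disjoint_iff less_irrefl linorder_neqE_nat)

text \<open>A point above some level of a block is also above all lower ones, so avoiding S only
  constrains each block at its lowest level in S.\<close>

definition lowest :: "(nat \<times> nat) set \<Rightarrow> nat \<Rightarrow> nat" where
  "lowest S i = (LEAST l. (i, l) \<in> S)"

text \<open>Mean measure of the union of the boxes, block length times \<open>mu_ab\<close> of the
  half-line above the lowest level, over all blocks occurring in S.\<close>

definition void_rate :: "real \<Rightarrow> nat \<Rightarrow> (nat \<times> nat) set \<Rightarrow> real" where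
  "void_rate \<alpha> K S = (\<Sum>i\<in>fst ` S. 1 / real (K ^ 4) * (real (lowest S i) / real K) powr (- \<alpha>))"

lemma lowest: "i \<in> fst ` S \<Longrightarrow> (i, lowest S i) \<in> S" "(i, l) \<in> S \<Longrightarrow> lowest S i \<le> l"
  unfolding lowest_def by (force intro: LeastI, rule Least_le)

lemma cell_disjoint_iff:
  assumes "S \<subseteq> {..<K ^ 5} \<times> {1..r}"
  shows "cell K r p \<inter> S = {} \<longleftrightarrow>
     (\<forall>k. \<forall>i\<in>fst ` S. fst (p k) \<in> block K i \<longrightarrow> snd (p k) \<le> ennreal (real (lowest S i) / real K))"
proof
  assume L: "cell K r p \<inter> S = {}"
  show "\<forall>k. \<forall>i\<in>fst ` S. fst (p k) \<in> block K i \<longrightarrow> snd (p k) \<le> ennreal (real (lowest S i) / real K)"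
  proof (intro allI ballI impI, rule ccontr)
    fix k i assume i: "i \<in> fst ` S" "fst (p k) \<in> block K i" "\<not> snd (p k) \<le> ennreal (real (lowest S i) / real K)"
    then have "(i, lowest S i) \<in> S" using lowest by blast
    moreover have "(i, lowest S i) \<in> cell K r p"
      using i assms \<open>(i, lowest S i) \<in> S\<close> by (auto simp: cell_def exceeds_def not_le)
    ultimately show False using L by blast
  qed
next
  assume R: "\<forall>k. \<forall>i\<in>fst ` S. fst (p k) \<in> block K i \<longrightarrow> snd (p k) \<le> ennreal (real (lowest S i) / real K)"
  show "cell K r p \<inter> S = {}"
  proof (rule ccontr)
    assume "cell K r p \<inter> S \<noteq> {}"
    then obtain i l where il: "(i, l) \<in> S" "(i, l) \<in> cell K r p" by auto
    then obtain k where k: "fst (p k) \<in> block K i" "snd (p k) > ennreal (real l / real K)"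
      by (auto simp: cell_def exceeds_def)
    have "snd (p k) \<le> ennreal (real (lowest S i) / real K)" using R k il by force
    also have "\<dots> \<le> ennreal (real l / real K)" using lowest(2)[OF il(1)] by (intro ennreal_leI divide_right_mono) auto
    finally show False using k by simp
  qed
qed

text \<open>As \<alpha> is at most 1, a block carries on average at most K^(-4) K = K^(-3) visible
  points. Squaring and summing over K^5 blocks leaves 1/K, which is where the fourth power in the
  block length comes from.\<close>

lemma block_pair_bound:
  assumes K: "K > 0" and \<alpha>: "0 < \<alpha>" "\<alpha> \<le> 1"
  shows "real (K ^ 5) * (1 / real (K ^ 4) * (1 / real K) powr (- \<alpha>))\<^sup>2 \<le> 1 / real K"
proof -
  define x where "x = 1 / real (K ^ 4) * (1 / real K) powr (- \<alpha>)"
  have "(1 / real K) powr (- \<alpha>) = real K powr \<alpha>" using K by (simp add: powr_minus powr_divide)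
  also have "\<dots> \<le> real K powr 1" using K \<alpha> by (intro powr_mono) auto
  finally have "(1 / real K) powr (- \<alpha>) \<le> real K" using K by simp
  then have "x \<le> 1 / real (K ^ 4) * real K" unfolding x_def by (intro mult_left_mono) auto
  moreover have "0 \<le> x" by (simp add: x_def)
  ultimately have "x\<^sup>2 \<le> (1 / real (K ^ 4) * real K)\<^sup>2" by (intro power_mono)
  then have "real (K ^ 5) * x\<^sup>2 \<le> real (K ^ 5) * (1 / real (K ^ 4) * real K)\<^sup>2" by (intro mult_left_mono) auto
  also have "\<dots> = 1 / real K" using K by (simp add: power2_eq_square field_simps eval_nat_numeral)
  finally show ?thesis by (simp only: x_def)
qed

locale poisson_points =
  fixes N :: "'b measure" and \<alpha> :: real and P :: "nat \<Rightarrow> 'b \<Rightarrow> real \<times> ennreal"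
  assumes PRM: "is_PRM N (mean_meas 1 \<alpha>) P" and \<alpha>: "0 < \<alpha>" "\<alpha> \<le> 1"
begin

sublocale prob_space N using PRM by (simp add: is_PRM_def)

lemma P_measurable [measurable]: "P k \<in> measurable N (borel \<Otimes>\<^sub>M borel)"
proof -
  have "P k \<in> measurable N (mean_meas 1 \<alpha>)" using PRM unfolding is_PRM_def by blast
  then show ?thesis by (subst measurable_cong_sets[OF refl sets_mean_meas[symmetric]])
qed

lemma pcount_measurable: "B \<in> sets (borel \<Otimes>\<^sub>M borel) \<Longrightarrow> (\<lambda>\<omega>. pcount P \<omega> B) \<in> borel_measurable N"
  unfolding pcount_def
  by (intro borel_measurable_suminf_order measurable_compose[OF P_measurable] borel_measurable_indicator)

lemma pcount_prob:
  assumes "B \<in> sets (borel \<Otimes>\<^sub>M borel)" "emeasure (mean_meas 1 \<alpha>) B = ennreal x" "x \<ge> 0"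
  shows "prob {\<omega>\<in>space N. pcount P \<omega> B = of_nat n} = exp (- x) * x ^ n / fact n"
  using PRM assms by (auto simp: is_PRM_def)

lemma pcount_eq_0_iff: "pcount P \<omega> B = 0 \<longleftrightarrow> (\<forall>k. P k \<omega> \<notin> B)"
  unfolding pcount_def by (subst suminf_eq_zero_iff) (auto simp: indicator_def)

lemma void_prob:
  assumes "B \<in> sets (borel \<Otimes>\<^sub>M borel)" "emeasure (mean_meas 1 \<alpha>) B = ennreal x" "x \<ge> 0"
  shows "prob {\<omega>\<in>space N. \<forall>k. P k \<omega> \<notin> B} = exp (- x)"
  using pcount_prob[OF assms, of 0] by (simp add: pcount_eq_0_iff)

lemma AE_void:
  assumes "B \<in> sets (borel \<Otimes>\<^sub>M borel)" "emeasure (mean_meas 1 \<alpha>) B = 0"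
  shows "AE \<omega> in N. \<forall>k. P k \<omega> \<notin> B"
proof -
  have "prob {\<omega>\<in>space N. \<forall>k. P k \<omega> \<notin> B} = 1" using void_prob[of B 0] assms by simp
  moreover note [measurable] = assms(1)
  have "{\<omega>\<in>space N. \<forall>k. P k \<omega> \<notin> B} \<in> events" by measurable
  ultimately show ?thesis by (simp add: prob_Collect_eq_1)
qed

lemma prob_occupied_le:
  assumes "B \<in> sets (borel \<Otimes>\<^sub>M borel)" "emeasure (mean_meas 1 \<alpha>) B = ennreal x" "x \<ge> 0"
  shows "prob {\<omega>\<in>space N. \<exists>k. P k \<omega> \<in> B} \<le> x"
proof -
  note [measurable] = assms(1)
  have m: "{\<omega>\<in>space N. \<forall>k. P k \<omega> \<notin> B} \<in> events" by measurable
  have "{\<omega>\<in>space N. \<exists>k. P k \<omega> \<in> B} = space N - {\<omega>\<in>space N. \<forall>k. P k \<omega> \<notin> B}" by auto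
  then have "prob {\<omega>\<in>space N. \<exists>k. P k \<omega> \<in> B} = 1 - exp (- x)"
    using prob_compl[OF m] void_prob[OF assms] by simp
  then show ?thesis using exp_ge_add_one_self[of "- x"] by linarith
qed

text \<open>Two distinct indices force the count to be neither 0 nor 1, and 1 - exp(-x)(1 + x) is at
  most x^2 because exp(-x) is at least 1 - x.\<close>

lemma prob_two_points_le:
  assumes B: "B \<in> sets (borel \<Otimes>\<^sub>M borel)" and x: "emeasure (mean_meas 1 \<alpha>) B = ennreal x" "x \<ge> 0"
  shows "prob {\<omega>\<in>space N. \<exists>k k'. k \<noteq> k' \<and> P k \<omega> \<in> B \<and> P k' \<omega> \<in> B} \<le> x\<^sup>2"
proof -
  note [measurable] = pcount_measurable[OF B] B
  let ?A = "\<lambda>n. {\<omega>\<in>space N. pcount P \<omega> B = of_nat n}"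
  have A: "?A n \<in> events" for n by measurable
  have "prob {\<omega>\<in>space N. \<exists>k k'. k \<noteq> k' \<and> P k \<omega> \<in> B \<and> P k' \<omega> \<in> B} \<le> prob (space N - (?A 0 \<union> ?A 1))"
  proof (rule finite_measure_mono)
    show "{\<omega>\<in>space N. \<exists>k k'. k \<noteq> k' \<and> P k \<omega> \<in> B \<and> P k' \<omega> \<in> B} \<subseteq> space N - (?A 0 \<union> ?A 1)"
    proof safe
      fix \<omega> k k' assume w: "k \<noteq> k'" "P k \<omega> \<in> B" "P k' \<omega> \<in> B"
      have "(2 :: ennreal) = (\<Sum>j\<in>{k, k'}. indicator B (P j \<omega>))" using w by (simp add: one_add_one)
      also have "\<dots> \<le> pcount P \<omega> B" unfolding pcount_def by (intro sum_le_suminf) auto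
      finally have ge: "2 \<le> pcount P \<omega> B" .
      { assume "pcount P \<omega> B = of_nat 0" then show False using ge by simp }
      { assume "pcount P \<omega> B = of_nat 1" then show False using ge by simp }
    qed
  qed (use A in auto)
  also have "\<dots> = 1 - prob (?A 0 \<union> ?A 1)" using A by (intro prob_compl) auto
  also have "prob (?A 0 \<union> ?A 1) = prob (?A 0) + prob (?A 1)"
    using A by (intro finite_measure_Union) auto
  also have "\<dots> = exp (- x) * (1 + x)"
    unfolding pcount_prob[OF B x] by (simp add: algebra_simps)
  also have "1 - exp (- x) * (1 + x) \<le> 1 - (1 - x) * (1 + x)"
    using exp_ge_add_one_self[of "- x"] x by (intro diff_left_mono mult_right_mono) auto
  also have "\<dots> = x\<^sup>2" by (simp add: algebra_simps power2_eq_square)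
  finally show ?thesis by simp
qed

text \<open>The Poisson weights sum to 1, so the count is almost surely a natural number n, and n +
  1 distinct indices in B would contradict this.\<close>

lemma AE_finite_points:
  assumes B: "B \<in> sets (borel \<Otimes>\<^sub>M borel)" and x: "emeasure (mean_meas 1 \<alpha>) B = ennreal x" "x \<ge> 0"
  shows "AE \<omega> in N. finite {k. P k \<omega> \<in> B}"
proof -
  note [measurable] = pcount_measurable[OF B] B
  let ?A = "\<lambda>n. {\<omega>\<in>space N. pcount P \<omega> B = of_nat n}"
  have A: "range ?A \<subseteq> events" by auto
  have "(\<lambda>n. prob (?A n)) sums prob (\<Union>n. ?A n)"
    by (rule finite_measure_UNION[OF A]) (auto simp: disjoint_family_on_def)
  moreover have "(\<lambda>n. prob (?A n)) sums (exp (- x) * exp x)"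
  proof -
    have "(\<lambda>n. x ^ n /\<^sub>R fact n) sums exp x" by (rule exp_converges)
    from sums_mult[OF this, of "exp (- x)"] show ?thesis
      unfolding pcount_prob[OF B x] by (simp add: divide_inverse mult_ac)
  qed
  ultimately have "prob (\<Union>n. ?A n) = exp (- x) * exp x" by (rule sums_unique2)
  then have "prob (\<Union>n. ?A n) = 1" by (simp flip: exp_add)
  then have "AE \<omega> in N. \<omega> \<in> (\<Union>n. ?A n)" by (intro prob_eq_1[THEN iffD1]) auto
  then show ?thesis
  proof eventually_elim
    case (elim \<omega>)
    then obtain n :: nat where n: "pcount P \<omega> B = of_nat n" by auto
    show ?case
    proof (rule ccontr)
      assume inf: "infinite {k. P k \<omega> \<in> B}"
      obtain F where F: "F \<subseteq> {k. P k \<omega> \<in> B}" "finite F" "card F = Suc n"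
        using infinite_arbitrarily_large[OF inf] by blast
      have "(of_nat (Suc n) :: ennreal) = (\<Sum>j\<in>F. indicator B (P j \<omega>))"
      proof -
        have "(\<Sum>j\<in>F. indicator B (P j \<omega>) :: ennreal) = (\<Sum>j\<in>F. 1)"
          using F by (intro sum.cong) (auto simp: indicator_def)
        then show ?thesis using F by simp
      qed
      also have "\<dots> \<le> pcount P \<omega> B" unfolding pcount_def using F by (intro sum_le_suminf) auto
      finally have "(of_nat (Suc n) :: ennreal) \<le> of_nat n" using n by simp
      then show False by (simp only: of_nat_le_iff)
    qed
  qed
qed

abbreviation config :: "'b \<Rightarrow> nat \<Rightarrow> real \<times> ennreal" where
  "config \<omega> \<equiv> \<lambda>k. P k \<omega>"

lemma AE_cadlag: "AE \<omega> in N. cadlag (sup_path (config \<omega>))"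
proof -
  have "AE \<omega> in N. \<forall>T j. finite {k. P k \<omega> \<in> {..real T} \<times> {ennreal (1 / real (Suc j))<..}}"
    unfolding AE_all_countable
  proof (intro allI)
    fix T j :: nat
    have e: "emeasure lborel ({0..} \<inter> {..real T}) = ennreal (real T)"
    proof -
      have "{0..} \<inter> {..real T} = {0..real T}" by auto
      then show ?thesis by simp
    qed
    show "AE \<omega> in N. finite {k. P k \<omega> \<in> {..real T} \<times> {ennreal (1 / real (Suc j))<..}}"
      by (rule AE_finite_points[OF _ emeasure_mean_meas_box[OF \<alpha>(1) _ _ e]]) auto
  qed
  moreover have "AE \<omega> in N. \<forall>k. P k \<omega> \<notin> UNIV \<times> {\<top>}"
    by (intro AE_void) (auto simp: emeasure_mean_meas_Times \<alpha> emeasure_mu_ab_top)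
  ultimately show ?thesis
  proof eventually_elim
    case (elim \<omega>)
    show ?case
    proof (rule cadlag_sup_path)
      show "finite {k. fst (P k \<omega>) \<le> real T \<and> snd (P k \<omega>) > ennreal (1 / real (Suc j))}" for T j
        using elim(1)[rule_format, of T j] by (simp add: mem_Times_iff)
      show "snd (P k \<omega>) < \<top>" for k
        using elim(2)[rule_format, of k] by (simp add: mem_Times_iff less_top)
    qed
  qed
qed

text \<open>The boxes of distinct blocks are disjoint, so the event is emptiness of a single set
  whose mean measure is the sum of the box measures.\<close>

lemma void_prob_cell:
  assumes K: "K > 0" and S: "S \<subseteq> {..<K ^ 5} \<times> {1..r}"
  shows "prob {\<omega>\<in>space N. cell K r (config \<omega>) \<inter> S = {}} = exp (- void_rate \<alpha> K S)"
proof -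
  define I where "I = fst ` S"
  have finS: "finite S" using S by (rule finite_subset) auto
  then have finI: "finite I" by (simp add: I_def)
  let ?B = "\<lambda>i. block K i \<times> {ennreal (real (lowest S i) / real K)<..}"
  have low: "lowest S i \<ge> 1" if "i \<in> I" for i using lowest(1)[of i S] that S by (auto simp: I_def)
  have eB: "emeasure (mean_meas 1 \<alpha>) (?B i) = ennreal (1 / real (K ^ 4) * (real (lowest S i) / real K) powr (- \<alpha>))"
    if "i \<in> I" for i
    using K low[OF that] by (intro emeasure_mean_meas_box \<alpha> emeasure_lborel_block) auto
  have "emeasure (mean_meas 1 \<alpha>) (\<Union>i\<in>I. ?B i) = (\<Sum>i\<in>I. emeasure (mean_meas 1 \<alpha>) (?B i))"
    using block_disjoint[OF K] finI
    by (intro sum_emeasure[symmetric]) (auto simp: disjoint_family_on_def)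
  also have "\<dots> = (\<Sum>i\<in>I. ennreal (1 / real (K ^ 4) * (real (lowest S i) / real K) powr (- \<alpha>)))"
    by (intro sum.cong refl eB)
  also have "\<dots> = ennreal (void_rate \<alpha> K S)"
    unfolding void_rate_def I_def by (intro sum_ennreal) auto
  finally have e: "emeasure (mean_meas 1 \<alpha>) (\<Union>i\<in>I. ?B i) = ennreal (void_rate \<alpha> K S)" .
  have "{\<omega>\<in>space N. cell K r (config \<omega>) \<inter> S = {}} = {\<omega>\<in>space N. \<forall>k. P k \<omega> \<notin> (\<Union>i\<in>I. ?B i)}"
    unfolding cell_disjoint_iff[OF S] I_def[symmetric] by (auto simp: mem_Times_iff not_less)
  moreover have "0 \<le> void_rate \<alpha> K S" by (auto simp: void_rate_def intro!: sum_nonneg)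
  moreover have "(\<Union>i\<in>I. ?B i) \<in> sets (borel \<Otimes>\<^sub>M borel)" using finI by auto
  ultimately show ?thesis using void_prob[OF _ e] by simp
qed

lemma prob_bad_le:
  assumes K: "K > 0" and r: "real K * (real (Suc r) / real K) powr (- \<alpha>) \<le> 1 / real K"
  shows "prob {\<omega>\<in>space N. bad K r (config \<omega>)} \<le> 4 / real K"
proof -
  let ?h = "{ennreal (1 / real K)<..}"
  let ?E1 = "{\<omega>\<in>space N. \<exists>k. P k \<omega> \<in> {..0} \<times> ?h}"
  let ?E2 = "\<lambda>i. {\<omega>\<in>space N. \<exists>k k'. k \<noteq> k' \<and> P k \<omega> \<in> block K i \<times> ?h \<and> P k' \<omega> \<in> block K i \<times> ?h}"
  let ?E3 = "{\<omega>\<in>space N. \<exists>k. P k \<omega> \<in> {..real K} \<times> {ennreal (real (Suc r) / real K)<..}}"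
  define x where "x = 1 / real (K ^ 4) * (1 / real K) powr (- \<alpha>)"
  have "{\<omega>\<in>space N. bad K r (config \<omega>)} \<subseteq> (?E1 \<union> (\<Union>i\<in>{..<K ^ 5}. ?E2 i)) \<union> ?E3"
    unfolding bad_def by (fastforce simp: mem_Times_iff)
  then have "prob {\<omega>\<in>space N. bad K r (config \<omega>)} \<le> prob ((?E1 \<union> (\<Union>i\<in>{..<K ^ 5}. ?E2 i)) \<union> ?E3)"
    by (rule finite_measure_mono) measurable
  also have "\<dots> \<le> prob (?E1 \<union> (\<Union>i\<in>{..<K ^ 5}. ?E2 i)) + prob ?E3"
    by (rule measure_Un_le) measurable
  also have "\<dots> \<le> (prob ?E1 + prob (\<Union>i\<in>{..<K ^ 5}. ?E2 i)) + prob ?E3"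
    by (intro add_right_mono measure_Un_le) measurable
  also have "\<dots> \<le> (prob ?E1 + (\<Sum>i\<in>{..<K ^ 5}. prob (?E2 i))) + prob ?E3"
    by (intro add_right_mono add_left_mono finite_measure_subadditive_finite) auto
  also have "\<dots> \<le> (0 + (\<Sum>i\<in>{..<K ^ 5}. x\<^sup>2)) + 1 / real K"
  proof (intro add_mono sum_mono)
    have "emeasure lborel ({0..} \<inter> {..0::real}) = ennreal 0"
    proof -
      have "{0..} \<inter> {..0::real} = {0}" by auto
      then show ?thesis by simp
    qed
    from prob_occupied_le[OF _ emeasure_mean_meas_box[OF \<alpha>(1) _ _ this]] show "prob ?E1 \<le> 0" using K by simp
    show "prob (?E2 i) \<le> x\<^sup>2" for i
      unfolding x_def using K
      by (intro prob_two_points_le emeasure_mean_meas_box \<alpha> emeasure_lborel_block) auto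
    have "{0..} \<inter> {..real K} = {0..real K}" by auto
    then have e: "emeasure lborel ({0..} \<inter> {..real K}) = ennreal (real K)" by simp
    have "prob ?E3 \<le> real K * (real (Suc r) / real K) powr (- \<alpha>)"
      using K by (intro prob_occupied_le emeasure_mean_meas_box[OF \<alpha>(1) _ _ e]) auto
    then show "prob ?E3 \<le> 1 / real K" using r by linarith
  qed
  also have "\<dots> = real (K ^ 5) * x\<^sup>2 + 1 / real K" by simp
  also have "real (K ^ 5) * x\<^sup>2 \<le> 1 / real K"
    unfolding x_def by (rule block_pair_bound[OF K \<alpha>])
  finally have "prob {\<omega>\<in>space N. bad K r (config \<omega>)} \<le> 1 / real K + 1 / real K" by simp
  \<comment> \<open>Relaxed to the bound that also holds before the limit, where the approximation
    of the process adds its own error.\<close>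
  also have "\<dots> \<le> 4 / real K" using K by (simp add: field_simps)
  finally show ?thesis .
qed

end

section \<open>Regularly varying tails\<close>

text \<open>The factor by which G differs from its regularly varying equivalent tends to 1 and
  cancels in the ratio; slow variation of L does the rest.\<close>

lemma tail_ratio_tendsto:
  fixes G L :: "real \<Rightarrow> real"
  assumes sv: "slowly_varying L" and tail: "G \<sim>[at_top] (\<lambda>x. x powr (- \<alpha>) * L x)" and c: "c > 0"
  shows "((\<lambda>x. G (c * x) / G x) \<longlongrightarrow> c powr (- \<alpha>)) at_top"
proof -
  define g where "g x = x powr (- \<alpha>) * L x" for x
  define \<rho> where "\<rho> x = G x / g x" for x
  have g: "g x \<noteq> 0" if "x > 0" for x using sv that by (auto simp: g_def slowly_varying_def)
  have "\<forall>\<^sub>F x in at_top. G x \<noteq> 0 \<or> x powr (- \<alpha>) * L x \<noteq> 0"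
    using eventually_gt_at_top[of 0] by eventually_elim (use g in \<open>auto simp: g_def\<close>)
  from asymp_equivD_strong[OF tail this] have \<rho>: "(\<rho> \<longlongrightarrow> 1) at_top"
    by (simp add: \<rho>_def[abs_def] g_def)
  have top: "filterlim (\<lambda>x. c * x) at_top at_top"
    using c by (intro filterlim_tendsto_pos_mult_at_top[OF tendsto_const]) (auto intro: filterlim_ident)
  have L: "((\<lambda>x. L (c * x) / L x) \<longlongrightarrow> 1) at_top" using sv c by (simp add: slowly_varying_def)
  have lim: "((\<lambda>x. \<rho> (c * x) / \<rho> x * (c powr (- \<alpha>) * (L (c * x) / L x))) \<longlongrightarrow> 1 / 1 * (c powr (- \<alpha>) * 1)) at_top"
    by (intro tendsto_intros \<rho> L filterlim_compose[OF \<rho> top]) auto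
  have "\<forall>\<^sub>F x in at_top. \<rho> (c * x) / \<rho> x * (c powr (- \<alpha>) * (L (c * x) / L x)) = G (c * x) / G x"
    using eventually_gt_at_top[of 0]
  proof eventually_elim
    case (elim x)
    have "c powr (- \<alpha>) * (L (c * x) / L x) = g (c * x) / g x"
      using elim c by (simp add: g_def powr_mult)
    moreover have "G (c * x) = \<rho> (c * x) * g (c * x)" "G x = \<rho> x * g x"
      using g[of "c * x"] g[of x] elim c by (auto simp: \<rho>_def)
    ultimately show ?case by simp
  qed
  from Lim_transform_eventually[OF lim this] show ?thesis by simp
qed

text \<open>
  For \<open>\<alpha> < 1\<close> the monotonicity of \<open>G\<close> replaces the uniform convergence theorem: only the ratios
  along doubling arguments are needed.
\<close>

lemma tail_times_id_at_top:
  fixes G L :: "real \<Rightarrow> real"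
  assumes sv: "slowly_varying L" and tail: "G \<sim>[at_top] (\<lambda>x. x powr (- \<alpha>) * L x)"
    and \<alpha>: "\<alpha> \<le> 1" and one: "\<alpha> = 1 \<Longrightarrow> filterlim L at_top at_top"
    and anti: "antimono G" and pos: "\<And>x. G x > 0"
  shows "filterlim (\<lambda>x. x * G x) at_top at_top"
proof (cases "\<alpha> = 1")
  case True
  define \<rho> where "\<rho> x = G x / (x powr (- \<alpha>) * L x)" for x
  have "\<forall>\<^sub>F x in at_top. G x \<noteq> 0 \<or> x powr (- \<alpha>) * L x \<noteq> 0"
    using pos by (intro always_eventually) (metis less_irrefl)
  from asymp_equivD_strong[OF tail this] have \<rho>: "(\<rho> \<longlongrightarrow> 1) at_top" by (simp add: \<rho>_def[abs_def])
  have lim: "filterlim (\<lambda>x. \<rho> x * L x) at_top at_top"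
    by (rule filterlim_tendsto_pos_mult_at_top[OF \<rho> _ one[OF True]]) simp
  have "\<forall>\<^sub>F x in at_top. \<rho> x * L x = x * G x"
    using eventually_gt_at_top[of 0]
  proof eventually_elim
    case (elim x)
    have "L x > 0" using sv elim by (simp add: slowly_varying_def)
    then show ?case using elim True by (simp add: \<rho>_def powr_minus field_simps)
  qed
  then show ?thesis using lim by (simp add: filterlim_cong)
next
  case False
  then have \<alpha>1: "\<alpha> < 1" using \<alpha> by simp
  \<comment> \<open>The midpoint between 1 and \<open>2 powr (1 - \<alpha>)\<close>: large enough to
    make H grow geometrically along doublings, small enough that q/2 stays below the limit of the
    ratio G(2x)/G(x).\<close>
  define q where "q = (1 + 2 powr (1 - \<alpha>)) / 2"
  have p1: "2 powr (1 - \<alpha>) > (1::real)" using \<alpha>1 by simp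
  have q: "q > 1" "q / 2 < 2 powr (- \<alpha>)"
    using p1 by (simp_all add: q_def powr_diff powr_minus field_simps)
  have "\<forall>\<^sub>F x in at_top. q / 2 < G (2 * x) / G x"
    using q by (intro order_tendstoD(1)[OF tail_ratio_tendsto[OF sv tail]]) auto
  then obtain x1 where x1: "\<And>x. x \<ge> x1 \<Longrightarrow> q / 2 < G (2 * x) / G x"
    by (auto simp: eventually_at_top_linorder)
  define x0 where "x0 = max x1 1"
  have x0: "x0 \<ge> 1" by (simp add: x0_def)
  define H where "H x = x * G x" for x
  have H_double: "q * H x \<le> H (2 * x)" if "x \<ge> x0" for x
  proof -
    have "q / 2 * G x \<le> G (2 * x)" using x1[of x] that pos[of x] by (simp add: x0_def field_simps)
    then have "2 * x * (q / 2 * G x) \<le> 2 * x * G (2 * x)" using that x0 by (intro mult_left_mono) auto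
    then show ?thesis by (simp add: H_def algebra_simps)
  qed
  have H0: "H x0 > 0" using x0 pos[of x0] by (simp add: H_def)
  have H_pow: "q ^ j * H x0 \<le> H (2 ^ j * x0)" for j
  proof (induction j)
    case (Suc j)
    have "x0 * 1 \<le> x0 * 2 ^ j" using x0 by (intro mult_left_mono) auto
    then have "q * H (2 ^ j * x0) \<le> H (2 * (2 ^ j * x0))" by (intro H_double) (simp add: mult.commute)
    moreover have "q * (q ^ j * H x0) \<le> q * H (2 ^ j * x0)" using Suc q by (intro mult_left_mono) auto
    ultimately show ?case by (simp add: mult.assoc)
  qed simp
  show ?thesis unfolding H_def[symmetric]
  proof (subst filterlim_at_top, rule allI)
    fix Z :: real
    obtain m where "Z / (H x0 / 2) < q ^ m" using real_arch_pow[OF q(1)] by blast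
    then have m: "Z \<le> q ^ m * (H x0 / 2)" using H0 by (simp add: field_simps)
    show "\<forall>\<^sub>F x in at_top. Z \<le> H x"
      using eventually_ge_at_top[of "2 ^ m * x0"]
    proof eventually_elim
      case (elim x)
      \<comment> \<open>x lies between consecutive doublings of x0. Bounding x from below by the
        smaller one and G x by its value at the larger one loses a factor 2, hence
        \<open>H x0 / 2\<close> in the choice of m.\<close>
      define j where "j = (LEAST j. x < 2 ^ j * x0)"
      obtain i where "x / x0 < 2 ^ i" using real_arch_pow[of 2 "x / x0"] by auto
      then have ex: "x < 2 ^ i * x0" using x0 by (simp add: field_simps)
      have j: "x < 2 ^ j * x0" unfolding j_def by (rule LeastI[of _ i]) (rule ex)
      have mj: "m < j"
      proof (rule ccontr)
        assume "\<not> m < j"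
        then have "(2::real) ^ j * x0 \<le> 2 ^ m * x0" using x0 by (intro mult_right_mono power_increasing) auto
        then show False using j elim by simp
      qed
      then obtain j' where j': "j = Suc j'" by (cases j) auto
      have "\<not> x < 2 ^ j' * x0" unfolding j' using not_less_Least[of j' "\<lambda>j. x < 2 ^ j * x0"] j' by (simp add: j_def)
      then have xj: "2 ^ j' * x0 \<le> x" by simp
      have "q ^ m * (H x0 / 2) \<le> q ^ j * (H x0 / 2)" using q H0 mj by (intro mult_right_mono power_increasing) auto
      also have "\<dots> \<le> H (2 ^ j * x0) / 2" using H_pow[of j] by simp
      also have "\<dots> = 2 ^ j' * x0 * G (2 ^ j * x0)" by (simp add: H_def j')
      also have "\<dots> \<le> x * G x" using xj j x0 pos by (intro mult_mono antimonoD[OF anti]) (auto intro: less_imp_le order_trans[OF _ xj])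
      finally show ?case using m by (simp add: H_def)
    qed
  qed
qed

text \<open>A nonnegative antitone function with one zero vanishes from there on, but G is
  eventually nonzero, being equivalent to a positive function.\<close>

lemma tail_pos:
  fixes G L :: "real \<Rightarrow> real"
  assumes sv: "slowly_varying L" and tail: "G \<sim>[at_top] (\<lambda>x. x powr (- \<alpha>) * L x)"
    and anti: "antimono G" and nonneg: "\<And>x. 0 \<le> G x"
  shows "0 < G x"
proof -
  have "\<forall>\<^sub>F x in at_top. x powr (- \<alpha>) * L x \<noteq> 0"
    using eventually_gt_at_top[of 0] by eventually_elim (use sv in \<open>auto simp: slowly_varying_def\<close>)
  then have "\<forall>\<^sub>F x in at_top. G x \<noteq> 0"
    using asymp_equiv_eventually_zeros[OF tail] by eventually_elim auto
  then have "\<forall>\<^sub>F y in at_top. G y \<noteq> 0 \<and> x \<le> y" using eventually_ge_at_top[of x] by eventually_elim auto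
  then obtain y where "G y \<noteq> 0" "x \<le> y" using eventually_happens[of _ "at_top :: real filter"] by auto
  then show ?thesis using nonneg[of y] antimonoD[OF anti, of x y] by linarith
qed

text \<open>The assumption forces G(b_n) to 0, hence below the positive number G(C), and
  monotonicity then pushes b_n beyond C.\<close>

lemma normalization_at_top:
  fixes G :: "real \<Rightarrow> real" and b :: "nat \<Rightarrow> real"
  assumes anti: "antimono G" and pos: "\<And>x. 0 < G x" and b_lim: "(\<lambda>n. real n * G (b n)) \<longlonglongrightarrow> 1"
  shows "filterlim b at_top sequentially"
  unfolding filterlim_at_top
proof
  fix C :: real
  have "(\<lambda>n. real n * G (b n) * (1 / real n)) \<longlonglongrightarrow> 1 * 0" by (intro tendsto_mult b_lim lim_1_over_n)
  then have "\<forall>\<^sub>F n in sequentially. real n * G (b n) * (1 / real n) < G C"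
    using pos[of C] by (intro order_tendstoD(2)[of _ 0]) auto
  then show "\<forall>\<^sub>F n in sequentially. C \<le> b n"
    using eventually_gt_at_top[of 0]
  proof eventually_elim
    case (elim n)
    then have "G (b n) < G C" by simp
    then show ?case using antimonoD[OF anti, of "b n" C] by (meson not_less nle_le)
  qed
qed

lemma scaled_tail_tendsto:
  fixes G L :: "real \<Rightarrow> real" and b :: "nat \<Rightarrow> real"
  assumes sv: "slowly_varying L" and tail: "G \<sim>[at_top] (\<lambda>x. x powr (- \<alpha>) * L x)"
    and anti: "antimono G" and pos: "\<And>x. 0 < G x" and b_lim: "(\<lambda>n. real n * G (b n)) \<longlonglongrightarrow> 1" and x: "x > 0"
  shows "(\<lambda>n. real n * G (x * b n)) \<longlonglongrightarrow> x powr (- \<alpha>)"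
proof -
  have "(\<lambda>n. real n * G (b n) * (G (x * b n) / G (b n))) \<longlonglongrightarrow> 1 * x powr (- \<alpha>)"
    by (intro tendsto_mult b_lim filterlim_compose[OF tail_ratio_tendsto[OF sv tail x] normalization_at_top[OF anti pos b_lim]])
  moreover have "real n * G (b n) * (G (x * b n) / G (b n)) = real n * G (x * b n)" for n
    using pos[of "b n"] by simp
  ultimately show ?thesis by simp
qed

text \<open>Write b_n / n as b_n G(b_n) divided by n G(b_n): the numerator diverges, and the
  denominator tends to 1.\<close>

lemma normalization_superlinear:
  fixes G L :: "real \<Rightarrow> real" and b :: "nat \<Rightarrow> real"
  assumes sv: "slowly_varying L" and tail: "G \<sim>[at_top] (\<lambda>x. x powr (- \<alpha>) * L x)"
    and \<alpha>: "\<alpha> \<le> 1" and one: "\<alpha> = 1 \<Longrightarrow> filterlim L at_top at_top"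
    and anti: "antimono G" and pos: "\<And>x. 0 < G x" and b_lim: "(\<lambda>n. real n * G (b n)) \<longlonglongrightarrow> 1"
  shows "filterlim (\<lambda>n. b n / real n) at_top sequentially"
proof -
  have "filterlim (\<lambda>n. b n * G (b n)) at_top sequentially"
    by (rule filterlim_compose[OF tail_times_id_at_top[OF sv tail \<alpha> one anti pos] normalization_at_top[OF anti pos b_lim]])
  moreover have "(\<lambda>n. inverse (real n * G (b n))) \<longlonglongrightarrow> inverse 1" by (intro tendsto_inverse b_lim) simp
  ultimately have lim: "filterlim (\<lambda>n. inverse (real n * G (b n)) * (b n * G (b n))) at_top sequentially"
    using filterlim_tendsto_pos_mult_at_top by force
  have "inverse (real n * G (b n)) * (b n * G (b n)) = b n / real n" for n
    using pos[of "b n"] by (simp add: field_simps)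
  then show ?thesis using lim by simp
qed

section \<open>Scaled immigration points\<close>

text \<open>The Poisson limit with real parameters: the logarithm of 1 - a is squeezed between -a -
  2a^2 and -a, and N_n a_n^2 vanishes in the limit.\<close>

lemma power_tendsto_exp:
  fixes a :: "nat \<Rightarrow> real" and N :: "nat \<Rightarrow> nat"
  assumes na: "(\<lambda>n. real n * a n) \<longlonglongrightarrow> q" and a0: "\<And>n. 0 \<le> a n" and N: "(\<lambda>n. real (N n) / real n) \<longlonglongrightarrow> d"
  shows "(\<lambda>n. (1 - a n) ^ N n) \<longlonglongrightarrow> exp (- (d * q))"
proof -
  have pos: "\<forall>\<^sub>F n in sequentially. n > (0::nat)" by (rule eventually_gt_at_top)
  have "(\<lambda>n. real n * a n * (1 / real n)) \<longlonglongrightarrow> q * 0" by (intro tendsto_mult na lim_1_over_n)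
  moreover have "\<forall>\<^sub>F n in sequentially. real n * a n * (1 / real n) = a n" using pos by eventually_elim auto
  ultimately have alim: "a \<longlonglongrightarrow> 0" by (simp add: tendsto_cong)
  have "(\<lambda>n. real (N n) / real n * (real n * a n)) \<longlonglongrightarrow> d * q" by (intro tendsto_mult N na)
  moreover have "\<forall>\<^sub>F n in sequentially. real (N n) / real n * (real n * a n) = real (N n) * a n" using pos by eventually_elim auto
  ultimately have Na: "(\<lambda>n. real (N n) * a n) \<longlonglongrightarrow> d * q" by (simp add: tendsto_cong)
  have low: "(\<lambda>n. - (real (N n) * a n) - 2 * (real (N n) * a n) * a n) \<longlonglongrightarrow> - (d * q) - 2 * (d * q) * 0"
    by (intro tendsto_intros Na alim)
  have half: "\<forall>\<^sub>F n in sequentially. a n < 1 / 2" using alim by (intro order_tendstoD(2)[of _ 0]) auto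
  have "(\<lambda>n. real (N n) * ln (1 - a n)) \<longlonglongrightarrow> - (d * q)"
  proof (rule tendsto_sandwich)
    show "(\<lambda>n. - (real (N n) * a n) - 2 * (real (N n) * a n) * a n) \<longlonglongrightarrow> - (d * q)" using low by simp
    show "(\<lambda>n. - (real (N n) * a n)) \<longlonglongrightarrow> - (d * q)" by (intro tendsto_minus Na)
    show "\<forall>\<^sub>F n in sequentially. - (real (N n) * a n) - 2 * (real (N n) * a n) * a n \<le> real (N n) * ln (1 - a n)"
      using half
    proof eventually_elim
      case (elim n)
      have "- a n - 2 * (a n)\<^sup>2 \<le> ln (1 - a n)" using elim a0 by (intro ln_one_minus_pos_lower_bound) auto
      then have "real (N n) * (- a n - 2 * (a n)\<^sup>2) \<le> real (N n) * ln (1 - a n)" by (intro mult_left_mono) auto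
      then show ?case by (simp add: algebra_simps power2_eq_square)
    qed
    show "\<forall>\<^sub>F n in sequentially. real (N n) * ln (1 - a n) \<le> - (real (N n) * a n)"
      using half
    proof eventually_elim
      case (elim n)
      have "ln (1 - a n) \<le> - a n" using elim ln_le_minus_one[of "1 - a n"] by simp
      then have "real (N n) * ln (1 - a n) \<le> real (N n) * (- a n)" by (intro mult_left_mono) auto
      then show ?case by simp
    qed
  qed
  then have "(\<lambda>n. exp (real (N n) * ln (1 - a n))) \<longlonglongrightarrow> exp (- (d * q))" by (intro tendsto_exp)
  moreover have "\<forall>\<^sub>F n in sequentially. exp (real (N n) * ln (1 - a n)) = (1 - a n) ^ N n"
    using half by eventually_elim (simp add: exp_of_nat_mult)
  ultimately show ?thesis by (simp add: tendsto_cong)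
qed

definition block_index :: "nat \<Rightarrow> nat \<Rightarrow> nat \<Rightarrow> nat set" where
  "block_index K n i = {k. real k / real n \<in> block K i}"

lemma block_index_bounds:
  assumes "K > 0" "n > 0"
  shows "finite (block_index K n i)" "\<bar>real (card (block_index K n i)) - real n / real (K ^ 4)\<bar> \<le> 1"
proof -
  define D where "D = real (K ^ 4)"
  have D: "D > 0" using assms by (simp add: D_def)
  \<comment> \<open>Half-open blocks turn the index set into the integer interval from u + 1 to v.
    Each floor loses less than 1, so the difference of the two is off by at most 1.\<close>
  define u v where "u = nat \<lfloor>real n * real i / D\<rfloor>" and "v = nat \<lfloor>real n * real (Suc i) / D\<rfloor>"
  have "k \<in> block_index K n i \<longleftrightarrow> k \<in> {u<..v}" for k
  proof -
    have "k \<in> block_index K n i \<longleftrightarrow> real n * real i / D < real k \<and> real k \<le> real n * real (Suc i) / D"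
      using assms D by (auto simp: block_index_def block_def D_def field_simps)
    also have "real n * real i / D < real k \<longleftrightarrow> u < k"
    proof -
      have "\<lfloor>real n * real i / D\<rfloor> \<ge> 0" using D by simp
      then show ?thesis unfolding u_def by (simp add: nat_less_iff) linarith
    qed
    also have "real k \<le> real n * real (Suc i) / D \<longleftrightarrow> k \<le> v"
      unfolding v_def using D by (simp add: le_nat_iff le_floor_iff)
    finally show ?thesis by simp
  qed
  then have eq: "block_index K n i = {u<..v}" by blast
  show "finite (block_index K n i)" by (simp add: eq)
  have u: "real u \<le> real n * real i / D" "real n * real i / D < real u + 1"
  proof -
    have "real n * real i / D \<ge> 0" using D by simp
    then show "real u \<le> real n * real i / D" "real n * real i / D < real u + 1" unfolding u_def by linarith+
  qed
  have v: "real v \<le> real n * real (Suc i) / D" "real n * real (Suc i) / D < real v + 1"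
  proof -
    have "real n * real (Suc i) / D \<ge> 0" using D by simp
    then show "real v \<le> real n * real (Suc i) / D" "real n * real (Suc i) / D < real v + 1" unfolding v_def by linarith+
  qed
  have "real n * real i / D \<le> real n * real (Suc i) / D" using D by (intro divide_right_mono mult_left_mono) auto
  then have "real u < real v + 1" using u v by linarith
  then have "u \<le> v" by linarith
  then have "real (card (block_index K n i)) = real v - real u" by (simp add: eq of_nat_diff)
  moreover have "real n * real (Suc i) / D = real n * real i / D + real n / D" by (simp add: field_simps add_divide_distrib)
  ultimately show "\<bar>real (card (block_index K n i)) - real n / real (K ^ 4)\<bar> \<le> 1"
    using u v unfolding D_def[symmetric] by linarith
qed

lemma card_block_index_tendsto:
  assumes K: "K > 0"
  shows "(\<lambda>n. real (card (block_index K n i)) / real n) \<longlonglongrightarrow> 1 / real (K ^ 4)"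
proof (rule LIM_zero_cancel, rule Lim_null_comparison[OF _ lim_1_over_n])
  show "\<forall>\<^sub>F n in sequentially. norm (real (card (block_index K n i)) / real n - 1 / real (K ^ 4)) \<le> 1 / real n"
    using eventually_gt_at_top[of 0]
  proof eventually_elim
    case (elim n)
    have "real (card (block_index K n i)) / real n - 1 / real (K ^ 4)
        = (real (card (block_index K n i)) - real n / real (K ^ 4)) / real n"
      using elim by (simp add: diff_divide_distrib)
    then have "norm (real (card (block_index K n i)) / real n - 1 / real (K ^ 4))
        = \<bar>real (card (block_index K n i)) - real n / real (K ^ 4)\<bar> / real n" by simp
    also have "\<dots> \<le> 1 / real n" using block_index_bounds(2)[OF K elim, of i] by (intro divide_right_mono) auto
    finally show ?case .
  qed
qed

lemma log_plus_nonneg: "0 \<le> log_plus x"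
  by (simp add: log_plus_def)

text \<open>Reconciles the positive part in the points with the plain \<open>ln\<close> of the tail
  hypothesis: for j at most 1 neither side can hold when y is nonnegative, j = 0 included.\<close>

lemma log_plus_gt_iff: "0 \<le> y \<Longrightarrow> y < log_plus (real j) \<longleftrightarrow> y < ln (real j)"
  by (cases "j \<le> 1") (auto simp: log_plus_def le_Suc_eq)

text \<open>Every generation contributes a point; those with at most one immigrant have height 0 and
  are never visible.\<close>

definition immigration_points :: "(nat \<Rightarrow> 'a \<Rightarrow> nat) \<Rightarrow> (nat \<Rightarrow> real) \<Rightarrow> nat \<Rightarrow> 'a \<Rightarrow> nat \<Rightarrow> real \<times> ennreal" where
  "immigration_points J b n \<omega> k = (real k / real n, ennreal (log_plus (real (J k \<omega>)) / b n))"

text \<open>Regular variation enters only through the scaled tail limit, which already determines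
  the Poisson limit of the immigration points; offspring play no part at this stage.\<close>

locale immigration = prob_space M for M :: "'a measure" +
  fixes J :: "nat \<Rightarrow> 'a \<Rightarrow> nat" and b :: "nat \<Rightarrow> real" and \<alpha> :: real
  assumes J_indep: "indep_vars (\<lambda>_. count_space UNIV) J UNIV"
    and J_id: "\<And>k. distr M (count_space UNIV) (J k) = distr M (count_space UNIV) (J 0)"
    and \<alpha>: "0 < \<alpha>" "\<alpha> \<le> 1"
    and b_pos: "\<And>n. n \<ge> 1 \<Longrightarrow> 0 < b n"
    and scaled_tail: "\<And>x. x > 0 \<Longrightarrow>
       (\<lambda>n. real n * measure M {\<omega>\<in>space M. ln (real (J 0 \<omega>)) > x * b n}) \<longlonglongrightarrow> x powr (- \<alpha>)"
begin

lemma J_measurable [measurable]: "J k \<in> measurable M (count_space UNIV)"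
  using J_indep by (auto simp: indep_vars_def)

definition G :: "real \<Rightarrow> real" where "G x = prob {\<omega>\<in>space M. ln (real (J 0 \<omega>)) > x}"

lemma J_prob_eq: "prob {\<omega>\<in>space M. J k \<omega> \<in> A} = prob {\<omega>\<in>space M. J 0 \<omega> \<in> A}"
proof -
  have "prob {\<omega>\<in>space M. J i \<omega> \<in> A} = measure (distr M (count_space UNIV) (J i)) A" for i
    by (subst measure_distr) (auto intro!: arg_cong[where f=prob])
  then show ?thesis using J_id[of k] by simp
qed

lemma prob_J_gt: "prob {\<omega>\<in>space M. ln (real (J k \<omega>)) > x} = G x"
  using J_prob_eq[of k "{j. ln (real j) > x}"] by (simp add: G_def)

lemma prob_J_le: "prob {\<omega>\<in>space M. ln (real (J k \<omega>)) \<le> x} = 1 - G x"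
proof -
  have "{\<omega>\<in>space M. ln (real (J k \<omega>)) \<le> x} = space M - {\<omega>\<in>space M. ln (real (J k \<omega>)) > x}" by auto
  moreover have "{\<omega>\<in>space M. ln (real (J k \<omega>)) > x} \<in> events" by measurable
  ultimately show ?thesis using prob_compl prob_J_gt by simp
qed

lemma points_measurable:
  "(\<lambda>\<omega>. fst (immigration_points J b n \<omega> k)) \<in> borel_measurable M"
  "(\<lambda>\<omega>. snd (immigration_points J b n \<omega> k)) \<in> borel_measurable M"
  by (simp_all add: immigration_points_def)

lemma points_gt_iff:
  assumes "n \<ge> 1" "0 \<le> x"
  shows "snd (immigration_points J b n \<omega> k) > ennreal x \<longleftrightarrow> ln (real (J k \<omega>)) > x * b n"
proof -
  have "snd (immigration_points J b n \<omega> k) > ennreal x \<longleftrightarrow> x < log_plus (real (J k \<omega>)) / b n"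
    using assms by (simp add: immigration_points_def ennreal_less_iff)
  also have "\<dots> \<longleftrightarrow> x * b n < log_plus (real (J k \<omega>))" using b_pos[OF assms(1)] by (simp add: pos_less_divide_eq)
  also have "\<dots> \<longleftrightarrow> ln (real (J k \<omega>)) > x * b n"
    using assms b_pos[OF assms(1)] by (intro log_plus_gt_iff) auto
  finally show ?thesis .
qed

lemma fst_points [simp]: "fst (immigration_points J b n \<omega> k) = real k / real n"
  by (simp add: immigration_points_def)

text \<open>Every generation lies in at most one block, so the void event constrains each J_k
  separately, and independence yields one power per block.\<close>

lemma void_prob_cell:
  assumes K: "K > 0" and n: "n \<ge> 1" and S: "S \<subseteq> {..<K ^ 5} \<times> {1..r}"
  shows "prob {\<omega>\<in>space M. cell K r (immigration_points J b n \<omega>) \<inter> S = {}} =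
     (\<Prod>i\<in>fst ` S. (1 - G (real (lowest S i) / real K * b n)) ^ card (block_index K n i))"
proof -
  define I where "I = fst ` S"
  have finS: "finite S" using S by (rule finite_subset) auto
  then have finI: "finite I" by (simp add: I_def)
  define U where "U = (\<Union>i\<in>I. block_index K n i)"
  have finU: "finite U" using finI block_index_bounds(1)[OF K] n by (auto simp: U_def)
  define y where "y i = real (lowest S i) / real K * b n" for i
  \<comment> \<open>Although quantified over all blocks, the constraint comes from the only block
    that contains k.\<close>
  define A where "A k = {j::nat. \<forall>i\<in>I. k \<in> block_index K n i \<longrightarrow> ln (real j) \<le> y i}" for k
  have disj: "i = i'" if "k \<in> block_index K n i" "k \<in> block_index K n i'" for i i' k
    using that block_disjoint[OF K, of i i'] by (auto simp: block_index_def)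
  have le_iff: "snd (immigration_points J b n \<omega> k) \<le> ennreal (real (lowest S i) / real K) \<longleftrightarrow> ln (real (J k \<omega>)) \<le> y i" for \<omega> k i
    unfolding y_def using points_gt_iff[OF n divide_nonneg_nonneg[OF of_nat_0_le_iff of_nat_0_le_iff], of "lowest S i" K \<omega> k]
    by (metis not_less)
  have "{\<omega>\<in>space M. cell K r (immigration_points J b n \<omega>) \<inter> S = {}} = {\<omega>\<in>space M. \<forall>k\<in>U. J k \<omega> \<in> A k}"
    unfolding cell_disjoint_iff[OF S] I_def[symmetric] le_iff fst_points A_def U_def block_index_def by auto
  also have "prob \<dots> = (\<Prod>k\<in>U. prob {\<omega>\<in>space M. J k \<omega> \<in> A k})"
  proof (cases "U = {}")
    case True
    then show ?thesis using prob_space by simp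
  next
    case False
    have "prob (\<Inter>k\<in>U. J k -` A k \<inter> space M) = (\<Prod>k\<in>U. prob (J k -` A k \<inter> space M))"
      using False finU by (intro indep_varsD[OF J_indep]) auto
    moreover have "(\<Inter>k\<in>U. J k -` A k \<inter> space M) = {\<omega>\<in>space M. \<forall>k\<in>U. J k \<omega> \<in> A k}" using False by auto
    moreover have "J k -` A k \<inter> space M = {\<omega>\<in>space M. J k \<omega> \<in> A k}" for k by auto
    ultimately show ?thesis by simp
  qed
  also have "\<dots> = (\<Prod>i\<in>I. \<Prod>k\<in>block_index K n i. prob {\<omega>\<in>space M. J k \<omega> \<in> A k})"
    unfolding U_def
  proof (rule prod.UNION_disjoint)
    show "\<forall>i\<in>I. finite (block_index K n i)" using block_index_bounds(1)[OF K] n by simp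
    show "\<forall>i\<in>I. \<forall>j\<in>I. i \<noteq> j \<longrightarrow> block_index K n i \<inter> block_index K n j = {}" using disj by blast
  qed (rule finI)
  also have "\<dots> = (\<Prod>i\<in>I. \<Prod>k\<in>block_index K n i. 1 - G (y i))"
  proof (intro prod.cong refl)
    fix i k assume ik: "i \<in> I" "k \<in> block_index K n i"
    have "A k = {j. ln (real j) \<le> y i}" unfolding A_def using ik disj by blast
    then show "prob {\<omega>\<in>space M. J k \<omega> \<in> A k} = 1 - G (y i)" using prob_J_le[of k "y i"] by simp
  qed
  finally show ?thesis by (simp add: I_def y_def)
qed

lemma G_tendsto: "x > 0 \<Longrightarrow> (\<lambda>n. real n * G (x * b n)) \<longlonglongrightarrow> x powr (- \<alpha>)"
  using scaled_tail by (simp add: G_def)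

lemma G_nonneg: "0 \<le> G x" by (simp add: G_def)

lemma void_prob_tendsto:
  assumes K: "K > 0" and S: "S \<subseteq> {..<K ^ 5} \<times> {1..r}"
  shows "(\<lambda>n. prob {\<omega>\<in>space M. cell K r (immigration_points J b n \<omega>) \<inter> S = {}}) \<longlonglongrightarrow> exp (- void_rate \<alpha> K S)"
proof -
  have fin: "finite S" using S by (rule finite_subset) auto
  have "(\<lambda>n. \<Prod>i\<in>fst ` S. (1 - G (real (lowest S i) / real K * b n)) ^ card (block_index K n i))
     \<longlonglongrightarrow> (\<Prod>i\<in>fst ` S. exp (- (1 / real (K ^ 4) * (real (lowest S i) / real K) powr (- \<alpha>))))"
  proof (intro tendsto_prod power_tendsto_exp G_tendsto G_nonneg card_block_index_tendsto K)
    fix i assume "i \<in> fst ` S"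
    then show "0 < real (lowest S i) / real K" using lowest(1)[of i S] S K by auto
  qed
  also have "(\<Prod>i\<in>fst ` S. exp (- (1 / real (K ^ 4) * (real (lowest S i) / real K) powr (- \<alpha>)))) = exp (- void_rate \<alpha> K S)"
    using fin by (simp add: void_rate_def exp_sum flip: sum_negf)
  finally show ?thesis
  proof (rule Lim_transform_eventually)
    show "\<forall>\<^sub>F n in sequentially. (\<Prod>i\<in>fst ` S. (1 - G (real (lowest S i) / real K * b n)) ^ card (block_index K n i)) =
      prob {\<omega>\<in>space M. cell K r (immigration_points J b n \<omega>) \<inter> S = {}}"
      using eventually_ge_at_top[of 1] by eventually_elim (rule void_prob_cell[OF K _ S, symmetric])
  qed
qed

text \<open>Union bound over ordered pairs of distinct indices, each of probability (G x)^2 by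
  independence.\<close>

lemma prob_two_J_le:
  assumes "finite A"
  shows "prob {\<omega>\<in>space M. \<exists>k\<in>A. \<exists>k'\<in>A. k \<noteq> k' \<and> ln (real (J k \<omega>)) > x \<and> ln (real (J k' \<omega>)) > x} \<le> (real (card A) * G x)\<^sup>2"
proof -
  let ?E = "\<lambda>(k, k'). {\<omega>\<in>space M. ln (real (J k \<omega>)) > x \<and> ln (real (J k' \<omega>)) > x}"
  let ?Q = "{(k, k'). k \<in> A \<and> k' \<in> A \<and> k \<noteq> k'}"
  have finQ: "finite ?Q" by (rule finite_subset[of _ "A \<times> A"]) (use assms in auto)
  have cardQ: "card ?Q \<le> card A * card A"
    using assms by (subst card_cartesian_product[symmetric]) (intro card_mono, auto)
  have "prob {\<omega>\<in>space M. \<exists>k\<in>A. \<exists>k'\<in>A. k \<noteq> k' \<and> ln (real (J k \<omega>)) > x \<and> ln (real (J k' \<omega>)) > x}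
      = prob (\<Union>q\<in>?Q. ?E q)"
    by (intro arg_cong[where f=prob]) auto
  also have "\<dots> \<le> (\<Sum>q\<in>?Q. prob (?E q))"
    using finQ by (intro finite_measure_subadditive_finite) auto
  also have "\<dots> \<le> (\<Sum>q\<in>?Q. (G x)\<^sup>2)"
  proof (intro sum_mono)
    fix q assume "q \<in> ?Q"
    then obtain k k' where q: "q = (k, k')" "k \<noteq> k'" by auto
    let ?B = "{j::nat. ln (real j) > x}"
    have "prob (\<Inter>i\<in>{k, k'}. J i -` ?B \<inter> space M) = (\<Prod>i\<in>{k, k'}. prob (J i -` ?B \<inter> space M))"
      by (intro indep_varsD[OF J_indep]) auto
    moreover have "(\<Inter>i\<in>{k, k'}. J i -` ?B \<inter> space M) = ?E q" using q by auto
    moreover have "prob (J i -` ?B \<inter> space M) = G x" for i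
      using prob_J_gt[of x i] by (simp add: vimage_def Int_def conj_commute)
    ultimately show "prob (?E q) \<le> (G x)\<^sup>2" using q by (simp add: power2_eq_square)
  qed
  also have "\<dots> = real (card ?Q) * (G x)\<^sup>2" by simp
  also have "\<dots> \<le> real (card A * card A) * (G x)\<^sup>2" using cardQ by (intro mult_right_mono) (simp_all only: of_nat_le_iff zero_le_power2)
  also have "\<dots> = (real (card A) * G x)\<^sup>2" by (simp add: power2_eq_square)
  finally show ?thesis .
qed

lemma prob_bad_le:
  assumes K: "K > 0" and n: "n \<ge> 1"
  shows "prob {\<omega>\<in>space M. bad K r (immigration_points J b n \<omega>)} \<le>
     G (1 / real K * b n) + (\<Sum>i<K ^ 5. (real (card (block_index K n i)) * G (1 / real K * b n))\<^sup>2)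
     + real (n * K + 1) * G (real (Suc r) / real K * b n)"
proof -
  let ?x = "1 / real K * b n" and ?z = "real (Suc r) / real K * b n"
  let ?E1 = "{\<omega>\<in>space M. ln (real (J 0 \<omega>)) > ?x}"
  let ?E2 = "\<lambda>i. {\<omega>\<in>space M. \<exists>k\<in>block_index K n i. \<exists>k'\<in>block_index K n i.
        k \<noteq> k' \<and> ln (real (J k \<omega>)) > ?x \<and> ln (real (J k' \<omega>)) > ?x}"
  let ?E3 = "\<Union>k\<in>{..n * K}. {\<omega>\<in>space M. ln (real (J k \<omega>)) > ?z}"
  have gt1: "snd (immigration_points J b n \<omega> k) > ennreal (1 / real K) \<longleftrightarrow> ln (real (J k \<omega>)) > ?x" for \<omega> k
    using points_gt_iff[OF n, of "1 / real K"] by simp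
  have gtr: "snd (immigration_points J b n \<omega> k) > ennreal (real (Suc r) / real K) \<longleftrightarrow> ln (real (J k \<omega>)) > ?z" for \<omega> k
    using points_gt_iff[OF n, of "real (Suc r) / real K"] by simp
  \<comment> \<open>Generation 0 is the only one rescaled to time 0, and the generations up to time
    K number nK + 1.\<close>
  have k0: "real k / real n \<le> 0 \<longleftrightarrow> k = 0" for k using n by (simp add: divide_le_0_iff)
  have kK: "real k / real n \<le> real K \<longleftrightarrow> k \<le> n * K" for k
    using n by (simp add: pos_divide_le_eq mult.commute flip: of_nat_mult)
  have "{\<omega>\<in>space M. bad K r (immigration_points J b n \<omega>)} \<subseteq> (?E1 \<union> (\<Union>i\<in>{..<K ^ 5}. ?E2 i)) \<union> ?E3"
    unfolding bad_def gt1 gtr fst_points k0 kK by (auto simp: block_index_def)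
  then have "prob {\<omega>\<in>space M. bad K r (immigration_points J b n \<omega>)} \<le> prob ((?E1 \<union> (\<Union>i\<in>{..<K ^ 5}. ?E2 i)) \<union> ?E3)"
    by (rule finite_measure_mono) measurable
  also have "\<dots> \<le> prob (?E1 \<union> (\<Union>i\<in>{..<K ^ 5}. ?E2 i)) + prob ?E3"
    by (rule measure_Un_le) measurable
  also have "\<dots> \<le> (prob ?E1 + prob (\<Union>i\<in>{..<K ^ 5}. ?E2 i)) + prob ?E3"
    by (intro add_right_mono measure_Un_le) measurable
  also have "\<dots> \<le> (prob ?E1 + (\<Sum>i\<in>{..<K ^ 5}. prob (?E2 i))) + (\<Sum>k\<in>{..n * K}. prob {\<omega>\<in>space M. ln (real (J k \<omega>)) > ?z})"
    by (intro add_mono order_refl finite_measure_subadditive_finite) auto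
  also have "\<dots> \<le> (G ?x + (\<Sum>i\<in>{..<K ^ 5}. (real (card (block_index K n i)) * G ?x)\<^sup>2)) + (\<Sum>k\<in>{..n * K}. G ?z)"
    using block_index_bounds(1)[OF K] n
    by (intro add_mono sum_mono prob_two_J_le) (auto simp: prob_J_gt)
  also have "(\<Sum>k\<in>{..n * K}. G ?z) = real (n * K + 1) * G ?z" by simp
  finally show ?thesis .
qed

lemma eventually_prob_bad_le:
  assumes K: "K > 0" and r: "real K * (real (Suc r) / real K) powr (- \<alpha>) \<le> 1 / real K"
  shows "\<forall>\<^sub>F n in sequentially. prob {\<omega>\<in>space M. bad K r (immigration_points J b n \<omega>)} \<le> 3 / real K"
proof -
  have pos: "\<forall>\<^sub>F n in sequentially. n > (0::nat)" by (rule eventually_gt_at_top)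
  have G0: "(\<lambda>n. G (x * b n)) \<longlonglongrightarrow> 0" if "x > 0" for x
  proof -
    have "(\<lambda>n. real n * G (x * b n) * (1 / real n)) \<longlonglongrightarrow> x powr (- \<alpha>) * 0"
      by (intro tendsto_mult G_tendsto lim_1_over_n that)
    moreover have "\<forall>\<^sub>F n in sequentially. real n * G (x * b n) * (1 / real n) = G (x * b n)" using pos by eventually_elim auto
    ultimately show ?thesis by (simp add: tendsto_cong)
  qed
  have cG: "(\<lambda>n. real (card (block_index K n i)) * G (1 / real K * b n)) \<longlonglongrightarrow> 1 / real (K ^ 4) * (1 / real K) powr (- \<alpha>)" for i
  proof -
    have "(\<lambda>n. real (card (block_index K n i)) / real n * (real n * G (1 / real K * b n))) \<longlonglongrightarrow> 1 / real (K ^ 4) * (1 / real K) powr (- \<alpha>)"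
      using K by (intro tendsto_mult G_tendsto card_block_index_tendsto) auto
    moreover have "\<forall>\<^sub>F n in sequentially. real (card (block_index K n i)) / real n * (real n * G (1 / real K * b n)) =
        real (card (block_index K n i)) * G (1 / real K * b n)" using pos by eventually_elim auto
    ultimately show ?thesis by (simp add: tendsto_cong)
  qed
  let ?z = "real (Suc r) / real K"
  have z: "?z > 0" using K by simp
  have G3: "(\<lambda>n. real (n * K + 1) * G (?z * b n)) \<longlonglongrightarrow> real K * ?z powr (- \<alpha>) + 0"
  proof -
    have "(\<lambda>n. real K * (real n * G (?z * b n)) + G (?z * b n)) \<longlonglongrightarrow> real K * ?z powr (- \<alpha>) + 0"
      by (intro tendsto_intros G_tendsto G0 z)
    then show ?thesis by (simp add: algebra_simps)
  qed
  define x where "x = 1 / real (K ^ 4) * (1 / real K) powr (- \<alpha>)"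
  have lim: "(\<lambda>n. G (1 / real K * b n) + (\<Sum>i<K ^ 5. (real (card (block_index K n i)) * G (1 / real K * b n))\<^sup>2)
     + real (n * K + 1) * G (?z * b n)) \<longlonglongrightarrow> 0 + (\<Sum>i<K ^ 5. x\<^sup>2) + (real K * ?z powr (- \<alpha>) + 0)"
    unfolding x_def using K by (intro tendsto_add tendsto_sum tendsto_power cG G3 G0) auto
  have "(\<Sum>i<K ^ 5. x\<^sup>2) \<le> 1 / real K"
    unfolding x_def using block_pair_bound[OF K \<alpha>] by simp
  \<comment> \<open>The limit is at most 2/K: generation 0 disappears, crowded blocks and points
    beyond the cap give 1/K each. The slack up to 3/K turns convergence into an eventual
    inequality.\<close>
  then have "0 + (\<Sum>i<K ^ 5. x\<^sup>2) + (real K * ?z powr (- \<alpha>) + 0) < 3 / real K"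
    using r K by (simp add: field_simps)
  from order_tendstoD(2)[OF lim this] eventually_ge_at_top[of 1]
  show ?thesis
  proof eventually_elim
    case (elim n)
    then show ?case using prob_bad_le[OF K, of n r] by linarith
  qed
qed

end

section \<open>Galton--Watson processes with immigration\<close>

text \<open>Generation n depends only on offspring numbers of earlier generations. This transfers
  the process to the coordinate space and isolates it from generation n.\<close>

lemma gw_cong:
  assumes "\<And>l m. l < n \<Longrightarrow> \<xi> i k l m \<omega> = \<xi>' i k l m \<omega>'"
  shows "gw \<xi> i k n \<omega> = gw \<xi>' i k n \<omega>'"
  using assms by (induction n) auto

lemma gw_pos:
  assumes "\<And>l. l < n \<Longrightarrow> \<xi> i k l 0 \<omega> \<ge> 1"
  shows "gw \<xi> i k n \<omega> \<ge> 1"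
  using assms
proof (induction n)
  case (Suc n)
  then have "gw \<xi> i k n \<omega> \<ge> 1" by simp
  then have "\<xi> i k n 0 \<omega> \<le> (\<Sum>m<gw \<xi> i k n \<omega>. \<xi> i k n m \<omega>)" by (intro member_le_sum) auto
  then show ?case using Suc.prems[of n] by simp
qed simp

lemma measurable_nat_sum:
  fixes f :: "nat \<Rightarrow> 'a \<Rightarrow> nat"
  assumes "\<And>m. m \<in> A \<Longrightarrow> f m \<in> measurable M (count_space UNIV)"
  shows "(\<lambda>\<omega>. \<Sum>m\<in>A. f m \<omega>) \<in> measurable M (count_space UNIV)"
proof (cases "finite A")
  case True
  then show ?thesis using assms
  proof (induction A rule: finite_induct)
    case (insert a A)
    have [measurable]: "f a \<in> measurable M (count_space UNIV)"
      "(\<lambda>\<omega>. \<Sum>m\<in>A. f m \<omega>) \<in> measurable M (count_space UNIV)" using insert by auto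
    have "(\<lambda>\<omega>. f a \<omega> + (\<Sum>m\<in>A. f m \<omega>)) \<in> measurable M (count_space UNIV)"
      by measurable
    then show ?case using insert by simp
  qed simp
qed simp

lemma measurable_gw:
  assumes "\<And>l m. l < n \<Longrightarrow> \<xi> i k l m \<in> measurable M (count_space UNIV)"
  shows "gw \<xi> i k n \<in> measurable M (count_space UNIV)"
  using assms
proof (induction n)
  case 0
  show ?case by (simp add: measurable_cong[of M "gw \<xi> i k 0" "\<lambda>_. 1"])
next
  case (Suc n)
  have "(\<lambda>\<omega>. \<Sum>m<gw \<xi> i k n \<omega>. \<xi> i k n m \<omega>) \<in> measurable M (count_space UNIV)"
    by (rule measurable_compose_countable[where f="\<lambda>c \<omega>. \<Sum>m<c. \<xi> i k n m \<omega>"])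
       (auto intro!: measurable_nat_sum Suc)
  then show ?case by (subst measurable_cong[where g="\<lambda>\<omega>. \<Sum>m<gw \<xi> i k n \<omega>. \<xi> i k n m \<omega>"]) auto
qed

section \<open>Offspring and immigration as one independent family\<close>

type_synonym gwi_index = "nat \<times> nat \<times> nat \<times> nat + nat"

text \<open>The coordinate projections arranged as an offspring array: \<open>gw coord\<close> is
  the process as a function on the product space, to which independence of restrictions
  applies.\<close>

definition coord :: "nat \<Rightarrow> nat \<Rightarrow> nat \<Rightarrow> nat \<Rightarrow> (gwi_index \<Rightarrow> nat) \<Rightarrow> nat" where
  "coord i k n m x = x (Inl (i, k, n, m))"

definition family :: "(nat \<Rightarrow> nat \<Rightarrow> nat \<Rightarrow> nat \<Rightarrow> 'a \<Rightarrow> nat) \<Rightarrow> (nat \<Rightarrow> 'a \<Rightarrow> nat) \<Rightarrow> gwi_index \<Rightarrow> 'a \<Rightarrow> nat" where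
  "family xi J x \<omega> = (case x of Inl (i, k, n, m) \<Rightarrow> xi i k n m \<omega> | Inr k \<Rightarrow> J k \<omega>)"

lemma family_simps [simp]: "family xi J (Inl (i, k, n, m)) \<omega> = xi i k n m \<omega>" "family xi J (Inr k) \<omega> = J k \<omega>"
  by (simp_all add: family_def)

abbreviation nat_product :: "gwi_index set \<Rightarrow> (gwi_index \<Rightarrow> nat) measure" where
  "nat_product A \<equiv> PiM A (\<lambda>_. count_space UNIV)"

lemma measurable_coord: "Inl (i, k, n, m) \<in> A \<Longrightarrow> coord i k n m \<in> measurable (nat_product A) (count_space UNIV)"
  unfolding coord_def by (rule measurable_component_singleton)

locale gwi_process = prob_space M for M :: "'a measure" +
  fixes xi :: "nat \<Rightarrow> nat \<Rightarrow> nat \<Rightarrow> nat \<Rightarrow> 'a \<Rightarrow> nat" and J :: "nat \<Rightarrow> 'a \<Rightarrow> nat" and mu :: real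
  assumes indep: "indep_vars (\<lambda>_. count_space UNIV) (family xi J) UNIV"
    and xi_id: "\<And>i k n m. distr M (count_space UNIV) (xi i k n m) = distr M (count_space UNIV) (xi 0 0 0 0)"
    and mean: "(\<integral>\<^sup>+\<omega>. of_nat (xi 0 0 0 0 \<omega>) \<partial>M) = ennreal mu" and mu_pos: "0 < mu"
begin

lemma family_measurable: "family xi J x \<in> measurable M (count_space UNIV)"
  using indep by (auto simp: indep_vars_def)

lemma xi_measurable [measurable]: "xi i k n m \<in> measurable M (count_space UNIV)"
  using family_measurable[of "Inl (i, k, n, m)"] by (simp add: family_def[abs_def])

lemma J_measurable [measurable]: "J k \<in> measurable M (count_space UNIV)"
  using family_measurable[of "Inr k"] by (simp add: family_def[abs_def])

lemma gw_measurable [measurable]: "gw xi i k n \<in> measurable M (count_space UNIV)"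
  by (rule measurable_gw) simp

lemma J_indep: "indep_vars (\<lambda>_. count_space UNIV) J UNIV"
proof -
  have "indep_vars (\<lambda>k. nat_product {Inr k}) (\<lambda>k \<omega>. restrict (\<lambda>x. family xi J x \<omega>) {Inr k}) UNIV"
    by (rule indep_vars_restrict[OF indep]) (auto simp: disjoint_family_on_def)
  then have "indep_vars (\<lambda>_. count_space UNIV) (\<lambda>k \<omega>. (\<lambda>f. f (Inr k)) (restrict (\<lambda>x. family xi J x \<omega>) {Inr k})) UNIV"
    by (rule indep_vars_compose2) (auto intro: measurable_component_singleton)
  then show ?thesis by simp
qed

lemma xi_mean: "(\<integral>\<^sup>+\<omega>. of_nat (xi i k n m \<omega>) \<partial>M) = ennreal mu"
proof -
  have "(\<integral>\<^sup>+\<omega>. of_nat (xi i k n m \<omega>) \<partial>M) = (\<integral>\<^sup>+j. of_nat j \<partial>distr M (count_space UNIV) (xi i k n m))" for i k n m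
    by (subst nn_integral_distr) auto
  then show ?thesis using xi_id[of i k n m] mean by metis
qed

lemma xi_prob_eq: "prob {\<omega>\<in>space M. xi i k n m \<omega> \<in> A} = prob {\<omega>\<in>space M. xi 0 0 0 0 \<omega> \<in> A}"
proof -
  have "prob {\<omega>\<in>space M. xi i k n m \<omega> \<in> A} = measure (distr M (count_space UNIV) (xi i k n m)) A" for i k n m
    by (subst measure_distr) (auto intro!: arg_cong[where f=prob])
  then show ?thesis using xi_id[of i k n m] by simp
qed

text \<open>Whether individual m exists in generation n is decided by earlier generations, hence is
  independent of how many children it has.\<close>

lemma indep_gw_xi:
  "(\<integral>\<^sup>+\<omega>. indicator {m<..} (gw xi i k n \<omega>) * of_nat (xi i k n m \<omega>) \<partial>M)
     = (\<integral>\<^sup>+\<omega>. indicator {m<..} (gw xi i k n \<omega>) \<partial>M) * ennreal mu"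
proof -
  define A :: "gwi_index set" where "A = {Inl (i, k, l, m') | l m'. l < n}"
  define B :: "gwi_index set" where "B = {Inl (i, k, n, m)}"
  let ?f = "\<lambda>x. indicator {m<..} (gw coord i k n x) :: ennreal" and ?g = "\<lambda>x. of_nat (coord i k n m x) :: ennreal"
  have "indep_var (nat_product A) (\<lambda>\<omega>. restrict (\<lambda>x. family xi J x \<omega>) A)
      (nat_product B) (\<lambda>\<omega>. restrict (\<lambda>x. family xi J x \<omega>) B)"
    by (rule indep_var_restrict[OF indep]) (auto simp: A_def B_def)
  then have "indep_var borel (?f \<circ> (\<lambda>\<omega>. restrict (\<lambda>x. family xi J x \<omega>) A)) borel (?g \<circ> (\<lambda>\<omega>. restrict (\<lambda>x. family xi J x \<omega>) B))"
  proof (rule indep_var_compose)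
    have "gw coord i k n \<in> measurable (nat_product A) (count_space UNIV)"
      by (intro measurable_gw measurable_coord) (auto simp: A_def)
    then show "?f \<in> borel_measurable (nat_product A)"
      by (rule measurable_compose) (rule borel_measurable_count_space)
    have "coord i k n m \<in> measurable (nat_product B) (count_space UNIV)"
      by (intro measurable_coord) (auto simp: B_def)
    then show "?g \<in> borel_measurable (nat_product B)"
      by (rule measurable_compose) (rule borel_measurable_count_space)
  qed
  also have "?f \<circ> (\<lambda>\<omega>. restrict (\<lambda>x. family xi J x \<omega>) A) = (\<lambda>\<omega>. indicator {m<..} (gw xi i k n \<omega>))"
  proof
    fix \<omega>
    have "gw coord i k n (restrict (\<lambda>x. family xi J x \<omega>) A) = gw xi i k n \<omega>"
      by (rule gw_cong) (auto simp: coord_def A_def)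
    then show "(?f \<circ> (\<lambda>\<omega>. restrict (\<lambda>x. family xi J x \<omega>) A)) \<omega> = indicator {m<..} (gw xi i k n \<omega>)" by simp
  qed
  also have "?g \<circ> (\<lambda>\<omega>. restrict (\<lambda>x. family xi J x \<omega>) B) = (\<lambda>\<omega>. of_nat (xi i k n m \<omega>))"
    by (auto simp: fun_eq_iff coord_def B_def)
  finally have iv: "indep_var borel (\<lambda>\<omega>. indicator {m<..} (gw xi i k n \<omega>) :: ennreal) borel (\<lambda>\<omega>. of_nat (xi i k n m \<omega>))" .
  then have "indep_vars (\<lambda>_. borel) (case_bool (\<lambda>\<omega>. indicator {m<..} (gw xi i k n \<omega>) :: ennreal) (\<lambda>\<omega>. of_nat (xi i k n m \<omega>))) UNIV"
    unfolding indep_var_def by (rule indep_vars_cong[THEN iffD1, rotated -1]) (auto split: bool.split)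
  from indep_vars_nn_integral[OF _ this] show ?thesis
    by (simp add: UNIV_bool xi_mean mult.commute)
qed

text \<open>The random sum becomes a series over all m of existence indicator times offspring
  number. Integration is termwise by nonnegativity, and the probabilities of having more than m
  individuals add up to the previous mean.\<close>

lemma gw_mean: "(\<integral>\<^sup>+\<omega>. of_nat (gw xi i k n \<omega>) \<partial>M) = ennreal mu ^ n"
proof (induction n)
  case 0
  then show ?case by (simp add: emeasure_space_1)
next
  case (Suc n)
  have as_sum: "(of_nat (\<Sum>m<g. x m) :: ennreal) = (\<Sum>m. indicator {m<..} g * of_nat (x m))" for g :: nat and x :: "nat \<Rightarrow> nat"
  proof -
    have "(\<Sum>m. indicator {m<..} g * of_nat (x m) :: ennreal) = (\<Sum>m<g. indicator {m<..} g * of_nat (x m))"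
      by (rule suminf_finite) auto
    then show ?thesis by (simp add: of_nat_sum)
  qed
  have "(\<integral>\<^sup>+\<omega>. of_nat (gw xi i k (Suc n) \<omega>) \<partial>M)
      = (\<integral>\<^sup>+\<omega>. (\<Sum>m. indicator {m<..} (gw xi i k n \<omega>) * of_nat (xi i k n m \<omega>)) \<partial>M)"
    unfolding gw.simps as_sum ..
  also have "\<dots> = (\<Sum>m. \<integral>\<^sup>+\<omega>. indicator {m<..} (gw xi i k n \<omega>) * of_nat (xi i k n m \<omega>) \<partial>M)"
    by (intro nn_integral_suminf borel_measurable_times_ennreal
        measurable_compose[OF gw_measurable borel_measurable_count_space]
        measurable_compose[OF xi_measurable borel_measurable_count_space])
  also have "\<dots> = (\<Sum>m. (\<integral>\<^sup>+\<omega>. indicator {m<..} (gw xi i k n \<omega>) \<partial>M) * ennreal mu)"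
    by (simp only: indep_gw_xi)
  also have "\<dots> = (\<Sum>m. (\<integral>\<^sup>+\<omega>. indicator {m<..} (gw xi i k n \<omega>) \<partial>M)) * ennreal mu"
    by simp
  also have "(\<Sum>m. (\<integral>\<^sup>+\<omega>. indicator {m<..} (gw xi i k n \<omega>) \<partial>M)) = (\<integral>\<^sup>+\<omega>. (\<Sum>m. indicator {m<..} (gw xi i k n \<omega>)) \<partial>M)"
    by (intro nn_integral_suminf[symmetric] measurable_compose[OF gw_measurable borel_measurable_count_space])
  also have "\<dots> = (\<integral>\<^sup>+\<omega>. of_nat (gw xi i k n \<omega>) \<partial>M)"
    using as_sum[of "\<lambda>_. 1"] by simp
  finally show ?case using Suc by (simp add: mult.commute)
qed

text \<open>Conditioning on the number of immigrants: J_k is independent of all offspring, so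
  splitting the event over its countably many values transfers a bound that is uniform over j in A.
  The splitting also yields measurability.\<close>

lemma prob_random_index_le:
  assumes B: "\<And>j. {x\<in>space (nat_product (range Inl)). Q j x} \<in> sets (nat_product (range Inl))"
    and c: "\<And>j. j \<in> A \<Longrightarrow> prob {\<omega>\<in>space M. Q j (restrict (\<lambda>x. family xi J x \<omega>) (range Inl))} \<le> c" and c0: "0 \<le> c"
  shows "{\<omega>\<in>space M. J k \<omega> \<in> A \<and> Q (J k \<omega>) (restrict (\<lambda>x. family xi J x \<omega>) (range Inl))} \<in> events"
    and "prob {\<omega>\<in>space M. J k \<omega> \<in> A \<and> Q (J k \<omega>) (restrict (\<lambda>x. family xi J x \<omega>) (range Inl))} \<le> c"
proof -
  let ?X = "\<lambda>\<omega>. restrict (\<lambda>x. family xi J x \<omega>) (range Inl)"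
  let ?S = "\<lambda>j. {x\<in>space (nat_product (range Inl)). Q j x}"
  have iv: "indep_var (nat_product {Inr k}) (\<lambda>\<omega>. restrict (\<lambda>x. family xi J x \<omega>) {Inr k}) (nat_product (range Inl)) ?X"
    by (rule indep_var_restrict[OF indep]) auto
  have Xm: "?X \<in> measurable M (nat_product (range Inl))"
    by (intro measurable_restrict family_measurable)
  define E where "E j = {\<omega>\<in>space M. J k \<omega> = j \<and> j \<in> A \<and> Q j (?X \<omega>)}" for j
  have X_space: "?X \<omega> \<in> space (nat_product (range Inl))" for \<omega> by (simp add: space_PiM)
  have Qm: "{\<omega>\<in>space M. Q j (?X \<omega>)} \<in> events" for j
  proof -
    have "{\<omega>\<in>space M. Q j (?X \<omega>)} = ?X -` ?S j \<inter> space M" using X_space by auto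
    then show ?thesis using measurable_sets[OF Xm B[of j]] by simp
  qed
  have Jm: "{\<omega>\<in>space M. J k \<omega> = j} \<in> events" for j by measurable
  have Em: "E j \<in> events" for j
  proof -
    have "E j = (if j \<in> A then {\<omega>\<in>space M. J k \<omega> = j} \<inter> {\<omega>\<in>space M. Q j (?X \<omega>)} else {})" by (auto simp: E_def)
    then show ?thesis using Qm Jm by auto
  qed
  have un: "{\<omega>\<in>space M. J k \<omega> \<in> A \<and> Q (J k \<omega>) (?X \<omega>)} = (\<Union>j. E j)" by (auto simp: E_def)
  then show "{\<omega>\<in>space M. J k \<omega> \<in> A \<and> Q (J k \<omega>) (?X \<omega>)} \<in> events" using Em by auto
  have Eprob: "prob (E j) \<le> c * prob {\<omega>\<in>space M. J k \<omega> = j}" for j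
  proof (cases "j \<in> A")
    case True
    let ?T = "{x\<in>space (nat_product {Inr k}). x (Inr k) = j}"
    have T: "?T \<in> sets (nat_product {Inr k})"
    proof -
      have [measurable]: "(\<lambda>x. x (Inr k)) \<in> measurable (nat_product {Inr k}) (count_space UNIV)"
        by (rule measurable_component_singleton) simp
      show ?thesis by measurable
    qed
    have "prob ((\<lambda>\<omega>. (restrict (\<lambda>x. family xi J x \<omega>) {Inr k}, ?X \<omega>)) -` (?T \<times> ?S j) \<inter> space M)
      = prob ((\<lambda>\<omega>. restrict (\<lambda>x. family xi J x \<omega>) {Inr k}) -` ?T \<inter> space M) * prob (?X -` ?S j \<inter> space M)"
      by (rule indep_varD[OF iv T B])
    moreover have "(\<lambda>\<omega>. (restrict (\<lambda>x. family xi J x \<omega>) {Inr k}, ?X \<omega>)) -` (?T \<times> ?S j) \<inter> space M = E j"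
      using True X_space by (auto simp: E_def space_PiM)
    moreover have "(\<lambda>\<omega>. restrict (\<lambda>x. family xi J x \<omega>) {Inr k}) -` ?T \<inter> space M = {\<omega>\<in>space M. J k \<omega> = j}"
      by (auto simp: space_PiM)
    moreover have "?X -` ?S j \<inter> space M = {\<omega>\<in>space M. Q j (?X \<omega>)}" using X_space by auto
    ultimately have "prob (E j) = prob {\<omega>\<in>space M. J k \<omega> = j} * prob {\<omega>\<in>space M. Q j (?X \<omega>)}" by simp
    also have "\<dots> \<le> prob {\<omega>\<in>space M. J k \<omega> = j} * c" by (intro mult_left_mono c True) simp
    finally show ?thesis by (simp add: mult.commute)
  next
    case False
    then show ?thesis using c0 by (simp add: E_def)
  qed
  have s1: "(\<lambda>j. prob (E j)) sums prob (\<Union>j. E j)"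
    by (rule finite_measure_UNION) (use Em in \<open>auto simp: disjoint_family_on_def E_def\<close>)
  have "(\<lambda>j. prob {\<omega>\<in>space M. J k \<omega> = j}) sums prob (\<Union>j. {\<omega>\<in>space M. J k \<omega> = j})"
    by (rule finite_measure_UNION) (use Jm in \<open>auto simp: disjoint_family_on_def\<close>)
  moreover have "(\<Union>j. {\<omega>\<in>space M. J k \<omega> = j}) = space M" by auto
  ultimately have "(\<lambda>j. prob {\<omega>\<in>space M. J k \<omega> = j}) sums 1" using prob_space by simp
  from sums_mult[OF this, of c] have s2: "(\<lambda>j. c * prob {\<omega>\<in>space M. J k \<omega> = j}) sums c" by simp
  show "prob {\<omega>\<in>space M. J k \<omega> \<in> A \<and> Q (J k \<omega>) (?X \<omega>)} \<le> c"
    unfolding un by (rule sums_le[OF Eprob s1 s2])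
qed

lemma gw_restrict: "gw coord i k n (restrict (\<lambda>x. family xi J x \<omega>) (range Inl)) = gw xi i k n \<omega>"
  by (rule gw_cong) (simp add: coord_def)

text \<open>Markov's inequality for j independent descents: the mean \<open>j * mu ^ l\<close> is
  proportional to j, as is the threshold, so the bound does not depend on j. The maximum with 1
  makes it uniform over ages up to R.\<close>

lemma prob_offspring_large_le:
  assumes "0 \<le> \<theta>" "l \<le> R"
  shows "{\<omega>\<in>space M. real (J k \<omega>) * exp \<theta> < real (\<Sum>i\<in>{1..J k \<omega>}. gw xi i k l \<omega>)} \<in> events"
    and "prob {\<omega>\<in>space M. real (J k \<omega>) * exp \<theta> < real (\<Sum>i\<in>{1..J k \<omega>}. gw xi i k l \<omega>)} \<le> max 1 mu ^ R * exp (- \<theta>)"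
proof -
  define Q where "Q j x \<longleftrightarrow> real j * exp \<theta> < real (\<Sum>i\<in>{1..j}. gw coord i k l x)" for j x
  have m: "{x\<in>space (nat_product (range Inl)). Q j x} \<in> sets (nat_product (range Inl))" for j
  proof -
    have [measurable]: "(\<lambda>x. \<Sum>i\<in>{1..j}. gw coord i k l x) \<in> measurable (nat_product (range Inl)) (count_space UNIV)"
      by (intro measurable_nat_sum measurable_gw measurable_coord) auto
    show ?thesis unfolding Q_def by measurable
  qed
  have bound: "prob {\<omega>\<in>space M. Q j (restrict (\<lambda>x. family xi J x \<omega>) (range Inl))} \<le> max 1 mu ^ R * exp (- \<theta>)" for j
  proof (cases "j = 0")
    case True
    then show ?thesis by (simp add: Q_def)
  next
    case False
    let ?u = "\<lambda>\<omega>. (\<Sum>i\<in>{1..j}. of_nat (gw xi i k l \<omega>)) :: ennreal"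
    let ?c = "ennreal (exp (- \<theta>) / real j)"
    have "emeasure M {\<omega>\<in>space M. Q j (restrict (\<lambda>x. family xi J x \<omega>) (range Inl))} \<le> emeasure M {\<omega>\<in>space M. 1 \<le> ?c * ?u \<omega>}"
    proof (rule emeasure_mono)
      show "{\<omega>\<in>space M. Q j (restrict (\<lambda>x. family xi J x \<omega>) (range Inl))} \<subseteq> {\<omega>\<in>space M. 1 \<le> ?c * ?u \<omega>}"
      proof safe
        fix \<omega> assume "Q j (restrict (\<lambda>x. family xi J x \<omega>) (range Inl))"
        then have "real j * exp \<theta> < real (\<Sum>i\<in>{1..j}. gw xi i k l \<omega>)" by (simp add: Q_def gw_restrict)
        then have "1 \<le> exp (- \<theta>) / real j * real (\<Sum>i\<in>{1..j}. gw xi i k l \<omega>)"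
          using False by (simp add: exp_minus field_simps)
        then have "1 \<le> ennreal (exp (- \<theta>) / real j * real (\<Sum>i\<in>{1..j}. gw xi i k l \<omega>))" by (simp add: ennreal_ge_1)
        also have "\<dots> = ?c * ?u \<omega>"
          by (subst ennreal_mult) (auto simp: ennreal_of_nat_eq_real_of_nat sum_nonneg)
        finally show "1 \<le> ?c * ?u \<omega>" .
      qed
    qed measurable
    also have "\<dots> \<le> ?c * (\<integral>\<^sup>+\<omega>. ?u \<omega> * indicator (space M) \<omega> \<partial>M)"
      by (rule nn_integral_Markov_inequality) measurable
    also have "(\<integral>\<^sup>+\<omega>. ?u \<omega> * indicator (space M) \<omega> \<partial>M) = (\<integral>\<^sup>+\<omega>. ?u \<omega> \<partial>M)"
      by (rule nn_integral_cong) simp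
    also have "\<dots> = (\<Sum>i\<in>{1..j}. ennreal mu ^ l)"
      by (subst nn_integral_sum) (auto simp: gw_mean)
    also have "\<dots> = ennreal (real j * mu ^ l)"
      using mu_pos by (simp add: ennreal_mult ennreal_power ennreal_of_nat_eq_real_of_nat)
    also have "?c * \<dots> = ennreal (exp (- \<theta>) / real j * (real j * mu ^ l))"
      using mu_pos by (intro ennreal_mult[symmetric]) auto
    also have "exp (- \<theta>) / real j * (real j * mu ^ l) = mu ^ l * exp (- \<theta>)" using False by simp
    finally have "prob {\<omega>\<in>space M. Q j (restrict (\<lambda>x. family xi J x \<omega>) (range Inl))} \<le> mu ^ l * exp (- \<theta>)"
      unfolding emeasure_eq_measure by (rule ennreal_le_iff[THEN iffD1, rotated]) (use mu_pos in simp)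
    also have "mu ^ l \<le> max 1 mu ^ l" using mu_pos by (intro power_mono) auto
    also have "max 1 mu ^ l \<le> max 1 mu ^ R" using assms by (intro power_increasing) auto
    finally show ?thesis by simp
  qed
  have eq: "{\<omega>\<in>space M. real (J k \<omega>) * exp \<theta> < real (\<Sum>i\<in>{1..J k \<omega>}. gw xi i k l \<omega>)} =
      {\<omega>\<in>space M. J k \<omega> \<in> UNIV \<and> Q (J k \<omega>) (restrict (\<lambda>x. family xi J x \<omega>) (range Inl))}"
    by (simp only: Q_def gw_restrict UNIV_I simp_thms)
  have c0: "0 \<le> max 1 mu ^ R * exp (- \<theta>)" by simp
  show "{\<omega>\<in>space M. real (J k \<omega>) * exp \<theta> < real (\<Sum>i\<in>{1..J k \<omega>}. gw xi i k l \<omega>)} \<in> events"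
    "prob {\<omega>\<in>space M. real (J k \<omega>) * exp \<theta> < real (\<Sum>i\<in>{1..J k \<omega>}. gw xi i k l \<omega>)} \<le> max 1 mu ^ R * exp (- \<theta>)"
    unfolding eq by (rule prob_random_index_le[where Q=Q, OF m bound c0])+
qed

definition p :: real where "p = prob {\<omega>\<in>space M. xi 0 0 0 0 \<omega> \<ge> 1}"

text \<open>Otherwise the offspring number would vanish almost surely, against the positive
  mean.\<close>

lemma p_pos: "0 < p"
proof (rule ccontr)
  assume "\<not> 0 < p"
  then have "p = 0" unfolding p_def using measure_nonneg[of M "{\<omega>\<in>space M. xi 0 0 0 0 \<omega> \<ge> 1}"] by linarith
  then have "AE \<omega> in M. \<not> xi 0 0 0 0 \<omega> \<ge> 1"
    unfolding p_def by (subst (asm) prob_eq_0) auto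
  then have "(\<integral>\<^sup>+\<omega>. of_nat (xi 0 0 0 0 \<omega>) \<partial>M) = (\<integral>\<^sup>+\<omega>. 0 \<partial>M)"
    by (intro nn_integral_cong_AE) (auto elim!: eventually_mono)
  then show False using mean mu_pos by simp
qed

lemma p_le_1: "p \<le> 1" by (simp add: p_def)

text \<open>The line of first children: it survives \<open>R\<close> generations with probability \<open>p\<^sup>R\<close> and bounds the process from below.\<close>

definition line :: "nat \<Rightarrow> nat \<Rightarrow> nat \<Rightarrow> (gwi_index \<Rightarrow> nat) \<Rightarrow> nat" where
  "line R i k x = (if \<forall>l<R. coord i k l 0 x \<ge> 1 then 1 else 0)"

lemma line_restrict: "line R i k (restrict (\<lambda>x. family xi J x \<omega>) (range Inl)) = (if \<forall>l<R. xi i k l 0 \<omega> \<ge> 1 then 1 else 0)"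
  by (simp add: line_def coord_def)

lemma prob_line: "prob {\<omega>\<in>space M. \<forall>l<R. xi i k l 0 \<omega> \<ge> 1} = p ^ R"
proof (cases "R = 0")
  case True
  then show ?thesis using prob_space by simp
next
  case False
  let ?I = "(\<lambda>l. Inl (i, k, l, 0)) ` {..<R} :: gwi_index set"
  have "prob (\<Inter>x\<in>?I. family xi J x -` {1..} \<inter> space M) = (\<Prod>x\<in>?I. prob (family xi J x -` {1..} \<inter> space M))"
    using False by (intro indep_varsD[OF indep]) auto
  also have "(\<Inter>x\<in>?I. family xi J x -` {1..} \<inter> space M) = {\<omega>\<in>space M. \<forall>l<R. xi i k l 0 \<omega> \<ge> 1}"
    using False by auto
  also have "(\<Prod>x\<in>?I. prob (family xi J x -` {1..} \<inter> space M)) = (\<Prod>l<R. prob (family xi J (Inl (i, k, l, 0)) -` {1..} \<inter> space M))"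
    by (subst prod.reindex) (auto simp: inj_on_def)
  also have "\<dots> = (\<Prod>l<R. p)"
  proof (intro prod.cong refl)
    fix l
    have "family xi J (Inl (i, k, l, 0)) -` {1..} \<inter> space M = {\<omega>\<in>space M. xi i k l 0 \<omega> \<in> {1..}}" by auto
    then show "prob (family xi J (Inl (i, k, l, 0)) -` {1..} \<inter> space M) = p"
      using xi_prob_eq[of i k l 0 "{1..}"] by (simp add: p_def)
  qed
  finally show ?thesis by simp
qed

text \<open>The surviving lines are j independent trials with success probability q =
  \<open>p ^ R\<close>. Hoeffding's inequality for half the mean gives exp(-j q^2 / 2), which is
  weakened to 2 / (j q^2) so that the bound carries the same factor exp(-\<theta>) as the upper
  estimate.\<close>

lemma prob_few_lines_le:
  assumes \<theta>: "exp \<theta> \<le> real j"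
  shows "prob {\<omega>\<in>space M. real (\<Sum>i\<in>{1..j}. line R i k (restrict (\<lambda>x. family xi J x \<omega>) (range Inl))) \<le> real j * p ^ R / 2}
     \<le> 2 / (p ^ R)\<^sup>2 * exp (- \<theta>)"
proof -
  let ?X = "\<lambda>i \<omega>. if \<forall>l<R. xi i k l 0 \<omega> \<ge> 1 then 1 else 0 :: real"
  define q where "q = p ^ R"
  have q: "q > 0" using p_pos by (simp add: q_def)
  have j: "real j > 0" using less_le_trans[OF exp_gt_zero \<theta>] .
  have iv: "indep_vars (\<lambda>_. borel) ?X {1..j}"
  proof -
    define A :: "nat \<Rightarrow> gwi_index set" where "A i = (\<lambda>l. Inl (i, k, l, 0)) ` {..<R}" for i
    have "indep_vars (\<lambda>i. nat_product (A i)) (\<lambda>i \<omega>. restrict (\<lambda>x. family xi J x \<omega>) (A i)) {1..j}"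
      by (rule indep_vars_restrict[OF indep]) (auto simp: disjoint_family_on_def A_def)
    then have "indep_vars (\<lambda>_. borel) (\<lambda>i \<omega>. real (line R i k (restrict (\<lambda>x. family xi J x \<omega>) (A i)))) {1..j}"
    proof (rule indep_vars_compose2)
      fix i
      have "{x \<in> space (nat_product (A i)). \<forall>l\<in>{..<R}. 1 \<le> coord i k l 0 x} \<in> sets (nat_product (A i))"
      proof (rule sets.sets_Collect_finite_All)
        fix l assume "l \<in> {..<R}"
        then have "coord i k l 0 \<in> measurable (nat_product (A i)) (count_space UNIV)"
          by (intro measurable_coord) (auto simp: A_def)
        then show "{x \<in> space (nat_product (A i)). 1 \<le> coord i k l 0 x} \<in> sets (nat_product (A i))"
          by measurable
      qed simp
      moreover have "(\<lambda>x. real (line R i k x)) = (\<lambda>x. if \<forall>l\<in>{..<R}. 1 \<le> coord i k l 0 x then 1 else 0)"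
        by (auto simp: line_def)
      ultimately show "(\<lambda>x. real (line R i k x)) \<in> borel_measurable (nat_product (A i))"
        by (simp only:) (intro measurable_If borel_measurable_const)
    qed
    moreover have "real (line R i k (restrict (\<lambda>x. family xi J x \<omega>) (A i))) = ?X i \<omega>" for i \<omega>
      by (simp add: line_def coord_def A_def)
    ultimately show ?thesis by simp
  qed
  have EX: "expectation (?X i) = q" for i
  proof -
    have "?X i = indicator {\<omega>. \<forall>l<R. xi i k l 0 \<omega> \<ge> 1}" by (auto simp: indicator_def fun_eq_iff)
    then have "expectation (?X i) = prob ({\<omega>. \<forall>l<R. xi i k l 0 \<omega> \<ge> 1} \<inter> space M)" by simp
    also have "{\<omega>. \<forall>l<R. xi i k l 0 \<omega> \<ge> 1} \<inter> space M = {\<omega>\<in>space M. \<forall>l<R. xi i k l 0 \<omega> \<ge> 1}" by auto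
    finally show ?thesis by (simp only: prob_line q_def)
  qed
  interpret H: Hoeffding_ineq M "{1..j}" ?X "\<lambda>_. 0" "\<lambda>_. 1" "real j * q"
  proof unfold_locales
    show "real j * q \<equiv> \<Sum>i\<in>{1..j}. expectation (?X i)" by (simp only: EX) simp
  qed (use iv in simp_all)
  have pos: "0 < (\<Sum>i\<in>{1..j}. (1 - 0 :: real)\<^sup>2)" using j by simp
  have eps: "0 \<le> real j * q / 2" using j q by simp
  have "prob {\<omega>\<in>space M. (\<Sum>i\<in>{1..j}. ?X i \<omega>) \<le> real j * q - real j * q / 2} \<le> exp (-2 * (real j * q / 2)\<^sup>2 / (\<Sum>i\<in>{1..j}. (1 - 0)\<^sup>2))"
    by (rule H.Hoeffding_ineq_le[OF eps pos])
  also have "-2 * (real j * q / 2)\<^sup>2 / (\<Sum>i\<in>{1..j}. (1 - 0)\<^sup>2) = - (real j * q\<^sup>2 / 2)"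
    using j by (simp add: power2_eq_square field_simps)
  also have "exp (- (real j * q\<^sup>2 / 2)) \<le> 1 / (real j * q\<^sup>2 / 2)"
  proof -
    have pos: "0 < real j * q\<^sup>2 / 2" using j q by simp
    have "real j * q\<^sup>2 / 2 \<le> exp (real j * q\<^sup>2 / 2)" using exp_ge_add_one_self[of "real j * q\<^sup>2 / 2"] by linarith
    from le_imp_inverse_le[OF this pos] show ?thesis by (simp only: exp_minus inverse_eq_divide)
  qed
  also have "\<dots> = 2 / q\<^sup>2 * (1 / real j)" by (simp add: field_simps)
  also have "\<dots> \<le> 2 / q\<^sup>2 * exp (- \<theta>)"
    using \<theta> j by (intro mult_left_mono) (auto simp: exp_minus inverse_eq_divide intro!: divide_left_mono)
  finally have "prob {\<omega>\<in>space M. (\<Sum>i\<in>{1..j}. ?X i \<omega>) \<le> real j * q / 2} \<le> 2 / q\<^sup>2 * exp (- \<theta>)"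
    by (simp only: diff_divide_distrib field_sum_of_halves[THEN eq_diff_eq[THEN iffD2], symmetric])
  moreover have "real (\<Sum>i\<in>{1..j}. line R i k (restrict (\<lambda>x. family xi J x \<omega>) (range Inl))) = (\<Sum>i\<in>{1..j}. ?X i \<omega>)" for \<omega>
    unfolding line_restrict of_nat_sum by (intro sum.cong) auto
  ultimately show ?thesis by (simp add: q_def)
qed

lemma prob_offspring_small_le:
  fixes R k :: nat and \<theta> :: real
  defines "E \<equiv> {\<omega>\<in>space M. exp \<theta> \<le> real (J k \<omega>) \<and>
      real (\<Sum>i\<in>{1..J k \<omega>}. if \<forall>l<R. xi i k l 0 \<omega> \<ge> 1 then 1 else 0) \<le> real (J k \<omega>) * p ^ R / 2}"
  shows "E \<in> events" "prob E \<le> 2 / (p ^ R)\<^sup>2 * exp (- \<theta>)"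
proof -
  define Q where "Q j x \<longleftrightarrow> real (\<Sum>i\<in>{1..j}. line R i k x) \<le> real j * p ^ R / 2" for j x
  have m: "{x\<in>space (nat_product (range Inl)). Q j x} \<in> sets (nat_product (range Inl))" for j
  proof -
    have "line R i k \<in> measurable (nat_product (range Inl)) (count_space UNIV)" for i
    proof -
      have [measurable]: "coord i k l 0 \<in> measurable (nat_product (range Inl)) (count_space UNIV)" for l
        by (intro measurable_coord) auto
      show ?thesis unfolding line_def by measurable
    qed
    then have [measurable]: "(\<lambda>x. \<Sum>i\<in>{1..j}. line R i k x) \<in> measurable (nat_product (range Inl)) (count_space UNIV)"
      by (intro measurable_nat_sum) auto
    show ?thesis unfolding Q_def by measurable
  qed
  have bound: "prob {\<omega>\<in>space M. Q j (restrict (\<lambda>x. family xi J x \<omega>) (range Inl))} \<le> 2 / (p ^ R)\<^sup>2 * exp (- \<theta>)"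
    if "j \<in> {j. exp \<theta> \<le> real j}" for j
    unfolding Q_def using that by (intro prob_few_lines_le) auto
  have c0: "0 \<le> 2 / (p ^ R)\<^sup>2 * exp (- \<theta>)" by simp
  have eq: "E = {\<omega>\<in>space M. J k \<omega> \<in> {j. exp \<theta> \<le> real j} \<and> Q (J k \<omega>) (restrict (\<lambda>x. family xi J x \<omega>) (range Inl))}"
    by (simp add: E_def Q_def line_restrict)
  show "E \<in> events" "prob E \<le> 2 / (p ^ R)\<^sup>2 * exp (- \<theta>)"
    unfolding eq by (rule prob_random_index_le[where Q=Q, OF m bound c0]; assumption)+
qed

text \<open>E collects all waves that are too large at some age and all large waves with too few
  surviving lines; off E both comparisons are deterministic. The quantifier over x replaces the
  maximum of the immigration heights.\<close>

lemma approximation_event: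
  assumes \<theta>: "0 \<le> \<theta>"
  shows "\<exists>E\<in>events. prob E \<le> (real (Suc R))\<^sup>2 * (max 1 mu ^ R * exp (- \<theta>)) + real (Suc R) * (2 / (p ^ R)\<^sup>2 * exp (- \<theta>)) \<and>
     (\<forall>\<omega>\<in>space M - E. \<forall>m\<le>R.
        (\<forall>x\<ge>0. (\<forall>k\<le>m. log_plus (real (J k \<omega>)) \<le> x) \<longrightarrow> log_plus (real (gwi xi J m \<omega>)) \<le> x + \<theta> + ln (real (Suc R))) \<and>
        (\<forall>k\<le>m. log_plus (real (J k \<omega>)) \<le> log_plus (real (gwi xi J m \<omega>)) + (\<theta> + real R * ln (1 / p) + ln 2)))"
proof -
  define U where "U k l = {\<omega>\<in>space M. real (J k \<omega>) * exp \<theta> < real (\<Sum>i\<in>{1..J k \<omega>}. gw xi i k l \<omega>)}" for k l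
  define V where "V k = {\<omega>\<in>space M. exp \<theta> \<le> real (J k \<omega>) \<and>
      real (\<Sum>i\<in>{1..J k \<omega>}. if \<forall>l<R. xi i k l 0 \<omega> \<ge> 1 then 1 else 0) \<le> real (J k \<omega>) * p ^ R / 2}" for k
  have U: "U k l \<in> events" "prob (U k l) \<le> max 1 mu ^ R * exp (- \<theta>)" if "l \<le> R" for k l
    unfolding U_def using prob_offspring_large_le[OF \<theta> that] by auto
  have V: "V k \<in> events" "prob (V k) \<le> 2 / (p ^ R)\<^sup>2 * exp (- \<theta>)" for k
    unfolding V_def by (rule prob_offspring_small_le)+
  define E where "E = (\<Union>(k, l)\<in>{..R} \<times> {..R}. U k l) \<union> (\<Union>k\<in>{..R}. V k)"
  have E: "E \<in> events" unfolding E_def using U V by (intro sets.Un sets.finite_UN) auto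
  have "prob E \<le> prob (\<Union>(k, l)\<in>{..R} \<times> {..R}. U k l) + prob (\<Union>k\<in>{..R}. V k)"
    unfolding E_def using U V by (intro measure_Un_le sets.finite_UN) auto
  also have "\<dots> \<le> (\<Sum>(k, l)\<in>{..R} \<times> {..R}. prob (U k l)) + (\<Sum>k\<in>{..R}. prob (V k))"
  proof (intro add_mono)
    have "prob (\<Union>q\<in>{..R} \<times> {..R}. case q of (k, l) \<Rightarrow> U k l) \<le> (\<Sum>q\<in>{..R} \<times> {..R}. prob (case q of (k, l) \<Rightarrow> U k l))"
      using U by (intro finite_measure_subadditive_finite) auto
    then show "prob (\<Union>(k, l)\<in>{..R} \<times> {..R}. U k l) \<le> (\<Sum>(k, l)\<in>{..R} \<times> {..R}. prob (U k l))"
      by (simp add: case_prod_beta)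
    show "prob (\<Union>k\<in>{..R}. V k) \<le> (\<Sum>k\<in>{..R}. prob (V k))"
      using V by (intro finite_measure_subadditive_finite) auto
  qed
  also have "\<dots> \<le> (\<Sum>(k, l)\<in>{..R} \<times> {..R}. max 1 mu ^ R * exp (- \<theta>)) + (\<Sum>k\<in>{..R}. 2 / (p ^ R)\<^sup>2 * exp (- \<theta>))"
    using U V by (intro add_mono sum_mono) auto
  also have "\<dots> = (real (Suc R))\<^sup>2 * (max 1 mu ^ R * exp (- \<theta>)) + real (Suc R) * (2 / (p ^ R)\<^sup>2 * exp (- \<theta>))"
    by (simp add: power2_eq_square card_cartesian_product algebra_simps)
  finally have PE: "prob E \<le> \<dots>" .
  show ?thesis
  proof (intro bexI[of _ E] conjI PE E ballI allI impI)
    fix \<omega> m assume w: "\<omega> \<in> space M - E" and m: "m \<le> R"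
    have notU: "real (\<Sum>i\<in>{1..J k \<omega>}. gw xi i k l \<omega>) \<le> real (J k \<omega>) * exp \<theta>" if "k \<le> R" "l \<le> R" for k l
      using w that by (force simp: E_def U_def not_less)
    have notV: "real (J k \<omega>) * p ^ R / 2 < real (\<Sum>i\<in>{1..J k \<omega>}. if \<forall>l<R. xi i k l 0 \<omega> \<ge> 1 then 1 else 0)"
      if "k \<le> R" "exp \<theta> \<le> real (J k \<omega>)" for k
    proof -
      have "\<omega> \<notin> V k" using w that by (auto simp: E_def)
      then show ?thesis using w that by (auto simp: V_def not_le)
    qed
    show "log_plus (real (gwi xi J m \<omega>)) \<le> x + \<theta> + ln (real (Suc R))"
      if x: "0 \<le> x" and Jx: "\<forall>k\<le>m. log_plus (real (J k \<omega>)) \<le> x" for x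
    proof -
      have Jle: "real (J k \<omega>) \<le> exp x" if "k \<le> m" for k
      proof (cases "real (J k \<omega>) \<le> 1")
        case True
        then show ?thesis using x by (meson one_le_exp_iff order_trans)
      next
        case False
        then have "ln (real (J k \<omega>)) \<le> x" using Jx that by (force simp: log_plus_def)
        then have "exp (ln (real (J k \<omega>))) \<le> exp x" by simp
        then show ?thesis using False by simp
      qed
      \<comment> \<open>At most R + 1 waves are alive, each of size at most exp(x + \<theta>); their
        number produces the term \<open>ln (real (Suc R))\<close>.\<close>
      have "real (gwi xi J m \<omega>) = (\<Sum>k\<le>m. real (\<Sum>i\<in>{1..J k \<omega>}. gw xi i k (m - k) \<omega>))"
        by (simp add: gwi_def)
      also have "\<dots> \<le> (\<Sum>k\<le>m. exp x * exp \<theta>)"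
      proof (rule sum_mono)
        fix k assume k: "k \<in> {..m}"
        have "real (\<Sum>i\<in>{1..J k \<omega>}. gw xi i k (m - k) \<omega>) \<le> real (J k \<omega>) * exp \<theta>" using k m by (intro notU) auto
        also have "\<dots> \<le> exp x * exp \<theta>" using Jle k by (intro mult_right_mono) auto
        finally show "real (\<Sum>i\<in>{1..J k \<omega>}. gw xi i k (m - k) \<omega>) \<le> exp x * exp \<theta>" .
      qed
      also have "\<dots> = real (Suc m) * (exp x * exp \<theta>)" by simp
      also have "\<dots> \<le> real (Suc R) * (exp x * exp \<theta>)" using m by (intro mult_right_mono) auto
      finally have le: "real (gwi xi J m \<omega>) \<le> real (Suc R) * (exp x * exp \<theta>)" .
      show ?thesis
      proof (cases "real (gwi xi J m \<omega>) \<le> 1")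
        case True
        then show ?thesis using x \<theta> by (simp add: log_plus_def)
      next
        case False
        then have "ln (real (gwi xi J m \<omega>)) \<le> ln (real (Suc R) * (exp x * exp \<theta>))" using le by (subst ln_le_cancel_iff) auto
        also have "\<dots> = ln (real (Suc R)) + x + \<theta>" by (simp add: ln_mult flip: exp_add)
        finally show ?thesis using False by (simp add: log_plus_def)
      qed
    qed
    show "log_plus (real (J k \<omega>)) \<le> log_plus (real (gwi xi J m \<omega>)) + (\<theta> + real R * ln (1 / p) + ln 2)" if k: "k \<le> m" for k
    \<comment> \<open>A wave below \<open>exp \<theta>\<close> has logarithm at most \<theta>,
      whatever its descendants do. A larger one keeps more than half the expected number of
      surviving lines, and each line has a member in every generation considered; taking logarithms
      costs \<open>real R * ln (1 / p) + ln 2\<close>.\<close>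
    proof (cases "exp \<theta> \<le> real (J k \<omega>)")
      case False
      have "ln (real (J k \<omega>)) \<le> \<theta>" if "1 < real (J k \<omega>)"
      proof -
        have "ln (real (J k \<omega>)) < ln (exp \<theta>)" using False that by (subst ln_less_cancel_iff) auto
        then show ?thesis by simp
      qed
      then have "log_plus (real (J k \<omega>)) \<le> \<theta>" using \<theta> by (simp add: log_plus_def)
      moreover have "0 \<le> real R * ln (1 / p)" using p_pos p_le_1 by simp
      ultimately show ?thesis using log_plus_nonneg[of "real (gwi xi J m \<omega>)"] ln_gt_zero[of 2] by linarith
    next
      case True
      have J1: "real (J k \<omega>) \<ge> 1" using True \<theta> by (meson one_le_exp_iff order_trans)
      have "real (\<Sum>i\<in>{1..J k \<omega>}. if \<forall>l<R. xi i k l 0 \<omega> \<ge> 1 then 1 else 0) \<le> real (\<Sum>i\<in>{1..J k \<omega>}. gw xi i k (m - k) \<omega>)"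
        unfolding of_nat_le_iff
      proof (rule sum_mono)
        fix i
        show "(if \<forall>l<R. xi i k l 0 \<omega> \<ge> 1 then 1 else 0) \<le> gw xi i k (m - k) \<omega>"
          using gw_pos[of "m - k" xi i k \<omega>] m by auto
      qed
      also have "\<dots> \<le> real (gwi xi J m \<omega>)"
        unfolding gwi_def of_nat_le_iff
        using k by (intro member_le_sum[of k "{..m}" "\<lambda>k. \<Sum>i\<in>{1..J k \<omega>}. gw xi i k (m - k) \<omega>"]) auto
      finally have less: "real (J k \<omega>) * p ^ R / 2 < real (gwi xi J m \<omega>)" using notV[of k] True k m by simp
      have pos: "0 < real (J k \<omega>) * p ^ R / 2" using J1 p_pos by simp
      have "ln (real (J k \<omega>) * p ^ R / 2) \<le> ln (real (gwi xi J m \<omega>))"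
        using less pos by (subst ln_le_cancel_iff) auto
      moreover have "ln (real (J k \<omega>) * p ^ R / 2) = ln (real (J k \<omega>)) + real R * ln p - ln 2"
        using J1 p_pos by (simp add: ln_div ln_mult ln_realpow)
      moreover have "ln (real (gwi xi J m \<omega>)) = log_plus (real (gwi xi J m \<omega>))"
        using less pos by (cases "gwi xi J m \<omega> = 1") (auto simp: log_plus_def)
      moreover have "log_plus (real (J k \<omega>)) = ln (real (J k \<omega>))" using J1 by (auto simp: log_plus_def)
      moreover have "ln (1 / p) = - ln p" using p_pos by (simp add: ln_div)
      ultimately show ?thesis using \<theta> by simp
    qed
  qed
qed

end

section \<open>Rescaled paths and their distance to the running maximum\<close>

lemma cadlag_step:
  fixes g :: "nat \<Rightarrow> real"
  shows "cadlag (\<lambda>t. g (nat \<lfloor>real n * t\<rfloor>))"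
proof (cases "n = 0")
  case True
  then show ?thesis by (auto simp: cadlag_def)
next
  case False
  then have n: "real n > 0" by simp
  have right: "((\<lambda>s. g (nat \<lfloor>real n * s\<rfloor>)) \<longlongrightarrow> g (nat \<lfloor>real n * t\<rfloor>)) (at_right t)" for t
  proof (rule tendsto_eventually, rule eventually_at_rightI)
    show "t < (of_int \<lfloor>real n * t\<rfloor> + 1) / real n" using n by (simp add: pos_less_divide_eq mult.commute)
    fix s assume s: "s \<in> {t<..<(of_int \<lfloor>real n * t\<rfloor> + 1) / real n}"
    then have "real n * s < of_int \<lfloor>real n * t\<rfloor> + 1" using n by (simp add: pos_less_divide_eq mult.commute)
    moreover have "real n * t < real n * s" using s n by simp
    ultimately have "\<lfloor>real n * s\<rfloor> = \<lfloor>real n * t\<rfloor>" by linarith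
    then show "g (nat \<lfloor>real n * s\<rfloor>) = g (nat \<lfloor>real n * t\<rfloor>)" by simp
  qed
  have left: "((\<lambda>s. g (nat \<lfloor>real n * s\<rfloor>)) \<longlongrightarrow> g (nat (\<lceil>real n * t\<rceil> - 1))) (at_left t)" for t
  proof (rule tendsto_eventually, rule eventually_at_leftI)
    show "(of_int \<lceil>real n * t\<rceil> - 1) / real n < t" using n by (simp add: pos_divide_less_eq mult.commute) linarith
    fix s assume s: "s \<in> {(of_int \<lceil>real n * t\<rceil> - 1) / real n<..<t}"
    then have "of_int \<lceil>real n * t\<rceil> - 1 < real n * s" using n by (simp add: pos_divide_less_eq mult.commute)
    moreover have "real n * s < real n * t" using s n by simp
    ultimately have "\<lfloor>real n * s\<rfloor> = \<lceil>real n * t\<rceil> - 1" by linarith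
    then show "g (nat \<lfloor>real n * s\<rfloor>) = g (nat (\<lceil>real n * t\<rceil> - 1))" by simp
  qed
  show ?thesis unfolding cadlag_def continuous_within using right left by blast
qed

lemma sup_path_immigration_close:
  assumes n: "n \<ge> 1" and t: "t \<ge> 0" and b: "b n > 0" and y: "0 \<le> y" and e: "0 \<le> e"
    and up: "\<And>x. 0 \<le> x \<Longrightarrow> (\<And>k. k \<le> nat \<lfloor>real n * t\<rfloor> \<Longrightarrow> log_plus (real (J k \<omega>)) \<le> x) \<Longrightarrow> y \<le> x + e"
    and low: "\<And>k. k \<le> nat \<lfloor>real n * t\<rfloor> \<Longrightarrow> log_plus (real (J k \<omega>)) \<le> y + e"
  shows "\<bar>y / b n - sup_path (immigration_points J b n \<omega>) t\<bar> \<le> e / b n"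
proof -
  define m where "m = nat \<lfloor>real n * t\<rfloor>"
  define a where "a k = log_plus (real (J k \<omega>))" for k
  define S where "S = (SUP k\<in>{..m}. ennreal (a k / b n))"
  define s where "s = enn2real S"
  have "real k / real n \<le> t \<longleftrightarrow> k \<le> m" for k
  proof -
    have "real k / real n \<le> t \<longleftrightarrow> real k \<le> real n * t" using n by (simp add: pos_divide_le_eq mult.commute)
    also have "\<dots> \<longleftrightarrow> k \<le> m" unfolding m_def using t by (simp add: le_nat_iff le_floor_iff)
    finally show ?thesis .
  qed
  then have path: "sup_path (immigration_points J b n \<omega>) t = s"
    by (simp add: sup_path_def immigration_points_def s_def S_def a_def atMost_def)
  have S_le: "S \<le> ennreal ((y + e) / b n)"
    unfolding S_def using low b by (intro SUP_least ennreal_leI divide_right_mono) (auto simp: a_def m_def)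
  then have "s \<le> (y + e) / b n" unfolding s_def using y e b by (intro enn2real_leI) auto
  moreover have "y \<le> s * b n + e"
  proof (rule up)
    show "0 \<le> s * b n" using b by (simp add: s_def)
    fix k assume "k \<le> nat \<lfloor>real n * t\<rfloor>"
    then have "ennreal (a k / b n) \<le> S" unfolding S_def by (intro SUP_upper) (simp add: m_def)
    then have "enn2real (ennreal (a k / b n)) \<le> s"
      unfolding s_def using S_le by (intro enn2real_mono) (auto intro: le_less_trans)
    then show "log_plus (real (J k \<omega>)) \<le> s * b n"
      using b log_plus_nonneg[of "real (J k \<omega>)"] by (simp add: a_def pos_divide_le_eq)
  qed
  then have "y / b n \<le> s + e / b n" using b by (simp add: field_simps)
  ultimately show ?thesis unfolding path by (simp add: add_divide_distrib)
qed

context gwi_process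
begin

lemma gwi_measurable: "gwi xi J m \<in> measurable M (count_space UNIV)"
proof -
  have "(\<lambda>\<omega>. \<Sum>i\<in>{1..J k \<omega>}. gw xi i k (m - k) \<omega>) \<in> measurable M (count_space UNIV)" for k
    by (rule measurable_compose_countable[where f="\<lambda>c \<omega>. \<Sum>i\<in>{1..c}. gw xi i k (m - k) \<omega>"])
       (auto intro!: measurable_nat_sum)
  then show ?thesis unfolding gwi_def[abs_def] by (intro measurable_nat_sum)
qed

lemma eventually_close_to_maximum:
  assumes b: "filterlim (\<lambda>n. b n / real n) at_top sequentially" and K: "K > 0"
  shows "\<forall>\<^sub>F n in sequentially. \<exists>E\<in>events. prob E \<le> 1 / real K \<and>
     (\<forall>\<omega>\<in>space M - E. \<forall>t\<in>{0..real K}.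
        \<bar>log_plus (real (gwi xi J (nat \<lfloor>real n * t\<rfloor>) \<omega>)) / b n - sup_path (immigration_points J b n \<omega>) t\<bar> \<le> 1 / real K)"
proof -
  \<comment> \<open>An exponential rate per generation covering both error probabilities: (R + 1)^2
    is at most exp(2R) and meets \<open>max 1 mu ^ R\<close>, while R + 1 is at most exp(R) and
    meets p^(-2R). It also dominates the correction ln(1/p).\<close>
  define c where "c = max (2 + ln (max 1 mu)) (1 + 2 * ln (1 / p))"
  have lnp: "0 \<le> ln (1 / p)" using p_pos p_le_1 by simp
  have c: "2 + ln (max 1 mu) \<le> c" "1 + 2 * ln (1 / p) \<le> c" "1 \<le> c" "ln (1 / p) \<le> c"
    using lnp by (auto simp: c_def)
  have "\<forall>\<^sub>F n in sequentially. 2 * real K * (c * real K + 1) \<le> b n / real n"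
    using b unfolding filterlim_at_top by blast
  moreover have "(\<lambda>n. 3 * exp (- real n)) \<longlonglongrightarrow> 3 * 0"
    by (intro tendsto_mult tendsto_const filterlim_compose[OF exp_at_bot] filterlim_compose[OF filterlim_uminus_at_bot_at_top] filterlim_real_sequentially)
  then have "\<forall>\<^sub>F n in sequentially. 3 * exp (- real n) < 1 / real K"
    using K by (intro order_tendstoD(2)[where y="3 * 0"]) auto
  ultimately show ?thesis using eventually_ge_at_top[of 1]
  proof eventually_elim
    case (elim n)
    \<comment> \<open>R is the last generation before time K, and \<theta> is half of the permitted
      error b_n / K.\<close>
    define R where "R = n * K"
    define \<theta> where "\<theta> = b n / (2 * real K)"
    have n: "real n > 0" using elim by simp
    have cK: "0 \<le> c * real K" using c by simp
    have "2 * real K * (c * real K + 1) * real n \<le> b n" using elim n by (simp add: pos_le_divide_eq)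
    \<comment> \<open>This is cR + n: the term cR pays for the exponential costs, and the remaining
      n brings the failure probability down to 3 exp(-n), with 3 = 1 + 2 from the two kinds of
      failure.\<close>
    then have \<theta>_ge: "real n * (c * real K + 1) \<le> \<theta>" unfolding \<theta>_def using K by (simp add: field_simps)
    have cR: "real n * (c * real K + 1) = c * real R + real n" by (simp add: R_def algebra_simps)
    have cR0: "0 \<le> c * real R" using c by simp
    have \<theta>0: "0 \<le> \<theta>" using \<theta>_ge cR cR0 n by linarith
    have bn: "b n = 2 * real K * \<theta>" using K by (simp add: \<theta>_def)
    have \<theta>pos: "0 < \<theta>" using \<theta>_ge cR cR0 n by linarith
    then have b0: "0 < b n" using K by (simp add: bn)
    have SucR: "real (Suc R) \<le> exp (real R)" using exp_ge_add_one_self[of "real R"] by simp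
    obtain E where E: "E \<in> events"
      and PE: "prob E \<le> (real (Suc R))\<^sup>2 * (max 1 mu ^ R * exp (- \<theta>)) + real (Suc R) * (2 / (p ^ R)\<^sup>2 * exp (- \<theta>))"
      and good: "\<forall>\<omega>\<in>space M - E. \<forall>m\<le>R.
        (\<forall>x\<ge>0. (\<forall>k\<le>m. log_plus (real (J k \<omega>)) \<le> x) \<longrightarrow> log_plus (real (gwi xi J m \<omega>)) \<le> x + \<theta> + ln (real (Suc R))) \<and>
        (\<forall>k\<le>m. log_plus (real (J k \<omega>)) \<le> log_plus (real (gwi xi J m \<omega>)) + (\<theta> + real R * ln (1 / p) + ln 2))"
      using approximation_event[OF \<theta>0, of R] by (elim bexE conjE) (rule that)
    have up: "log_plus (real (gwi xi J m \<omega>)) \<le> x + \<theta> + ln (real (Suc R))"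
      if "\<omega> \<in> space M - E" "m \<le> R" "0 \<le> x" "\<And>k. k \<le> m \<Longrightarrow> log_plus (real (J k \<omega>)) \<le> x" for \<omega> m x
      using conjunct1[OF good[THEN bspec, OF that(1), THEN spec, THEN mp, OF that(2)], THEN spec, THEN mp, OF that(3)] that(4)
      by simp
    have low: "log_plus (real (J k \<omega>)) \<le> log_plus (real (gwi xi J m \<omega>)) + (\<theta> + real R * ln (1 / p) + ln 2)"
      if "\<omega> \<in> space M - E" "m \<le> R" "k \<le> m" for \<omega> m k
      by (rule conjunct2[OF good[THEN bspec, OF that(1), THEN spec, THEN mp, OF that(2)], THEN spec, THEN mp, OF that(3)])
    have pow1: "max 1 mu ^ R = exp (real R * ln (max 1 mu))" by (simp add: exp_of_nat_mult)
    have pow2: "2 / (p ^ R)\<^sup>2 = 2 * exp (real R * (2 * ln (1 / p)))"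
    proof -
      have "exp (real R * (2 * ln (1 / p))) = (exp (ln (1 / p)) ^ 2) ^ R"
        by (simp only: exp_of_nat_mult exp_of_nat_mult[of 2, simplified])
      also have "exp (ln (1 / p)) = 1 / p" using p_pos by (intro exp_ln) simp
      also have "((1 / p) ^ 2) ^ R = 1 / (p ^ R)\<^sup>2" by (simp add: power_divide mult.commute flip: power_mult)
      finally show ?thesis by simp
    qed
    have "(real (Suc R))\<^sup>2 * (max 1 mu ^ R * exp (- \<theta>)) \<le> (exp (real R))\<^sup>2 * (max 1 mu ^ R * exp (- \<theta>))"
      using SucR by (intro mult_right_mono power_mono) auto
    also have "\<dots> = exp (real R * (2 + ln (max 1 mu)) - \<theta>)"
      unfolding pow1 by (simp add: power2_eq_square algebra_simps flip: exp_add)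
    also have "\<dots> \<le> exp (real R * c - \<theta>)" using c by (simp add: mult_left_mono)
    finally have 1: "(real (Suc R))\<^sup>2 * (max 1 mu ^ R * exp (- \<theta>)) \<le> exp (real R * c - \<theta>)" .
    have "real (Suc R) * (2 / (p ^ R)\<^sup>2 * exp (- \<theta>)) \<le> exp (real R) * (2 / (p ^ R)\<^sup>2 * exp (- \<theta>))"
      using SucR by (intro mult_right_mono) auto
    also have "\<dots> = 2 * exp (real R * (1 + 2 * ln (1 / p)) - \<theta>)"
      unfolding pow2 by (simp add: algebra_simps flip: exp_add)
    also have "\<dots> \<le> 2 * exp (real R * c - \<theta>)" using c by (simp add: mult_left_mono)
    finally have 2: "real (Suc R) * (2 / (p ^ R)\<^sup>2 * exp (- \<theta>)) \<le> 2 * exp (real R * c - \<theta>)" .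
    have "exp (real R * c - \<theta>) \<le> exp (- real n)" using \<theta>_ge cR by (simp add: mult.commute)
    then have PE': "prob E \<le> 1 / real K" using PE 1 2 elim by linarith
    have RcR: "real R \<le> c * real R" using mult_right_mono[OF c(3), of "real R"] by simp
    have lnR: "ln (real (Suc R)) \<le> \<theta>"
    proof -
      have "ln (real (Suc R)) \<le> real R" using ln_le_minus_one[of "real (Suc R)"] by simp
      then show ?thesis using \<theta>_ge cR RcR n by linarith
    qed
    \<comment> \<open>The other half of the error budget: as with \<open>lnR\<close>, the correction
      is at most \<theta>, so the total error is 2\<theta> = b_n / K.\<close>
    have lnp': "real R * ln (1 / p) + ln 2 \<le> \<theta>"
    proof -
      have "real R * ln (1 / p) \<le> real R * c" using c by (intro mult_left_mono) auto
      moreover have "ln 2 \<le> (1 :: real)" using ln_le_minus_one[of 2] by simp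
      moreover have "1 \<le> real n" using elim by simp
      ultimately show ?thesis using \<theta>_ge cR by (simp add: mult.commute)
    qed
    show ?case
    proof (intro bexI[of _ E] conjI PE' E ballI)
      fix \<omega> t assume w: "\<omega> \<in> space M - E" and t: "t \<in> {0..real K}"
      have mR: "nat \<lfloor>real n * t\<rfloor> \<le> R"
      proof -
        have "real n * t \<le> real n * real K" using t n by (intro mult_left_mono) auto
        then have "\<lfloor>real n * t\<rfloor> \<le> \<lfloor>real n * real K\<rfloor>" by (rule floor_mono)
        also have "\<lfloor>real n * real K\<rfloor> = int R" by (simp add: R_def flip: of_nat_mult)
        finally show ?thesis by simp
      qed
      have "\<bar>log_plus (real (gwi xi J (nat \<lfloor>real n * t\<rfloor>) \<omega>)) / b n - sup_path (immigration_points J b n \<omega>) t\<bar> \<le> 2 * \<theta> / b n"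
      proof (rule sup_path_immigration_close)
        show "log_plus (real (gwi xi J (nat \<lfloor>real n * t\<rfloor>) \<omega>)) \<le> x + 2 * \<theta>"
          if "0 \<le> x" "\<And>k. k \<le> nat \<lfloor>real n * t\<rfloor> \<Longrightarrow> log_plus (real (J k \<omega>)) \<le> x" for x
          using up[OF w mR that] lnR by linarith
        show "log_plus (real (J k \<omega>)) \<le> log_plus (real (gwi xi J (nat \<lfloor>real n * t\<rfloor>) \<omega>)) + 2 * \<theta>"
          if "k \<le> nat \<lfloor>real n * t\<rfloor>" for k
          using low[OF w mR that] lnp' by linarith
      qed (use elim t b0 \<theta>0 log_plus_nonneg in auto)
      also have "2 * \<theta> / b n = 1 / real K" using \<theta>pos by (simp add: bn)
      finally show "\<bar>log_plus (real (gwi xi J (nat \<lfloor>real n * t\<rfloor>) \<omega>)) / b n - sup_path (immigration_points J b n \<omega>) t\<bar> \<le> 1 / real K" .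
    qed
  qed
qed

end

text \<open>The left side is the mean number of limiting points up to time K above the cap, which
  tends to 0 as the cap grows.\<close>

lemma ex_height_cap:
  assumes "\<alpha> > 0" "K > 0"
  shows "\<exists>r. real K * (real (Suc r) / real K) powr (- \<alpha>) \<le> 1 / real K"
proof -
  have "filterlim (\<lambda>r. real (Suc r) / real K) at_top sequentially"
    unfolding divide_inverse mult.commute[of _ "inverse (real K)"] using assms
    by (intro filterlim_tendsto_pos_mult_at_top[OF tendsto_const] filterlim_compose[OF filterlim_real_sequentially filterlim_Suc]) auto
  then have "(\<lambda>r. (real (Suc r) / real K) powr (- \<alpha>)) \<longlonglongrightarrow> 0"
    using assms by (intro tendsto_neg_powr) auto
  then have "(\<lambda>r. real K * (real (Suc r) / real K) powr (- \<alpha>)) \<longlonglongrightarrow> real K * 0"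
    by (intro tendsto_mult tendsto_const)
  then have "\<forall>\<^sub>F r in sequentially. real K * (real (Suc r) / real K) powr (- \<alpha>) < 1 / real K"
    using assms by (intro order_tendstoD(2)[where y="real K * 0"]) auto
  then show ?thesis unfolding eventually_sequentially by (meson less_imp_le order_refl)
qed

theorem theorem2:
  fixes M :: "'a measure" and xi :: "nat \<Rightarrow> nat \<Rightarrow> nat \<Rightarrow> nat \<Rightarrow> 'a \<Rightarrow> nat"
    and J :: "nat \<Rightarrow> 'a \<Rightarrow> nat" and mu \<alpha> :: real and L :: "real \<Rightarrow> real" and b :: "nat \<Rightarrow> real"
    and N :: "'b measure" and tt :: "nat \<Rightarrow> 'b \<Rightarrow> real" and jj :: "nat \<Rightarrow> 'b \<Rightarrow> ennreal"
  assumes M: "prob_space M"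
    and indep: "prob_space.indep_vars M (\<lambda>_. count_space UNIV)
        (\<lambda>x \<omega>. case x of Inl (i, k, n, m) \<Rightarrow> xi i k n m \<omega> | Inr k \<Rightarrow> J k \<omega>) UNIV"
    and xi_iid: "\<forall>i k n m. distr M (count_space UNIV) (xi i k n m) = distr M (count_space UNIV) (xi 0 0 0 0)"
    and J_iid: "\<forall>k. distr M (count_space UNIV) (J k) = distr M (count_space UNIV) (J 0)"
    and J_nontriv: "measure M {\<omega>\<in>space M. J 0 \<omega> = 0} < 1"
    and mean_int: "integrable M (\<lambda>\<omega>. real (xi 0 0 0 0 \<omega>))"
    and mean: "(\<integral>\<omega>. real (xi 0 0 0 0 \<omega>) \<partial>M) = mu" and mu_pos: "0 < mu"
    and alpha: "0 < \<alpha>" "\<alpha> \<le> 1"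
    and sv: "slowly_varying L"
    and tail: "(\<lambda>x. measure M {\<omega>\<in>space M. ln (real (J 0 \<omega>)) > x}) \<sim>[at_top] (\<lambda>x. x powr (- \<alpha>) * L x)"
    and alpha1: "\<alpha> = 1 \<Longrightarrow> filterlim L at_top at_top"
    and b_pos: "\<forall>n\<ge>1. 0 < b n"
    and b_lim: "(\<lambda>n. real n * measure M {\<omega>\<in>space M. ln (real (J 0 \<omega>)) > b n}) \<longlonglongrightarrow> 1"
    and PRM: "is_PRM N (mean_meas 1 \<alpha>) (\<lambda>k \<omega>. (tt k \<omega>, jj k \<omega>))"
  shows "weak_conv_D M
           (\<lambda>n \<omega> t. log_plus (real (gwi xi J (nat \<lfloor>real n * t\<rfloor>) \<omega>)) / b n)
           N (\<lambda>\<omega> t. enn2real (SUP k\<in>{k. tt k \<omega> \<le> t}. jj k \<omega>))"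
proof -
  \<comment> \<open>Means of the process are computed as nonnegative integrals, which avoids
    integrability questions at every generation.\<close>
  have "(\<integral>\<^sup>+\<omega>. of_nat (xi 0 0 0 0 \<omega>) \<partial>M) = ennreal mu"
    using nn_integral_eq_integral[OF mean_int] mean by (simp add: ennreal_of_nat_eq_real_of_nat)
  then interpret X: gwi_process M xi J mu
    using M indep xi_iid mu_pos
    by (simp add: gwi_process_def gwi_process_axioms_def family_def[abs_def])
  define G where "G x = measure M {\<omega>\<in>space M. ln (real (J 0 \<omega>)) > x}" for x
  have anti: "antimono G"
  proof (rule antimonoI)
    fix x y :: real assume "x \<le> y"
    then show "G y \<le> G x" unfolding G_def
      by (intro X.finite_measure_mono) (auto intro: le_less_trans)
  qed
  have tailG: "G \<sim>[at_top] (\<lambda>x. x powr (- \<alpha>) * L x)" using tail by (simp add: G_def[abs_def])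
  have posG: "0 < G x" for x
    by (rule tail_pos[OF sv tailG anti]) (simp add: G_def)
  have b_limG: "(\<lambda>n. real n * G (b n)) \<longlonglongrightarrow> 1" using b_lim by (simp add: G_def)
  interpret I: immigration M J b \<alpha>
  proof unfold_locales
    show "(\<lambda>n. real n * measure M {\<omega>\<in>space M. ln (real (J 0 \<omega>)) > x * b n}) \<longlonglongrightarrow> x powr (- \<alpha>)" if "x > 0" for x
      using scaled_tail_tendsto[OF sv tailG anti posG b_limG that] by (simp add: G_def)
  qed (use X.J_indep J_iid alpha b_pos in auto)
  interpret P: poisson_points N \<alpha> "\<lambda>k \<omega>. (tt k \<omega>, jj k \<omega>)"
    by unfold_locales (use PRM alpha in auto)
  have superlin: "filterlim (\<lambda>n. b n / real n) at_top sequentially"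
    by (rule normalization_superlinear[OF sv tailG alpha(2) alpha1 anti posG b_limG])
  \<comment> \<open>The cap depends on K alone, so the grid stays fixed while n tends to
    infinity.\<close>
  obtain r where r: "\<And>K. K > 0 \<Longrightarrow> real K * (real (Suc (r K)) / real K) powr (- \<alpha>) \<le> 1 / real K"
    using ex_height_cap[OF alpha(1)] by metis
  have "weak_conv_D M (\<lambda>n \<omega> t. log_plus (real (gwi xi J (nat \<lfloor>real n * t\<rfloor>) \<omega>)) / b n)
           N (\<lambda>\<omega>. sup_path (\<lambda>k. (tt k \<omega>, jj k \<omega>)))"
  proof (rule weak_conv_D_point_configurations[where p="immigration_points J b" and r=r])
    show "prob_space M" by (rule M)
    show "prob_space N" by (rule P.prob_space_axioms)
    show "(\<lambda>\<omega>. fst (immigration_points J b n \<omega> k)) \<in> borel_measurable M"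
      "(\<lambda>\<omega>. snd (immigration_points J b n \<omega> k)) \<in> borel_measurable M" for n k
      by (rule I.points_measurable)+
    show "(\<lambda>\<omega>. fst (tt k \<omega>, jj k \<omega>)) \<in> borel_measurable N" "(\<lambda>\<omega>. snd (tt k \<omega>, jj k \<omega>)) \<in> borel_measurable N" for k
      by (rule measurable_compose[OF P.P_measurable measurable_fst] measurable_compose[OF P.P_measurable measurable_snd])+
    show "(\<lambda>\<omega> t. log_plus (real (gwi xi J (nat \<lfloor>real n * t\<rfloor>) \<omega>)) / b n) \<in> measurable M (PiM UNIV (\<lambda>_. borel))" for n
    proof (rule measurable_PiM_single')
      show "(\<lambda>\<omega>. log_plus (real (gwi xi J (nat \<lfloor>real n * t\<rfloor>) \<omega>)) / b n) \<in> borel_measurable M" for t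
        by (rule measurable_compose[OF X.gwi_measurable borel_measurable_count_space])
    qed auto
    show "cadlag (\<lambda>t. log_plus (real (gwi xi J (nat \<lfloor>real n * t\<rfloor>) \<omega>)) / b n)" for n \<omega>
      by (rule cadlag_step)
    show "AE \<omega> in N. cadlag (sup_path (\<lambda>k. (tt k \<omega>, jj k \<omega>)))" by (rule P.AE_cadlag)
    show "(\<lambda>n. measure M {\<omega>\<in>space M. cell K (r K) (immigration_points J b n \<omega>) \<inter> S = {}})
          \<longlonglongrightarrow> measure N {\<omega>\<in>space N. cell K (r K) (\<lambda>k. (tt k \<omega>, jj k \<omega>)) \<inter> S = {}}"
      if "K > 0" "S \<subseteq> {..<K ^ 5} \<times> {1..r K}" for K S
      unfolding P.void_prob_cell[OF that] by (rule I.void_prob_tendsto[OF that])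
    show "measure N {\<omega>\<in>space N. bad K (r K) (\<lambda>k. (tt k \<omega>, jj k \<omega>))} \<le> 4 / real K" if "K > 0" for K
      by (rule P.prob_bad_le[OF that r[OF that]])
    show "\<forall>\<^sub>F n in sequentially. \<exists>E\<in>sets M. measure M E \<le> 4 / real K \<and>
        (\<forall>\<omega>\<in>space M - E. \<not> bad K (r K) (immigration_points J b n \<omega>) \<and>
           (\<forall>t\<in>{0..real K}. \<bar>log_plus (real (gwi xi J (nat \<lfloor>real n * t\<rfloor>) \<omega>)) / b n
              - sup_path (immigration_points J b n \<omega>) t\<bar> \<le> 1 / real K))" if K: "K > 0" for K
      using I.eventually_prob_bad_le[OF K r[OF K]] X.eventually_close_to_maximum[OF superlin K]
    proof eventually_elim
      case (elim n)
      let ?B = "{\<omega>\<in>space M. bad K (r K) (immigration_points J b n \<omega>)}"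
      have B: "?B \<in> sets M" by (rule sets_bad) (rule I.points_measurable)+
      obtain E where E: "E \<in> sets M" "measure M E \<le> 1 / real K"
        and close: "\<And>\<omega> t. \<omega> \<in> space M - E \<Longrightarrow> t \<in> {0..real K} \<Longrightarrow>
          \<bar>log_plus (real (gwi xi J (nat \<lfloor>real n * t\<rfloor>) \<omega>)) / b n - sup_path (immigration_points J b n \<omega>) t\<bar> \<le> 1 / real K"
        using elim(2) by blast
      have "measure M (?B \<union> E) \<le> measure M ?B + measure M E" by (rule measure_Un_le[OF B E(1)])
      \<comment> \<open>The error budget: 3/K for a bad immigration configuration and 1/K for the
        failed comparison with the running maximum.\<close>
      also have "\<dots> \<le> 3 / real K + 1 / real K" using elim(1) E(2) by (rule add_mono)
      also have "\<dots> = 4 / real K" by (simp flip: add_divide_distrib)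
      finally have "measure M (?B \<union> E) \<le> 4 / real K" .
      then show ?case using B E close by (intro bexI[of _ "?B \<union> E"]) auto
    qed
  qed
  then show ?thesis by (simp add: sup_path_def[abs_def])
qed

end
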